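(* Let $\widehat S\in\mathrm{Mp}_+(d,\mathbb{C})$ have projection $S\in\mathrm{Sp}_+(d,\mathbb{C})$. Then, for every $f\in L^2(\mathbb{R}^d)$, $z\in\mathbb{R}^{2d}$ and $\tau\in\mathbb{R}$, $$\widehat S\rho(z;\tau)f=\rho(Sz;\tau)\widehat Sf\qquad\text{in } S_{1/2}^{1/2}(\mathbb{R}^d)'.$$ Moreover, the right-hand side is represented by the $L^2$ function on the left. Equivalently, for all $z\in\mathbb{R}^{2d}$, $\tau\in\mathbb{R}$, $$\mathrm{range}(\widehat S)\subseteq\{u\in L^2(\mathbb{R}^d):\rho(Sz;\tau)u\text{ is represented by an }L^2\text{ function}\},$$ and on all of $L^2(\mathbb{R}^d)$, $$\rho(Sz;\tau)\widehat S=\widehat S\rho(z;\tau)\in\mathcal{B}(L^2(\mathbb{R}^d)).$$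
   Context: Symplectic matrices. $J=\begin{pmatrix} O& I\\ -I& O\end{pmatrix}\in\mathbb{R}^{2d\times 2d}$; $\mathrm{Sp}(d,\mathbb{C})$ is the group of $S\in\mathbb{C}^{2d\times2d}$ with $S^\top JS=J$. $\mathrm{Sp}_+(d,\mathbb{C})$ is the semigroup of $S\in\mathrm{Sp}(d,\mathbb{C})$ such that the Hermitian matrix $H_S=i^{-1}(S^*JS-J)$ is positive semidefinite ($S^*$ is the conjugate transpose). $\mathcal{B}(L^2(\mathbb{R}^d))$ is the space of bounded linear operators on $L^2(\mathbb{R}^d)$. Gelfand-Shilov space. For $h>0$, $S_{1/2,h}^{1/2}(\mathbb{R}^d)$ is the Banach space of $\varphi\in C^\infty(\mathbb{R}^d)$ with $\|\varphi\|_h=\sup_{t\in\mathbb{R}^d,\ \beta,\gamma\in\mathbb{N}^d}\frac{|t^\beta\partial^\gamma\varphi(t)|}{h^{|\beta+\gamma|}(\beta!\gamma!)^{1/2}}<\infty$. $S_{1/2}^{1/2}(\mathbb{R}^d)=\bigcup_{h>0}S_{1/2,h}^{1/2}(\mathbb{R}^d)$ with the inductive-limit topology, and $S_{1/2}^{1/2}(\mathbb{R}^d)'$ is its topological dual, with bilinear pairing $\langle u,\varphi\rangle$. Each $f\in L^2(\mathbb{R}^d)$ is identified with the element $\varphi\mapsto\int f\varphi\,dt$ of $S_{1/2}^{1/2}(\mathbb{R}^d)'$ ("represented by $f$"). Complex Schrödinger action. $x\cdot y=\sum_j x_jy_j$ is bilinear on $\mathbb{C}^d$. For $x,\xi\in\mathbb{C}^d$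 and $\varphi\in S_{1/2}^{1/2}(\mathbb{R}^d)$ put $M_\xi\varphi(t)=e^{2\pi i\xi\cdot t}\varphi(t)$ and $T_x\varphi=\mathcal{F}^{-1}\big(e^{-2\pi i x\cdot\omega}\widehat\varphi(\omega)\big)$, with $\mathcal{F}$ the Fourier transform (kernel $e^{-2\pi i\omega\cdot t}$); these are continuous automorphisms of $S_{1/2}^{1/2}(\mathbb{R}^d)$. Extend to the dual by $\langle M_\xi u,\varphi\rangle=\langle u,M_\xi\varphi\rangle$, $\langle T_xu,\varphi\rangle=\langle u,T_{-x}\varphi\rangle$. For $x,\xi\in\mathbb{C}^d$, $\tau\in\mathbb{R}$ set $\rho(x,\xi;\tau)=e^{2\pi i\tau}e^{-i\pi x\cdot\xi}M_\xi T_x$ on $S_{1/2}^{1/2}(\mathbb{R}^d)'$. For $x,\xi\in\mathbb{R}^d$ and $f\in L^2(\mathbb{R}^d)$ this is the unitary Schrödinger representation $\rho(x,\xi;\tau)f(t)=e^{2\pi i\tau}e^{-i\pi x\cdot\xi}e^{2\pi i\xi\cdot t}f(t-x)$. Oscillator semigroup. $\mathrm{Mp}_+(d,\mathbb{C})$ is the two-fold cover of $\mathrm{Sp}_+(d,\mathbb{C})$ realized as the semigroup of bounded operators on $L^2(\mathbb{R}^d)$ generated by: the Fourier transform $\mathcal{F}f(\xi)=i^{-d/2}\int f(t)e^{-2\pi i\xi\cdot t}dt$; the operators $\mathfrak{T}_Ef(t)=i^m|\det E|^{1/2}f(Et)$, $E\in\mathrm{GL}(d,\mathbb{R})$, with $m$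 an integer such that $m\pi\equiv\arg\det E \pmod{2\pi}$; and the operators $\mathfrak{p}_Qf(t)=e^{i\pi Qt\cdot t}f(t)$ with $Q\in\mathbb{C}^{d\times d}$ symmetric, $\mathrm{Im}\,Q\ge0$. The projection $\pi_+^{Mp}:\mathrm{Mp}_+(d,\mathbb{C})\to\mathrm{Sp}_+(d,\mathbb{C})$ is the (well-defined, surjective, two-to-one) semigroup homomorphism determined by $\pi_+^{Mp}(\mathcal{F})=J$, $\pi_+^{Mp}(\mathfrak{T}_E)=\begin{pmatrix}E^{-1}&O\\O&E^\top\end{pmatrix}$, $\pi_+^{Mp}(\mathfrak{p}_Q)=\begin{pmatrix}I&O\\Q&I\end{pmatrix}$. "$\widehat S$ has projection $S$" means $\pi_+^{Mp}(\widehat S)=S$. *)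

theory Defs
  imports "HOL-Analysis.Analysis" "HOL-Library.FuncSet"
begin

section \<open>The Hilbert space \<open>L\<^sup>2(\<real>\<^sup>d)\<close>\<close>

definition sq_integrable :: "(real^'d \<Rightarrow> complex) \<Rightarrow> bool" where
  "sq_integrable f \<longleftrightarrow>
     f \<in> borel_measurable lborel \<and> integrable lborel (\<lambda>t. (cmod (f t))\<^sup>2)"

definition L2_rel :: "(real^'d \<Rightarrow> complex) \<Rightarrow> (real^'d \<Rightarrow> complex) \<Rightarrow> bool" where
  "L2_rel f g \<longleftrightarrow> sq_integrable f \<and> sq_integrable g \<and> (AE t in lborel. f t = g t)"

lemma sq_integrable_0: "sq_integrable (\<lambda>_. 0)"
  by (simp add: sq_integrable_def)

lemma sq_integrable_scale:
  assumes "sq_integrable f"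
  shows "sq_integrable (\<lambda>t. c * f t)"
  using assms by (auto simp: sq_integrable_def norm_mult power_mult_distrib)

lemma sq_integrable_add:
  assumes "sq_integrable f" "sq_integrable g"
  shows "sq_integrable (\<lambda>t. f t + g t)"
proof -
  have [measurable]: "f \<in> borel_measurable lborel" "g \<in> borel_measurable lborel"
    using assms by (auto simp: sq_integrable_def)
  have *: "(cmod (a + b))\<^sup>2 \<le> 2 * (cmod a)\<^sup>2 + 2 * (cmod b)\<^sup>2" for a b :: complex
  proof -
    have "(cmod (a + b))\<^sup>2 \<le> (cmod a + cmod b)\<^sup>2"
      by (simp add: norm_triangle_ineq power_mono)
    also have "\<dots> \<le> 2 * (cmod a)\<^sup>2 + 2 * (cmod b)\<^sup>2"
      using sum_squares_bound[of "cmod a" "cmod b"] by (simp add: power2_sum)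
    finally show ?thesis .
  qed
  have "integrable lborel (\<lambda>t. 2 * (cmod (f t))\<^sup>2 + 2 * (cmod (g t))\<^sup>2)"
    using assms by (auto simp: sq_integrable_def)
  then have "integrable lborel (\<lambda>t. (cmod (f t + g t))\<^sup>2)"
    by (rule Bochner_Integration.integrable_bound) (auto intro!: AE_I2 *)
  then show ?thesis by (simp add: sq_integrable_def)
qed

quotient_type (overloaded) 'd L2 = "real^'d::finite \<Rightarrow> complex" / partial: L2_rel
  morphisms rep_L2 L2_class
proof (rule part_equivpI)
  show "\<exists>f. L2_rel f (f :: real^'d \<Rightarrow> complex)"
    using sq_integrable_0 by (auto simp: L2_rel_def)
  show "symp (L2_rel :: (real^'d \<Rightarrow> complex) \<Rightarrow> _)"
    by (auto simp: symp_def L2_rel_def)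
  show "transp (L2_rel :: (real^'d \<Rightarrow> complex) \<Rightarrow> _)"
    by (auto simp: transp_def L2_rel_def)
qed

lemma sq_integrable_rep_L2: "sq_integrable (rep_L2 f)"
  using Quotient_rep_reflp[OF Quotient_L2, of f] by (auto simp: L2_rel_def)

lemma L2_class_rep_L2: "L2_class (rep_L2 f) = f"
  using Quotient_abs_rep[OF Quotient_L2] .

lemma rep_L2_L2_class:
  assumes "sq_integrable f"
  shows "AE t in lborel. rep_L2 (L2_class f) t = f t"
  using Quotient_rep_abs[OF Quotient_L2, of f] assms by (auto simp: L2_rel_def)

instantiation L2 :: (finite) real_normed_vector
begin

lift_definition zero_L2 :: "'a L2" is "\<lambda>_. 0"
  by (auto simp: L2_rel_def sq_integrable_0)

lift_definition plus_L2 :: "'a L2 \<Rightarrow> 'a L2 \<Rightarrow> 'a L2" is "\<lambda>f g t. f t + g t"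
  by (auto simp: L2_rel_def sq_integrable_add)

lift_definition uminus_L2 :: "'a L2 \<Rightarrow> 'a L2" is "\<lambda>f t. - f t"
  using sq_integrable_scale[of _ "-1"] by (auto simp: L2_rel_def)

definition minus_L2 :: "'a L2 \<Rightarrow> 'a L2 \<Rightarrow> 'a L2" where
  "minus_L2 f g = f + - g"

lift_definition scaleR_L2 :: "real \<Rightarrow> 'a L2 \<Rightarrow> 'a L2" is "\<lambda>r f t. complex_of_real r * f t"
  by (auto simp: L2_rel_def sq_integrable_scale)

lift_definition norm_L2 :: "'a L2 \<Rightarrow> real" is "\<lambda>f. sqrt (LINT t|lborel. (cmod (f t))\<^sup>2)"
proof -
  fix f g :: "real^'a \<Rightarrow> complex"
  assume "L2_rel f g"
  then have "(LINT t|lborel. (cmod (f t))\<^sup>2) = (LINT t|lborel. (cmod (g t))\<^sup>2)"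
    by (intro integral_cong_AE) (auto simp: L2_rel_def sq_integrable_def)
  then show "sqrt (LINT t|lborel. (cmod (f t))\<^sup>2) = sqrt (LINT t|lborel. (cmod (g t))\<^sup>2)"
    by simp
qed

definition dist_L2 :: "'a L2 \<Rightarrow> 'a L2 \<Rightarrow> real" where
  "dist_L2 f g = norm (f - g)"

definition sgn_L2 :: "'a L2 \<Rightarrow> 'a L2" where
  "sgn_L2 f = inverse (norm f) *\<^sub>R f"

definition uniformity_L2 :: "('a L2 \<times> 'a L2) filter" where
  "uniformity_L2 = (INF e\<in>{0<..}. principal {(x, y). dist x y < e})"

definition open_L2 :: "'a L2 set \<Rightarrow> bool" where
  "open_L2 U \<longleftrightarrow> (\<forall>x\<in>U. eventually (\<lambda>(x', y). x' = x \<longrightarrow> y \<in> U) uniformity)"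

lemma L2_minkowski:
  fixes f g :: "real^'b \<Rightarrow> complex"
  assumes f: "sq_integrable f" and g: "sq_integrable g"
  shows "sqrt (LINT t|lborel. (cmod (f t + g t))\<^sup>2)
       \<le> sqrt (LINT t|lborel. (cmod (f t))\<^sup>2) + sqrt (LINT t|lborel. (cmod (g t))\<^sup>2)"
proof -
  define a where "a = sqrt (LINT t|lborel. (cmod (f t))\<^sup>2)"
  define b where "b = sqrt (LINT t|lborel. (cmod (g t))\<^sup>2)"
  have [measurable]: "f \<in> borel_measurable lborel" "g \<in> borel_measurable lborel"
    using f g by (auto simp: sq_integrable_def)
  have fi: "integrable lborel (\<lambda>t. (cmod (f t))\<^sup>2)" and gi: "integrable lborel (\<lambda>t. (cmod (g t))\<^sup>2)"
    using f g by (auto simp: sq_integrable_def)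
  have a2: "(LINT t|lborel. (cmod (f t))\<^sup>2) = a\<^sup>2" and b2: "(LINT t|lborel. (cmod (g t))\<^sup>2) = b\<^sup>2"
    by (simp_all add: a_def b_def)
  have nn: "a \<ge> 0" "b \<ge> 0" by (simp_all add: a_def b_def)
  have AE0: "AE t in lborel. h t = 0"
    if "integrable lborel (\<lambda>t. (cmod (h t))\<^sup>2)" "(LINT t|lborel. (cmod (h t))\<^sup>2) = 0"
    for h :: "real^'b \<Rightarrow> complex"
    using that integral_nonneg_eq_0_iff_AE[of lborel "\<lambda>t. (cmod (h t))\<^sup>2"] by auto
  consider "a = 0" | "b = 0" | "a > 0" "b > 0" using nn by linarith
  then have "(LINT t|lborel. (cmod (f t + g t))\<^sup>2) \<le> (a + b)\<^sup>2"
  proof cases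
    case 1
    then have "AE t in lborel. f t = 0" using AE0[OF fi] a2 by simp
    then have "(LINT t|lborel. (cmod (f t + g t))\<^sup>2) = (LINT t|lborel. (cmod (g t))\<^sup>2)"
      by (intro integral_cong_AE) auto
    then show ?thesis using 1 b2 by simp
  next
    case 2
    then have "AE t in lborel. g t = 0" using AE0[OF gi] b2 by simp
    then have "(LINT t|lborel. (cmod (f t + g t))\<^sup>2) = (LINT t|lborel. (cmod (f t))\<^sup>2)"
      by (intro integral_cong_AE) auto
    then show ?thesis using 2 a2 by simp
  next
    case 3
    have *: "(cmod (u + v))\<^sup>2 \<le> (1 + b / a) * (cmod u)\<^sup>2 + (1 + a / b) * (cmod v)\<^sup>2" for u v
    proof -
      have "(cmod (u + v))\<^sup>2 \<le> (cmod u + cmod v)\<^sup>2"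
        by (simp add: norm_triangle_ineq power_mono)
      also have "\<dots> = (1 + b / a) * (cmod u)\<^sup>2 + (1 + a / b) * (cmod v)\<^sup>2
                       - (b * cmod u - a * cmod v)\<^sup>2 / (a * b)"
        using 3 by (simp add: field_simps power2_eq_square)
      also have "\<dots> \<le> (1 + b / a) * (cmod u)\<^sup>2 + (1 + a / b) * (cmod v)\<^sup>2"
        using 3 by simp
      finally show ?thesis .
    qed
    have "(LINT t|lborel. (cmod (f t + g t))\<^sup>2)
        \<le> (LINT t|lborel. (1 + b / a) * (cmod (f t))\<^sup>2 + (1 + a / b) * (cmod (g t))\<^sup>2)"
      using sq_integrable_add[OF f g] fi gi
      by (intro integral_mono *) (auto simp: sq_integrable_def)
    also have "\<dots> = (1 + b / a) * a\<^sup>2 + (1 + a / b) * b\<^sup>2"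
      using fi gi by (simp add: a2 b2)
    also have "\<dots> = (a + b)\<^sup>2"
      using 3 by (simp add: field_simps power2_eq_square)
    finally show ?thesis .
  qed
  then have "sqrt (LINT t|lborel. (cmod (f t + g t))\<^sup>2) \<le> a + b"
    using nn by (intro real_le_lsqrt) auto
  then show ?thesis by (simp add: a_def b_def)
qed

instance
proof
  fix f g h :: "'a L2" and r s :: real
  note [simp] = L2_rel_def sq_integrable_add sq_integrable_scale sq_integrable_0
  have neg: "sq_integrable (\<lambda>t. - k t)" if "sq_integrable k" for k :: "real^'a \<Rightarrow> complex"
    using sq_integrable_scale[OF that, of "-1"] by simp
  note [simp] = neg
  show "f + g + h = f + (g + h)" by transfer (auto simp: add.assoc)
  show "f + g = g + f" by transfer (auto simp: add.commute)
  show "0 + f = f" by transfer auto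
  show "- f + f = 0" by transfer auto
  show "f - g = f + - g" by (rule minus_L2_def)
  show "r *\<^sub>R (f + g) = r *\<^sub>R f + r *\<^sub>R g" by transfer (auto simp: distrib_left)
  show "(r + s) *\<^sub>R f = r *\<^sub>R f + s *\<^sub>R f" by transfer (auto simp: distrib_right)
  show "r *\<^sub>R s *\<^sub>R f = (r * s) *\<^sub>R f" by transfer (auto simp: mult.assoc)
  show "1 *\<^sub>R f = f" by transfer auto
  show "dist f g = norm (f - g)" by (rule dist_L2_def)
  show "sgn f = inverse (norm f) *\<^sub>R f" by (rule sgn_L2_def)
  show "(uniformity :: ('a L2 \<times> 'a L2) filter) = (INF e\<in>{0<..}. principal {(x, y). dist x y < e})"
    by (rule uniformity_L2_def)
  show "open U \<longleftrightarrow> (\<forall>x\<in>U. eventually (\<lambda>(x', y). x' = x \<longrightarrow> y \<in> U) uniformity)" for U :: "'a L2 set"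
    by (rule open_L2_def)
  show "norm f = 0 \<longleftrightarrow> f = 0"
  proof transfer
    fix f :: "real^'a \<Rightarrow> complex"
    assume "L2_rel f f"
    then show "sqrt (LINT t|lborel. (cmod (f t))\<^sup>2) = 0 \<longleftrightarrow> L2_rel f (\<lambda>_. 0)"
      using integral_nonneg_eq_0_iff_AE[of lborel "\<lambda>t. (cmod (f t))\<^sup>2"]
      by (auto simp: sq_integrable_def)
  qed
  show "norm (f + g) \<le> norm f + norm g"
    by transfer (auto intro: L2_minkowski)
  show "norm (r *\<^sub>R f) = \<bar>r\<bar> * norm f"
    by transfer (simp add: norm_mult power_mult_distrib real_sqrt_mult)
qed

end

lift_definition scaleC_L2 :: "complex \<Rightarrow> 'd::finite L2 \<Rightarrow> 'd L2" is "\<lambda>c f t. c * f t"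
  by (auto simp: L2_rel_def sq_integrable_scale)

definition bounded_ops :: "('d::finite L2 \<Rightarrow> 'd L2) set" where
  "bounded_ops = {A. bounded_linear A \<and> (\<forall>c f. A (scaleC_L2 c f) = scaleC_L2 c (A f))}"


section \<open>Symplectic matrices\<close>

text \<open>The index type \<^typ>\<open>'d + 'd\<close> gives \<open>2d\<close> coordinates: \<open>z = (x, \<xi>)\<close> has
  \<open>x\<close> in the \<^const>\<open>Inl\<close> and \<open>\<xi>\<close> in the \<^const>\<open>Inr\<close> components.\<close>

definition block_matrix ::
    "'a^'d^'d \<Rightarrow> 'a^'d^'d \<Rightarrow> 'a^'d^'d \<Rightarrow> 'a^'d^'d \<Rightarrow> 'a^('d::finite + 'd)^('d + 'd)" where
  "block_matrix A B C D = (\<chi> i j. case (i, j) of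
      (Inl k, Inl l) \<Rightarrow> A $ k $ l
    | (Inl k, Inr l) \<Rightarrow> B $ k $ l
    | (Inr k, Inl l) \<Rightarrow> C $ k $ l
    | (Inr k, Inr l) \<Rightarrow> D $ k $ l)"

definition fst_part :: "'a^('d::finite + 'd) \<Rightarrow> 'a^'d" where
  "fst_part z = (\<chi> j. z $ Inl j)"

definition snd_part :: "'a^('d::finite + 'd) \<Rightarrow> 'a^'d" where
  "snd_part z = (\<chi> j. z $ Inr j)"

definition cvec :: "real^'n \<Rightarrow> complex^'n" where
  "cvec v = (\<chi> j. complex_of_real (v $ j))"

definition bdot :: "complex^'n \<Rightarrow> complex^'n \<Rightarrow> complex"  (infixl "\<bullet>\<^sub>c" 70) where
  "x \<bullet>\<^sub>c y = (\<Sum>j\<in>UNIV. x $ j * y $ j)"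

definition J_mat :: "complex^('d::finite + 'd)^('d + 'd)" where
  "J_mat = block_matrix 0 (mat 1) (- mat 1) 0"

definition conj_transpose :: "complex^'n^'m \<Rightarrow> complex^'m^'n" where
  "conj_transpose A = map_matrix cnj (transpose A)"

definition hermitian_psd :: "complex^'n^'n \<Rightarrow> bool" where
  "hermitian_psd H \<longleftrightarrow>
     conj_transpose H = H \<and> (\<forall>v. 0 \<le> Re ((\<chi> j. cnj (v $ j)) \<bullet>\<^sub>c (H *v v)))"

definition Sp :: "(complex^('d::finite + 'd)^('d + 'd)) set" where
  "Sp = {S. transpose S ** J_mat ** S = J_mat}"

definition Sp_plus :: "(complex^('d::finite + 'd)^('d + 'd)) set" where
  "Sp_plus = {S \<in> Sp.
     hermitian_psd (map_matrix (\<lambda>c. inverse \<i> * c) (conj_transpose S ** J_mat ** S - J_mat))}"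


section \<open>The oscillator semigroup\<close>

text \<open>The integral transform with kernel \<open>exp (-2 \<pi> i \<omega> \<cdot> t)\<close> and no normalising factor.\<close>

definition fourier :: "(real^'d \<Rightarrow> complex) \<Rightarrow> real^'d \<Rightarrow> complex" where
  "fourier f \<omega> = (LINT t|lborel. f t * exp (- (2 * pi * \<i> * complex_of_real (\<omega> \<bullet> t))))"

definition inv_fourier :: "(real^'d \<Rightarrow> complex) \<Rightarrow> real^'d \<Rightarrow> complex" where
  "inv_fourier g t = (LINT \<omega>|lborel. g \<omega> * exp (2 * pi * \<i> * complex_of_real (\<omega> \<bullet> t)))"

text \<open>The Fourier integral with the factor \<open>i\<^bsup>-d/2\<^esup>\<close> only converges on \<open>L\<^sup>1 \<inter> L\<^sup>2\<close>; the operator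
  \<open>F\<close> on \<open>L\<^sup>2\<close> is its continuous extension. The extension exists and is unique by Plancherel's
  theorem and density, so the predicate below holds for exactly one \<open>F\<close>. The power of \<open>\<i>\<close>
  takes the principal branch; the other branch differs by the sign, that is by the generator
  \<open>dilation_op (mat 1) 2\<close>, whose projection is the identity.\<close>

definition is_fourier_L2 :: "('d::finite L2 \<Rightarrow> 'd L2) \<Rightarrow> bool" where
  "is_fourier_L2 F \<longleftrightarrow> F \<in> bounded_ops \<and>
     (\<forall>f :: real^'d \<Rightarrow> complex. sq_integrable f \<and> integrable lborel f \<longrightarrow>
        sq_integrable (fourier f) \<and>
        F (L2_class f) = L2_class (\<lambda>\<xi>. \<i> powr (- (of_nat CARD('d) / 2)) * fourier f \<xi>))"

text \<open>Here and below an operator on \<^typ>\<open>'d L2\<close> is given by its formula on the representative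
  \<^const>\<open>rep_L2\<close>; for the parameters actually used, the formula preserves square integrability
  and equality almost everywhere, so the choice of representative does not matter.\<close>

definition dilation_op :: "real^'d^'d \<Rightarrow> int \<Rightarrow> 'd::finite L2 \<Rightarrow> 'd L2" where
  "dilation_op E m f =
     L2_class (\<lambda>t. \<i> powi m * complex_of_real (sqrt \<bar>det E\<bar>) * rep_L2 f (E *v t))"

definition chirp_op :: "complex^'d^'d \<Rightarrow> 'd::finite L2 \<Rightarrow> 'd L2" where
  "chirp_op Q f =
     L2_class (\<lambda>t. exp (\<i> * pi * ((Q *v cvec t) \<bullet>\<^sub>c cvec t)) * rep_L2 f t)"

text \<open>\<open>arg det E\<close> for real \<open>E\<close>; \<^const>\<open>Arg\<close> is \<open>0\<close> or \<open>\<pi>\<close> on the nonzero reals.\<close>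

definition dilation_index :: "real^'d^'d \<Rightarrow> int \<Rightarrow> bool" where
  "dilation_index E m \<longleftrightarrow>
     (\<exists>k::int. real_of_int m * pi = Arg (complex_of_real (det E)) + 2 * pi * real_of_int k)"

definition im_nonneg :: "complex^'d^'d \<Rightarrow> bool" where
  "im_nonneg Q \<longleftrightarrow> (\<forall>t. 0 \<le> (map_matrix Im Q *v t) \<bullet> t)"

inductive Mp_generator ::
    "('d::finite L2 \<Rightarrow> 'd L2) \<Rightarrow> complex^('d + 'd)^('d + 'd) \<Rightarrow> bool" where
  fourier: "is_fourier_L2 F \<Longrightarrow> Mp_generator F J_mat"
| dilation: "invertible E \<Longrightarrow> dilation_index E m \<Longrightarrow>
    Mp_generator (dilation_op E m)
      (block_matrix (map_matrix complex_of_real (matrix_inv E)) 0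
                    0 (map_matrix complex_of_real (transpose E)))"
| chirp: "transpose Q = Q \<Longrightarrow> im_nonneg Q \<Longrightarrow>
    Mp_generator (chirp_op Q) (block_matrix (mat 1) 0 Q (mat 1))"

inductive_set Mp_plus :: "('d::finite L2 \<Rightarrow> 'd L2) set" where
  gen: "Mp_generator A S \<Longrightarrow> A \<in> Mp_plus"
| comp: "A \<in> Mp_plus \<Longrightarrow> B \<in> Mp_plus \<Longrightarrow> A \<circ> B \<in> Mp_plus"

text \<open>The graph of the projection \<open>\<pi>\<^sub>+\<close> from \<^const>\<open>Mp_plus\<close> to \<^const>\<open>Sp_plus\<close>: a homomorphism
  prescribed on generators has as its graph the semigroup of pairs generated by the prescribed
  ones.\<close>

inductive Mp_projection ::
    "('d::finite L2 \<Rightarrow> 'd L2) \<Rightarrow> complex^('d + 'd)^('d + 'd) \<Rightarrow> bool" where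
  gen: "Mp_generator A S \<Longrightarrow> Mp_projection A S"
| comp: "Mp_projection A S \<Longrightarrow> Mp_projection B R \<Longrightarrow> Mp_projection (A \<circ> B) (S ** R)"


section \<open>The Gelfand--Shilov space \<open>S\<^bsub>1/2\<^esub>\<^bsup>1/2\<^esup>(\<real>\<^sup>d)\<close> and its dual\<close>

definition partial_deriv :: "'d \<Rightarrow> (real^'d \<Rightarrow> complex) \<Rightarrow> real^'d \<Rightarrow> complex" where
  "partial_deriv j \<phi> t = vector_derivative (\<lambda>s. \<phi> (t + s *\<^sub>R axis j 1)) (at 0)"

definition iter_deriv :: "'d list \<Rightarrow> (real^'d \<Rightarrow> complex) \<Rightarrow> real^'d \<Rightarrow> complex" where
  "iter_deriv js \<phi> = foldr partial_deriv js \<phi>"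

definition smooth :: "(real^'d \<Rightarrow> complex) \<Rightarrow> bool" where
  "smooth \<phi> \<longleftrightarrow> (\<forall>js. iter_deriv js \<phi> differentiable_on UNIV)"

text \<open>\<open>\<partial>\<^sup>\<gamma>\<close> for a multi-index \<open>\<gamma>\<close>: differentiate \<open>\<gamma>\<^sub>j\<close> times in the \<open>j\<close>-th coordinate, in some
  order. On smooth functions the order is irrelevant.\<close>

definition multi_deriv :: "nat^'d::finite \<Rightarrow> (real^'d \<Rightarrow> complex) \<Rightarrow> real^'d \<Rightarrow> complex" where
  "multi_deriv \<gamma> = iter_deriv (SOME js. \<forall>j. count_list js j = \<gamma> $ j)"

definition monomial :: "nat^'d::finite \<Rightarrow> real^'d \<Rightarrow> real" where
  "monomial \<beta> t = (\<Prod>j\<in>UNIV. (t $ j) ^ (\<beta> $ j))"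

definition mi_size :: "nat^'d::finite \<Rightarrow> nat" where
  "mi_size \<beta> = (\<Sum>j\<in>UNIV. \<beta> $ j)"

definition mi_fact :: "nat^'d::finite \<Rightarrow> real" where
  "mi_fact \<beta> = (\<Prod>j\<in>UNIV. fact (\<beta> $ j))"

definition gs_norm :: "real \<Rightarrow> (real^'d::finite \<Rightarrow> complex) \<Rightarrow> ennreal" where
  "gs_norm h \<phi> = (SUP (t, \<beta>, \<gamma>) \<in> UNIV.
     ennreal (cmod (complex_of_real (monomial \<beta> t) * multi_deriv \<gamma> \<phi> t) /
              (h ^ mi_size (\<beta> + \<gamma>) * sqrt (mi_fact \<beta> * mi_fact \<gamma>))))"

definition gs_banach :: "real \<Rightarrow> (real^'d::finite \<Rightarrow> complex) set" where
  "gs_banach h = {\<phi>. smooth \<phi> \<and> gs_norm h \<phi> < \<infinity>}"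

definition gs_space :: "(real^'d::finite \<Rightarrow> complex) set" where
  "gs_space = (\<Union>h\<in>{0<..}. gs_banach h)"

text \<open>The (locally convex) inductive-limit topology: a base of neighbourhoods of \<open>0\<close> consists of
  the absolutely convex sets that meet every step \<^term>\<open>gs_banach h\<close> in a neighbourhood of \<open>0\<close>
  of that Banach space.\<close>

definition gs_nhd0 :: "(real^'d::finite \<Rightarrow> complex) set \<Rightarrow> bool" where
  "gs_nhd0 V \<longleftrightarrow> V \<subseteq> gs_space \<and>
     (\<forall>\<phi>\<in>V. \<forall>\<psi>\<in>V. \<forall>a b. cmod a + cmod b \<le> 1 \<longrightarrow> (\<lambda>t. a * \<phi> t + b * \<psi> t) \<in> V) \<and>
     (\<forall>h>0. \<exists>\<epsilon>>0. \<forall>\<phi>\<in>gs_banach h. gs_norm h \<phi> < ennreal \<epsilon> \<longrightarrow> \<phi> \<in> V)"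

definition gs_open :: "(real^'d::finite \<Rightarrow> complex) set \<Rightarrow> bool" where
  "gs_open U \<longleftrightarrow> U \<subseteq> gs_space \<and>
     (\<forall>\<phi>\<in>U. \<exists>V. gs_nhd0 V \<and> (\<forall>\<psi>\<in>V. (\<lambda>t. \<phi> t + \<psi> t) \<in> U))"

definition gs_topology :: "(real^'d::finite \<Rightarrow> complex) topology" where
  "gs_topology = topology gs_open"

lemma gs_nhd0_Int:
  assumes V: "gs_nhd0 V" and W: "gs_nhd0 W"
  shows "gs_nhd0 (V \<inter> W)"
proof -
  have "\<exists>\<epsilon>>0. \<forall>\<phi>\<in>gs_banach h. gs_norm h \<phi> < ennreal \<epsilon> \<longrightarrow> \<phi> \<in> V \<inter> W" if h: "h > 0" for h
  proof -
    obtain d where d: "d > 0" "\<forall>\<phi>\<in>gs_banach h. gs_norm h \<phi> < ennreal d \<longrightarrow> \<phi> \<in> V"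
      using V h unfolding gs_nhd0_def by blast
    obtain e where e: "e > 0" "\<forall>\<phi>\<in>gs_banach h. gs_norm h \<phi> < ennreal e \<longrightarrow> \<phi> \<in> W"
      using W h unfolding gs_nhd0_def by blast
    have "x < ennreal d \<and> x < ennreal e" if "x < ennreal (min d e)" for x
      using that by (meson ennreal_leI min.cobounded1 min.cobounded2 order_less_le_trans)
    then show ?thesis using d e by (intro exI[of _ "min d e"]) auto
  qed
  then show ?thesis using V W unfolding gs_nhd0_def by blast
qed

lemma istopology_gs_open: "istopology gs_open"
  unfolding istopology_def
proof (intro conjI allI impI)
  fix U W :: "(real^'d \<Rightarrow> complex) set"
  assume U: "gs_open U" and W: "gs_open W"
  show "gs_open (U \<inter> W)"
    unfolding gs_open_def
  proof (intro conjI ballI)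
    show "U \<inter> W \<subseteq> gs_space" using U by (auto simp: gs_open_def)
    fix \<phi> assume "\<phi> \<in> U \<inter> W"
    then obtain V V' where
      "gs_nhd0 V" "\<forall>\<psi>\<in>V. (\<lambda>t. \<phi> t + \<psi> t) \<in> U" "gs_nhd0 V'" "\<forall>\<psi>\<in>V'. (\<lambda>t. \<phi> t + \<psi> t) \<in> W"
      using U W unfolding gs_open_def by blast
    then show "\<exists>V. gs_nhd0 V \<and> (\<forall>\<psi>\<in>V. (\<lambda>t. \<phi> t + \<psi> t) \<in> U \<inter> W)"
      by (intro exI[of _ "V \<inter> V'"]) (auto intro: gs_nhd0_Int)
  qed
next
  fix \<K> :: "(real^'d \<Rightarrow> complex) set set"
  assume "\<forall>K\<in>\<K>. gs_open K"
  then show "gs_open (\<Union>\<K>)"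
    unfolding gs_open_def by (metis Sup_le_iff Union_iff)
qed

lemma openin_gs_topology: "openin gs_topology U \<longleftrightarrow> gs_open U"
  by (simp add: gs_topology_def istopology_gs_open topology_inverse')

text \<open>Functionals on \<^const>\<open>gs_space\<close> are \<^const>\<open>extensional\<close> there, so that equality in the dual is
  equality of Isabelle functions. The pairing of \<open>u\<close> and \<open>\<phi>\<close> is \<open>u \<phi>\<close>.\<close>

type_synonym 'd functional = "(real^'d \<Rightarrow> complex) \<Rightarrow> complex"

definition gs_dual :: "'d::finite functional set" where
  "gs_dual = {u \<in> extensional gs_space.
     (\<forall>\<phi>\<in>gs_space. \<forall>\<psi>\<in>gs_space. u (\<lambda>t. \<phi> t + \<psi> t) = u \<phi> + u \<psi>) \<and>
     (\<forall>c. \<forall>\<phi>\<in>gs_space. u (\<lambda>t. c * \<phi> t) = c * u \<phi>) \<and>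
     continuous_map gs_topology euclidean u}"

definition of_L2 :: "'d::finite L2 \<Rightarrow> 'd functional" where
  "of_L2 f = (\<lambda>\<phi>\<in>gs_space. LINT t|lborel. rep_L2 f t * \<phi> t)"


section \<open>The Schroedinger representation and its complex extension\<close>

definition mod_fun :: "complex^'d \<Rightarrow> (real^'d \<Rightarrow> complex) \<Rightarrow> real^'d \<Rightarrow> complex" where
  "mod_fun \<xi> \<phi> t = exp (2 * pi * \<i> * (\<xi> \<bullet>\<^sub>c cvec t)) * \<phi> t"

definition trans_fun :: "complex^'d \<Rightarrow> (real^'d \<Rightarrow> complex) \<Rightarrow> real^'d \<Rightarrow> complex" where
  "trans_fun x \<phi> = inv_fourier (\<lambda>\<omega>. exp (- (2 * pi * \<i> * (x \<bullet>\<^sub>c cvec \<omega>))) * fourier \<phi> \<omega>)"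

definition mod_dual :: "complex^'d::finite \<Rightarrow> 'd functional \<Rightarrow> 'd functional" where
  "mod_dual \<xi> u = (\<lambda>\<phi>\<in>gs_space. u (mod_fun \<xi> \<phi>))"

definition trans_dual :: "complex^'d::finite \<Rightarrow> 'd functional \<Rightarrow> 'd functional" where
  "trans_dual x u = (\<lambda>\<phi>\<in>gs_space. u (trans_fun (- x) \<phi>))"

definition schrodinger_dual ::
    "complex^('d::finite + 'd) \<Rightarrow> real \<Rightarrow> 'd functional \<Rightarrow> 'd functional" where
  "schrodinger_dual z \<tau> u = (let x = fst_part z; \<xi> = snd_part z in
     (\<lambda>\<phi>\<in>gs_space. exp (2 * pi * \<i> * \<tau>) * exp (- (\<i> * pi * (x \<bullet>\<^sub>c \<xi>))) *
        mod_dual \<xi> (trans_dual x u) \<phi>))"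

definition schrodinger_L2 ::
    "real^('d::finite + 'd) \<Rightarrow> real \<Rightarrow> 'd L2 \<Rightarrow> 'd L2" where
  "schrodinger_L2 z \<tau> f = (let x = fst_part z; \<xi> = snd_part z in
     L2_class (\<lambda>t. exp (2 * pi * \<i> * \<tau>) * exp (- (\<i> * pi * complex_of_real (x \<bullet> \<xi>))) *
                   exp (2 * pi * \<i> * complex_of_real (\<xi> \<bullet> t)) * rep_L2 f (t - x)))"

definition represented_by :: "'d::finite functional \<Rightarrow> 'd L2 \<Rightarrow> bool" where
  "represented_by u g \<longleftrightarrow> u \<in> gs_dual \<and> u = of_L2 g"

text \<open>The realization in \<open>L\<^sup>2\<close> of \<open>\<rho>(w;\<tau>)\<close>, \<open>w\<close> complex: meaningful for those \<open>f\<close> for which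
  \<open>\<rho>(w;\<tau>)f\<close> is represented by an \<open>L\<^sup>2\<close> function.\<close>

definition schrodinger_partial ::
    "complex^('d::finite + 'd) \<Rightarrow> real \<Rightarrow> 'd L2 \<Rightarrow> 'd L2" where
  "schrodinger_partial w \<tau> f = (THE g. represented_by (schrodinger_dual w \<tau> (of_L2 f)) g)"

end

theory Submission
  imports Defs "HOL-Complex_Analysis.Conformal_Mappings" "HOL-Probability.Characteristic_Functions"
begin

unbundle no fps_syntax

text \<open>A function belongs to \<open>S\<^bsub>1/2\<^esub>\<^bsup>1/2\<^esup>(\<real>\<^sup>d)\<close> iff it is the restriction to \<open>\<real>\<^sup>d\<close> of an entire
  function \<open>\<Phi>\<close> with \<open>|\<Phi>(x + i y)| \<le> C exp (b |y|\<^sup>2 - a |x|\<^sup>2)\<close>, \<open>a > 0\<close>. On such functions \<open>\<rho>(w;\<tau>)\<close>,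
  \<open>w\<close> complex, is a complex translation followed by multiplication with an exponential, and the
  transposes of the three kinds of generators act by explicit formulas; shifting contours shows
  that they intertwine \<open>\<rho>(w;\<tau>)\<close> and \<open>\<rho>(S w;\<tau>)\<close>. By duality, if \<open>\<rho>(w;\<tau>) f\<close> is represented by
  \<open>g \<in> L\<^sup>2\<close>, then \<open>\<rho>(S w;\<tau>) (A f)\<close> is represented by \<open>A g\<close> for every generator \<open>A\<close> with projection
  \<open>S\<close>. Since \<open>w\<close> is allowed to be complex here, this property is stable under composition. It is
  applied to real \<open>w\<close>, where \<open>g\<close> always exists; \<open>g\<close> is unique because Gaussians separate \<open>L\<^sup>2\<close>.\<close>

subsection \<open>Lebesgue measure and Gaussian integrals\<close>

text \<open>For complex w the operator rho(w) need not preserve L2; it acts on functionals only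
  through its transpose on test functions. Translation of a test function by a complex vector is
  defined on the Fourier side, where it cannot be compared with a chirp or a dilation; on entire
  extensions all of them become pointwise formulas. The identification with entire functions rests
  on one elementary fact: the supremum over n of u^n / sqrt (n!) is of Gaussian size in u. Applied
  to the monomial weight of the norm it gives decay along R^d, applied to the derivative weight it
  gives decay of the Fourier transform, and in the Taylor series it gives growth of order two along
  i R^d. The constants of the growth condition are free: decay may shrink and growth may increase at
  every step, as long as the decay rate stays positive. Multipliers may therefore grow in real
  directions only like exp (eps |x|^2) with eps arbitrarily small, and for chirps Im Q >= 0 secures
  this.\<close>

lemma nn_integral_lborel_shift:
  fixes f :: "'a::euclidean_space \<Rightarrow> ennreal"
  assumes [measurable]: "f \<in> borel_measurable borel"
  shows "(\<integral>\<^sup>+t. f (t + c) \<partial>lborel) = (\<integral>\<^sup>+t. f t \<partial>lborel)"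
  by (subst (2) lborel_distr_plus[symmetric, of c])
     (simp add: nn_integral_distr add.commute)

lemma integral_lborel_shift:
  fixes f :: "'a::euclidean_space \<Rightarrow> 'b::{banach, second_countable_topology}"
  assumes [measurable]: "f \<in> borel_measurable borel"
  shows "(LINT t|lborel. f (t + c)) = (LINT t|lborel. f t)"
  by (subst (2) lborel_distr_plus[symmetric, of c])
     (simp add: integral_distr add.commute)

lemma integrable_lborel_shift:
  fixes f :: "'a::euclidean_space \<Rightarrow> 'b::{banach, second_countable_topology}"
  assumes "integrable lborel f"
  shows "integrable lborel (\<lambda>t. f (t + c))"
proof -
  have [measurable]: "f \<in> borel_measurable borel" using assms by auto
  have "integrable (distr lborel borel ((+) c)) f" using assms by (simp add: lborel_distr_plus)
  then show ?thesis by (subst (asm) integrable_distr_eq) (auto simp: add.commute)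
qed

lemma lborel_distr_uminus_euclidean:
  "distr lborel borel uminus = (lborel :: 'a::euclidean_space measure)"
  using lborel_affine[of "-1" "0::'a"] by (simp add: density_1 power_abs)

lemma nn_integral_lborel_uminus:
  fixes f :: "'a::euclidean_space \<Rightarrow> ennreal"
  assumes [measurable]: "f \<in> borel_measurable borel"
  shows "(\<integral>\<^sup>+t. f (- t) \<partial>lborel) = (\<integral>\<^sup>+t. f t \<partial>lborel)"
  by (subst (2) lborel_distr_uminus_euclidean[symmetric])
     (simp add: nn_integral_distr)

text \<open>The uniqueness argument for Haar measure. The determinant formula of the library is restricted
  to well-ordered index types; the value of \<open>\<kappa>\<close> is irrelevant here.\<close>

lemma nn_integral_lborel_linear:
  fixes g :: "'a::euclidean_space \<Rightarrow> 'a"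
  assumes g: "linear g" "bij g"
  obtains \<kappa> :: real where "\<kappa> > 0"
    "\<And>f. f \<in> borel_measurable borel \<Longrightarrow>
      (\<integral>\<^sup>+t. f (g t) \<partial>lborel) = ennreal \<kappa> * (\<integral>\<^sup>+t. f t \<partial>lborel)"
proof -
  define k where "k = inv g"
  have k: "linear k" unfolding k_def using g by (simp add: inj_linear_imp_inv_linear bij_is_inj)
  have gk: "g (k y) = y" for y unfolding k_def using g by (simp add: bij_is_surj surj_f_inv_f)
  have [measurable]: "g \<in> borel_measurable borel" "k \<in> borel_measurable borel"
    using g k by (auto intro!: borel_measurable_continuous_onI linear_continuous_on
        simp: linear_conv_bounded_linear)
  \<comment> \<open>An auxiliary function of integral 1, brought in as a factor so that Fubini can
    trade its shift for one of f.\<close>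
  define h :: "'a \<Rightarrow> ennreal" where "h = indicator (box 0 One)"
  have [measurable]: "h \<in> borel_measurable borel" by (simp add: h_def)
  have h1: "(\<integral>\<^sup>+y. h y \<partial>lborel) = 1"
    by (simp add: h_def emeasure_lborel_box_eq inner_sum_left inner_Basis if_distrib)
  define K where "K = (\<integral>\<^sup>+x. h (g x) \<partial>lborel)"
  have main: "(\<integral>\<^sup>+x. f (g x) \<partial>lborel) = K * (\<integral>\<^sup>+x. f x \<partial>lborel)"
    if [measurable]: "f \<in> borel_measurable borel" for f :: "'a \<Rightarrow> ennreal"
  proof -
    have "(\<integral>\<^sup>+x. f (g x) \<partial>lborel) = (\<integral>\<^sup>+x. f (g x) * (\<integral>\<^sup>+y. h y \<partial>lborel) \<partial>lborel)"
      by (simp add: h1)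
    also have "\<dots> = (\<integral>\<^sup>+x. f (g x) * (\<integral>\<^sup>+y. h (y + g x) \<partial>lborel) \<partial>lborel)"
      by (simp add: nn_integral_lborel_shift)
    also have "\<dots> = (\<integral>\<^sup>+x. (\<integral>\<^sup>+y. f (g x) * h (y + g x) \<partial>lborel) \<partial>lborel)"
      by (simp add: nn_integral_cmult)
    also have "\<dots> = (\<integral>\<^sup>+y. (\<integral>\<^sup>+x. f (g x) * h (y + g x) \<partial>lborel) \<partial>lborel)"
      by (rule lborel_pair.Fubini') measurable
    \<comment> \<open>For fixed y the variable x is translated by \<open>k (- y)\<close>; since
      \<open>g (k y) = y\<close>, the shift leaves h and enters f.\<close>
    also have "\<dots> = (\<integral>\<^sup>+y. (\<integral>\<^sup>+x. f (g (x + k (- y))) * h (y + g (x + k (- y))) \<partial>lborel) \<partial>lborel)"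
      by (intro nn_integral_cong nn_integral_lborel_shift[symmetric]) measurable
    also have "\<dots> = (\<integral>\<^sup>+y. (\<integral>\<^sup>+x. f (g x + - y) * h (g x) \<partial>lborel) \<partial>lborel)"
      by (simp add: linear_add[OF g(1)] gk)
    also have "\<dots> = (\<integral>\<^sup>+x. (\<integral>\<^sup>+y. f (g x + - y) * h (g x) \<partial>lborel) \<partial>lborel)"
      by (rule lborel_pair.Fubini') measurable
    also have "\<dots> = (\<integral>\<^sup>+x. (\<integral>\<^sup>+y. f (g x + y) \<partial>lborel) * h (g x) \<partial>lborel)"
      using nn_integral_lborel_uminus[of "\<lambda>y. f (g x + y)" for x]
      by (simp add: nn_integral_multc)
    also have "\<dots> = (\<integral>\<^sup>+x. (\<integral>\<^sup>+y. f y \<partial>lborel) * h (g x) \<partial>lborel)"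
      by (simp add: nn_integral_lborel_shift add.commute[of "g _"])
    also have "\<dots> = K * (\<integral>\<^sup>+x. f x \<partial>lborel)"
      by (simp add: nn_integral_cmult K_def mult.commute)
    finally show ?thesis .
  qed
  have "K = (\<integral>\<^sup>+x. indicator (g -` box 0 One) x \<partial>lborel)"
    by (simp add: K_def h_def indicator_def)
  also have "\<dots> = emeasure lborel (g -` box 0 One)"
    using measurable_sets[of g borel borel "box 0 One"] by simp
  also have "g -` box 0 One = k ` box 0 One"
    unfolding k_def using g(2) by (simp add: bij_vimage_eq_inv_image)
  also have "emeasure lborel (k ` box 0 One) < \<infinity>"
    by (rule emeasure_bounded_finite) (use k in \<open>auto intro!: bounded_linear_image
        simp: linear_conv_bounded_linear\<close>)
  finally have fin: "K < \<infinity>" .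
  \<comment> \<open>For the constant function 1 both integrals are infinite, so K cannot
    vanish.\<close>
  have "K \<noteq> 0"
    using main[of "\<lambda>_. 1"] by auto
  with fin have K: "ennreal (enn2real K) = K" "enn2real K > 0"
    by (simp_all add: enn2real_positive_iff zero_less_iff_neq_zero)
  show ?thesis
    by (rule that[OF K(2)]) (simp only: K(1) main)
qed

lemma nn_integral_gauss:
  assumes a: "a > 0"
  shows "(\<integral>\<^sup>+t. ennreal (exp (- a * (norm (t::'a::euclidean_space))\<^sup>2)) \<partial>lborel) =
    ennreal (sqrt (pi / a) ^ DIM('a))"
proof -
  define \<sigma> where "\<sigma> = sqrt (1 / (2 * a))"
  have s: "\<sigma> > 0" "\<sigma>\<^sup>2 = 1 / (2 * a)" using a by (auto simp: \<sigma>_def)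
  have e: "exp (- a * x\<^sup>2) = sqrt (pi / a) * normal_density 0 \<sigma> x" for x :: real
    using a unfolding normal_density_def s(2) by (simp add: real_sqrt_divide)
  have one: "(\<integral>\<^sup>+x. ennreal (exp (- a * x\<^sup>2)) \<partial>lborel) = ennreal (sqrt (pi / a))"
  proof -
    have "(\<integral>\<^sup>+x. ennreal (exp (- a * x\<^sup>2)) \<partial>lborel) = ennreal (LINT x|lborel. exp (- a * x\<^sup>2))"
      unfolding e using s a by (intro nn_integral_eq_integral AE_I2 mult_nonneg_nonneg normal_density_nonneg) auto
    also have "(LINT x|lborel. exp (- a * x\<^sup>2)) = sqrt (pi / a)"
      unfolding e using s by simp
    finally show ?thesis .
  qed
  have "exp (- a * (norm t)\<^sup>2) = (\<Prod>b\<in>Basis. exp (- a * (t \<bullet> b)\<^sup>2))" for t :: 'a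
    unfolding exp_sum[OF finite_Basis, symmetric] sum_distrib_left[symmetric]
    by (subst power2_norm_eq_inner, subst euclidean_inner) (simp add: power2_eq_square)
  then have "(\<integral>\<^sup>+t. ennreal (exp (- a * (norm (t::'a))\<^sup>2)) \<partial>lborel)
      = (\<integral>\<^sup>+t. (\<Prod>b\<in>Basis. ennreal (exp (- a * ((t::'a) \<bullet> b)\<^sup>2))) \<partial>lborel)"
    by (simp add: prod_ennreal)
  also have "\<dots> = (\<Prod>b\<in>(Basis::'a set). ennreal (sqrt (pi / a)))"
    by (subst nn_integral_lborel_prod) (auto simp: one[simplified])
  also have "\<dots> = ennreal (sqrt (pi / a) ^ DIM('a))"
    using a by (simp add: ennreal_power)
  finally show ?thesis .
qed

lemma has_bochner_integral_gauss:
  assumes a: "a > 0"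
  shows "has_bochner_integral lborel (\<lambda>t::'a::euclidean_space. exp (- a * (norm t)\<^sup>2))
    (sqrt (pi / a) ^ DIM('a))"
  by (rule has_bochner_integral_nn_integral) (use a nn_integral_gauss[OF a] in auto)

lemma integrable_gauss:
  assumes "a > 0"
  shows "integrable lborel (\<lambda>t::'a::euclidean_space. exp (- a * (norm t)\<^sup>2))"
  using has_bochner_integral_gauss[OF assms] by (rule integrable.intros)

lemma integral_gauss_pi:
  "(LINT t::'a::euclidean_space|lborel. exp (- pi * (norm t)\<^sup>2)) = 1"
  using has_bochner_integral_integral_eq[OF has_bochner_integral_gauss[of pi]] by simp

lemma integrable_gauss_bound:
  fixes f :: "'a::euclidean_space \<Rightarrow> 'b::{banach, second_countable_topology}"
  assumes "f \<in> borel_measurable borel" "a > 0" "\<And>t. norm (f t) \<le> C * exp (- a * (norm t)\<^sup>2)"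
  shows "integrable lborel f"
proof (rule Bochner_Integration.integrable_bound)
  show "integrable lborel (\<lambda>t::'a. C * exp (- a * (norm t)\<^sup>2))"
    by (intro integrable_mult_right integrable_gauss assms)
  show "AE t in lborel. norm (f t) \<le> norm (C * exp (- a * (norm t)\<^sup>2))"
    unfolding real_norm_def by (intro AE_I2 order_trans[OF assms(3) abs_ge_self])
qed (use assms in auto)

subsection \<open>Functions holomorphic on complex lines\<close>

definition Re_vec :: "complex^'d \<Rightarrow> real^'d" where "Re_vec z = (\<chi> j. Re (z $ j))"
definition Im_vec :: "complex^'d \<Rightarrow> real^'d" where "Im_vec z = (\<chi> j. Im (z $ j))"

lemma Re_vec_nth [simp]: "Re_vec z $ j = Re (z $ j)" by (simp add: Re_vec_def)
lemma Im_vec_nth [simp]: "Im_vec z $ j = Im (z $ j)" by (simp add: Im_vec_def)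
lemma cvec_nth [simp]: "cvec t $ j = complex_of_real (t $ j)" by (simp add: cvec_def)

lemma Re_Im_vec_simps [simp]:
  "Re_vec (z + w) = Re_vec z + Re_vec w" "Im_vec (z + w) = Im_vec z + Im_vec w"
  "Re_vec (cvec t) = t" "Im_vec (cvec t) = 0"
  "Re_vec 0 = 0" "Im_vec 0 = 0"
  by (simp_all add: vec_eq_iff)

lemma cvec_simps [simp]:
  "cvec (x + y) = cvec x + cvec y" "cvec (x - y) = cvec x - cvec y" "cvec (- x) = - cvec x"
  "cvec 0 = 0" "cvec (r *\<^sub>R x) = complex_of_real r *s cvec x"
  by (simp_all add: vec_eq_iff)

lemma norm_vec_power2: "(norm (x :: 'a::real_normed_vector^'n))\<^sup>2 = (\<Sum>j\<in>UNIV. (norm (x $ j))\<^sup>2)"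
  by (simp add: norm_vec_def L2_set_def sum_nonneg)

lemma norm_Re_Im_vec: "(norm z)\<^sup>2 = (norm (Re_vec z))\<^sup>2 + (norm (Im_vec z))\<^sup>2"
  by (simp add: norm_vec_power2 cmod_power2 sum.distrib)

lemma norm_Re_vec_le: "norm (Re_vec z) \<le> norm z" and norm_Im_vec_le: "norm (Im_vec z) \<le> norm z"
  by (rule power2_le_imp_le; simp add: norm_Re_Im_vec)+

lemma norm_cvec [simp]: "norm (cvec t) = norm t"
  using norm_Re_Im_vec[of "cvec t"] by simp

lemma norm_scalar_mult_vec [simp]: "norm (l *s v) = cmod l * norm (v :: complex^'n)"
  by (simp add: norm_vec_def L2_set_right_distrib norm_mult)

lemma bounded_linear_cvec: "bounded_linear cvec"
  by (rule bounded_linear_intro[where K = 1]) (auto simp: vec_eq_iff complex_eq_iff simp del: cvec_simps(5))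

lemma continuous_on_cvec [continuous_intros]:
  "continuous_on A f \<Longrightarrow> continuous_on A (\<lambda>x. cvec (f x))"
  by (rule bounded_linear.continuous_on[OF bounded_linear_cvec])

lemma cvec_measurable [measurable]: "cvec \<in> borel_measurable borel"
  by (intro borel_measurable_continuous_onI continuous_intros)

lemma cvec_Re_Im: "z = cvec (Re_vec z) + \<i> *s cvec (Im_vec z)"
  by (simp add: vec_eq_iff complex_eq)

text \<open>Holomorphy on every complex line, with no continuity built in. Together with local
  boundedness this describes entire functions of several variables; every later argument restricts
  to a line and uses one-variable theory.\<close>

definition line_holomorphic :: "(complex^'d \<Rightarrow> complex) \<Rightarrow> bool" where
  "line_holomorphic \<Phi> \<longleftrightarrow> (\<forall>z v. (\<lambda>l. \<Phi> (z + l *s v)) holomorphic_on UNIV)"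

lemma Cauchy_deriv_bound:
  assumes "f holomorphic_on UNIV" "\<And>x. cmod (x - y) \<le> r \<Longrightarrow> cmod (f x) \<le> B" "r > 0"
  shows "cmod (deriv f y) \<le> B / r"
  using Cauchy_inequality[of f y r B 1] assms
  by (auto simp: dist_norm norm_minus_commute intro!: holomorphic_on_imp_continuous_on
      intro: holomorphic_on_subset)

text \<open>Cauchy's inequality on discs of radius 1 about the points of the unit disc around y;
  these discs lie in the disc of radius 2, where B is assumed.\<close>

lemma holomorphic_Lipschitz:
  assumes f: "f holomorphic_on UNIV" and B: "\<And>x. cmod (x - y) \<le> 2 \<Longrightarrow> cmod (f x) \<le> B"
    and h: "cmod h \<le> 1"
  shows "cmod (f (y + h) - f y) \<le> B * cmod h"
proof -
  have "cmod (f (y + h) - f y) \<le> B * cmod (y + h - y)"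
  proof (rule field_differentiable_bound[of "cball y 1" f "deriv f"])
    fix z assume z: "z \<in> cball y 1"
    show "(f has_field_derivative deriv f z) (at z within cball y 1)"
      using f holomorphic_derivI by blast
    show "cmod (deriv f z) \<le> B"
    proof -
      have "cmod (deriv f z) \<le> B / 1"
      proof (rule Cauchy_deriv_bound[OF f])
        fix x assume "cmod (x - z) \<le> 1"
        then show "cmod (f x) \<le> B"
          using z norm_triangle_ineq[of "x - z" "z - y"]
          by (intro B) (auto simp: dist_norm norm_minus_commute)
      qed auto
      then show ?thesis by simp
    qed
  qed (use h in \<open>auto simp: dist_norm\<close>)
  then show ?thesis by simp
qed

text \<open>The local bound makes the constant of \<open>holomorphic_Lipschitz\<close> the same for
  all unit directions, so holomorphy on lines becomes joint continuity.\<close>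

lemma line_holomorphic_continuous:
  assumes \<Phi>: "line_holomorphic \<Phi>" and bdd: "\<And>R. \<exists>M. \<forall>z. norm z \<le> R \<longrightarrow> cmod (\<Phi> z) \<le> M"
  shows "continuous_on UNIV \<Phi>"
  unfolding continuous_on_iff
proof (intro ballI allI impI)
  fix z :: "complex^'a" and e :: real assume e: "e > 0"
  obtain M where M: "\<And>w. norm w \<le> norm z + 2 \<Longrightarrow> cmod (\<Phi> w) \<le> M"
    using bdd[of "norm z + 2"] by auto
  have M0: "M \<ge> 0" using order_trans[OF norm_ge_zero M[of z]] by simp
  define d where "d = min 1 (e / (M + 1))"
  have "d > 0" using e M0 by (simp add: d_def)
  moreover have "dist (\<Phi> w) (\<Phi> z) < e" if "dist w z < d" for w
  proof (cases "w = z")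
    case False
    define v where "v = inverse (complex_of_real (norm (w - z))) *s (w - z)"
    have w: "w = z + complex_of_real (norm (w - z)) *s v"
      using False by (simp add: v_def vector_smult_assoc)
    have nv: "norm v = 1" unfolding v_def norm_scalar_mult_vec using False by (simp add: norm_inverse)
    define f where "f l = \<Phi> (z + l *s v)" for l
    have "cmod (f (0 + complex_of_real (norm (w - z))) - f 0) \<le> M * cmod (complex_of_real (norm (w - z)))"
    proof (rule holomorphic_Lipschitz)
      show "f holomorphic_on UNIV" using \<Phi> by (simp add: line_holomorphic_def f_def[abs_def])
      fix x :: complex assume "cmod (x - 0) \<le> 2"
      then have "norm (z + x *s v) \<le> norm z + 2"
        using norm_triangle_ineq[of z "x *s v"] nv by simp
      then show "cmod (f x) \<le> M" unfolding f_def by (rule M)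
    qed (use that in \<open>auto simp: d_def dist_norm\<close>)
    moreover have "f 0 = \<Phi> z" by (simp add: f_def)
    moreover have "f (complex_of_real (norm (w - z))) = \<Phi> w" unfolding f_def w[symmetric] ..
    ultimately have "dist (\<Phi> w) (\<Phi> z) \<le> M * dist w z" by (simp add: dist_norm)
    also have "\<dots> \<le> M * (e / (M + 1))" using that M0 by (intro mult_left_mono) (auto simp: d_def)
    also have "\<dots> < e" using e M0 by (simp add: field_simps)
    finally show ?thesis .
  qed (use e in auto)
  ultimately show "\<exists>d>0. \<forall>x'\<in>UNIV. dist x' z < d \<longrightarrow> dist (\<Phi> x') (\<Phi> z) < e" by blast
qed

text \<open>Differentiation under the integral sign. A majorant of G t on a larger disc also
  dominates the difference quotients by \<open>holomorphic_Lipschitz\<close>; limits are taken along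
  sequences so that dominated convergence applies.\<close>

lemma holomorphic_integral:
  fixes G :: "'a \<Rightarrow> complex \<Rightarrow> complex"
  assumes holo: "\<And>t. G t holomorphic_on UNIV"
    and meas: "\<And>l. (\<lambda>t. G t l) \<in> borel_measurable M"
    and dom: "\<And>R. \<exists>w. integrable M w \<and> (\<forall>t l. cmod l \<le> R \<longrightarrow> cmod (G t l) \<le> w t)"
  shows "((\<lambda>l. LINT t|M. G t l) has_field_derivative (LINT t|M. deriv (G t) l0)) (at l0)"
proof -
  obtain w where w: "integrable M w" "\<And>t l. cmod l \<le> cmod l0 + 2 \<Longrightarrow> cmod (G t l) \<le> w t"
    using dom[of "cmod l0 + 2"] by auto
  have int: "integrable M (\<lambda>t. G t l)" for l
  proof -
    obtain w where "integrable M w" "\<And>t. cmod (G t l) \<le> w t"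
      using dom[of "cmod l"] by auto
    then show ?thesis
      by (elim Bochner_Integration.integrable_bound) (auto intro: meas intro!: AE_I2 order_trans[OF _ abs_ge_self])
  qed
  have dG: "(G t has_field_derivative deriv (G t) l0) (at l0)" for t
    using holo holomorphic_derivI by blast
  have "((\<lambda>h. ((LINT t|M. G t (l0 + h)) - (LINT t|M. G t l0)) / h) \<circ> X) \<longlonglongrightarrow> (LINT t|M. deriv (G t) l0)"
    if X: "\<forall>i. X i \<in> UNIV - {0}" "X \<longlonglongrightarrow> 0" for X :: "nat \<Rightarrow> complex"
  proof -
    have "eventually (\<lambda>i. cmod (X i) < 1) sequentially"
      using tendstoD[OF X(2), of 1] by simp
    then obtain N where N: "\<And>i. i \<ge> N \<Longrightarrow> cmod (X i) < 1" by (auto simp: eventually_sequentially)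
    \<comment> \<open>The offset N drops an initial segment, after which all increments have modulus
      below 1 and the Lipschitz bound is available.\<close>
    define s where "s i t = (G t (l0 + X (i + N)) - G t l0) / X (i + N)" for i t
    have lim: "(\<lambda>i. s i t) \<longlonglongrightarrow> deriv (G t) l0" for t
    proof -
      have "(\<lambda>i. (G t (l0 + X i) - G t l0) / X i) \<longlonglongrightarrow> deriv (G t) l0"
        using dG[of t] X unfolding DERIV_def tendsto_at_iff_sequentially by (auto simp: comp_def)
      then show ?thesis unfolding s_def by (rule LIMSEQ_ignore_initial_segment)
    qed
    have ms: "s i \<in> borel_measurable M" for i
      unfolding s_def[abs_def] by (intro borel_measurable_divide borel_measurable_diff meas) auto
    have bd: "cmod (s i t) \<le> w t" for i t
    proof -
      have "cmod (G t (l0 + X (i + N)) - G t l0) \<le> w t * cmod (X (i + N))"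
      proof (rule holomorphic_Lipschitz[OF holo])
        fix x assume "cmod (x - l0) \<le> 2"
        then show "cmod (G t x) \<le> w t"
          using norm_triangle_ineq[of "x - l0" l0] by (intro w) simp
      qed (use N[of "i + N"] in auto)
      then show ?thesis using X(1) by (simp add: s_def norm_divide divide_simps)
    qed
    have "(\<lambda>i. LINT t|M. s i t) \<longlonglongrightarrow> (LINT t|M. deriv (G t) l0)"
    proof (rule integral_dominated_convergence[OF _ ms w(1)])
      show "(\<lambda>t. deriv (G t) l0) \<in> borel_measurable M"
        by (rule borel_measurable_LIMSEQ_metric[OF ms lim])
    qed (auto simp: lim bd)
    moreover have "(LINT t|M. s i t) = ((LINT t|M. G t (l0 + X (i + N))) - (LINT t|M. G t l0)) / X (i + N)" for i
      unfolding s_def integral_divide_zero Bochner_Integration.integral_diff[OF int int] ..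
    ultimately have "(\<lambda>i. ((LINT t|M. G t (l0 + X (i + N))) - (LINT t|M. G t l0)) / X (i + N)) \<longlonglongrightarrow> (LINT t|M. deriv (G t) l0)"
      by (simp only:)
    then show ?thesis
      unfolding comp_def by (rule LIMSEQ_offset)
  qed
  then show ?thesis
    unfolding DERIV_def tendsto_at_iff_sequentially by simp
qed

lemma holomorphic_integral_UNIV:
  fixes G :: "'a \<Rightarrow> complex \<Rightarrow> complex"
  assumes "\<And>t. G t holomorphic_on UNIV"
    and "\<And>l. (\<lambda>t. G t l) \<in> borel_measurable M"
    and "\<And>R. \<exists>w. integrable M w \<and> (\<forall>t l. cmod l \<le> R \<longrightarrow> cmod (G t l) \<le> w t)"
  shows "(\<lambda>l. LINT t|M. G t l) holomorphic_on UNIV"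
  unfolding holomorphic_on_open[OF open_UNIV]
  using holomorphic_integral[OF assms] by blast

subsection \<open>Entire functions with Gaussian growth\<close>

definition gs_entire :: "(complex^'d \<Rightarrow> complex) \<Rightarrow> bool" where
  "gs_entire \<Phi> \<longleftrightarrow> line_holomorphic \<Phi> \<and>
     (\<exists>a>0. \<exists>b\<ge>0. \<exists>C\<ge>0. \<forall>z. cmod (\<Phi> z) \<le> C * exp (b * (norm (Im_vec z))\<^sup>2 - a * (norm (Re_vec z))\<^sup>2))"

lemma gs_entireI:
  assumes "line_holomorphic \<Phi>" "a > 0"
    and bd: "\<And>z. cmod (\<Phi> z) \<le> C * exp (b * (norm (Im_vec z))\<^sup>2 - a * (norm (Re_vec z))\<^sup>2)"
  shows "gs_entire \<Phi>"
proof -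
  have "cmod (\<Phi> z) \<le> \<bar>C\<bar> * exp (\<bar>b\<bar> * (norm (Im_vec z))\<^sup>2 - a * (norm (Re_vec z))\<^sup>2)" for z
    by (rule order_trans[OF bd]) (auto intro!: mult_mono mult_right_mono)
  then show ?thesis using assms(1,2) unfolding gs_entire_def
    by (intro conjI exI[of _ a] exI[of _ "\<bar>b\<bar>"] exI[of _ "\<bar>C\<bar>"]) auto
qed

lemma gs_entireE:
  assumes "gs_entire \<Phi>"
  obtains a b C where "a > 0" "b \<ge> 0" "C \<ge> 0"
    "\<And>z. cmod (\<Phi> z) \<le> C * exp (b * (norm (Im_vec z))\<^sup>2 - a * (norm (Re_vec z))\<^sup>2)"
  using assms unfolding gs_entire_def by auto

lemma norm_add_power2_le: "(norm (x + y))\<^sup>2 \<le> 2 * (norm x)\<^sup>2 + 2 * (norm (y::'a::real_normed_vector))\<^sup>2"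
proof -
  have "(norm (x + y))\<^sup>2 \<le> (norm x + norm y)\<^sup>2" by (simp add: norm_triangle_ineq power_mono)
  also have "\<dots> \<le> 2 * (norm x)\<^sup>2 + 2 * (norm y)\<^sup>2"
    using sum_squares_bound[of "norm x" "norm y"] by (simp add: power2_sum)
  finally show ?thesis .
qed

lemma norm_add_power2_ge: "(norm x)\<^sup>2 / 2 - (norm y)\<^sup>2 \<le> (norm (x + y))\<^sup>2" for y :: "'a::real_normed_vector"
  using norm_add_power2_le[of "x + y" "- y"] by simp

text \<open>Since |t + Re s|^2 >= |t|^2 / 2 - |Re s|^2, half of the decay rate buys a bound in which
  the real variable and the complex shift are separated. It supplies one integrable majorant for all
  shifts in a bounded set.\<close>

lemma gs_entire_shift_bound:
  assumes "gs_entire \<Phi>"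
  obtains a K B where "a > 0" "K \<ge> 0" "B \<ge> 0"
    "\<And>t s. cmod (\<Phi> (cvec t + s)) \<le> K * exp (B * (norm s)\<^sup>2) * exp (- a * (norm t)\<^sup>2)"
proof -
  obtain a b C where abC: "a > 0" "b \<ge> 0" "C \<ge> 0"
    and bd: "\<And>z. cmod (\<Phi> z) \<le> C * exp (b * (norm (Im_vec z))\<^sup>2 - a * (norm (Re_vec z))\<^sup>2)"
    by (rule gs_entireE[OF assms]) (rule that)
  have "cmod (\<Phi> (cvec t + s)) \<le> C * exp ((b + a) * (norm s)\<^sup>2) * exp (- (a / 2) * (norm t)\<^sup>2)" for t s
  proof -
    have 1: "b * (norm (Im_vec s))\<^sup>2 \<le> b * (norm s)\<^sup>2"
      using norm_Im_vec_le[of s] abC by (intro mult_left_mono power_mono) auto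
    have "a * ((norm t)\<^sup>2 / 2 - (norm s)\<^sup>2) \<le> a * ((norm t)\<^sup>2 / 2 - (norm (Re_vec s))\<^sup>2)"
      using norm_Re_vec_le[of s] abC by (intro mult_left_mono diff_left_mono power_mono) auto
    also have "\<dots> \<le> a * (norm (t + Re_vec s))\<^sup>2"
      using norm_add_power2_ge abC by (intro mult_left_mono) auto
    finally have "b * (norm (Im_vec s))\<^sup>2 - a * (norm (t + Re_vec s))\<^sup>2
        \<le> (b + a) * (norm s)\<^sup>2 + (- (a / 2) * (norm t)\<^sup>2)"
      using 1 by (simp add: algebra_simps)
    then have "exp (b * (norm (Im_vec s))\<^sup>2 - a * (norm (t + Re_vec s))\<^sup>2)
        \<le> exp ((b + a) * (norm s)\<^sup>2) * exp (- (a / 2) * (norm t)\<^sup>2)"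
      unfolding exp_add[symmetric] by simp
    then have "C * exp (b * (norm (Im_vec s))\<^sup>2 - a * (norm (t + Re_vec s))\<^sup>2)
        \<le> C * (exp ((b + a) * (norm s)\<^sup>2) * exp (- (a / 2) * (norm t)\<^sup>2))"
      using abC by (intro mult_left_mono) auto
    then show ?thesis using bd[of "cvec t + s"] by (simp add: mult.assoc)
  qed
  then show ?thesis using abC by (intro that[of "a / 2" C "b + a"]) auto
qed

lemma gs_entire_continuous:
  assumes "gs_entire \<Phi>" shows "continuous_on UNIV \<Phi>"
proof (rule line_holomorphic_continuous)
  show "line_holomorphic \<Phi>" using assms by (simp add: gs_entire_def)
  fix R :: real
  obtain a K B where K: "a > 0" "K \<ge> 0" "B \<ge> 0"
    and bd: "\<And>t s. cmod (\<Phi> (cvec t + s)) \<le> K * exp (B * (norm s)\<^sup>2) * exp (- a * (norm t)\<^sup>2)"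
    by (rule gs_entire_shift_bound[OF assms]) (rule that)
  have "cmod (\<Phi> z) \<le> K * exp (B * R\<^sup>2)" if "norm z \<le> R" for z
  proof -
    have "cmod (\<Phi> z) \<le> K * exp (B * (norm z)\<^sup>2)" using bd[of 0 z] by simp
    also have "\<dots> \<le> K * exp (B * R\<^sup>2)"
      using that K by (intro mult_left_mono iffD2[OF exp_le_cancel_iff] power_mono) auto
    finally show ?thesis .
  qed
  then show "\<exists>M. \<forall>z. norm z \<le> R \<longrightarrow> cmod (\<Phi> z) \<le> M" by blast
qed

lemma gs_entire_measurable:
  assumes "gs_entire \<Phi>" shows "(\<lambda>t. \<Phi> (cvec t + s)) \<in> borel_measurable borel"
  by (intro borel_measurable_continuous_onI continuous_on_compose2[OF gs_entire_continuous[OF assms]]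
      continuous_intros) auto

lemma gs_entire_integrable:
  assumes "gs_entire \<Phi>" shows "integrable lborel (\<lambda>t. \<Phi> (cvec t + s))"
proof -
  obtain a K B where "a > 0" "K \<ge> 0" "B \<ge> 0"
    and bd: "\<And>t s. cmod (\<Phi> (cvec t + s)) \<le> K * exp (B * (norm s)\<^sup>2) * exp (- a * (norm t)\<^sup>2)"
    by (rule gs_entire_shift_bound[OF assms]) (rule that)
  with bd show ?thesis
    by (intro integrable_gauss_bound[OF gs_entire_measurable[OF assms]])
qed

lemma analytic_const_on_reals:
  assumes f: "f holomorphic_on UNIV" and r: "\<And>r::real. f (complex_of_real r) = c"
  shows "f z = c"
proof -
  have "f z - c = 0"
  proof (rule analytic_continuation[of "\<lambda>z. f z - c" UNIV "\<real>" 0])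
    show "0 islimpt (\<real> :: complex set)"
      unfolding islimpt_approachable
    proof (intro allI impI)
      fix e :: real assume "e > 0"
      then show "\<exists>x'\<in>\<real>. x' \<noteq> (0::complex) \<and> dist x' 0 < e"
        by (intro bexI[of _ "complex_of_real (e / 2)"]) auto
    qed
  qed (use f r in \<open>auto intro!: holomorphic_intros elim!: Reals_cases\<close>)
  then show ?thesis by simp
qed

text \<open>Along a real direction the integral is a holomorphic function of the shift parameter which
  is constant on the real axis.\<close>

lemma contour_shift:
  assumes "gs_entire \<Phi>"
  shows "(LINT t|lborel. \<Phi> (cvec t + s)) = (LINT t|lborel. \<Phi> (cvec t))"
proof -
  obtain a K B where K: "a > 0" "K \<ge> 0" "B \<ge> 0"
    and bd: "\<And>t s. cmod (\<Phi> (cvec t + s)) \<le> K * exp (B * (norm s)\<^sup>2) * exp (- a * (norm t)\<^sup>2)"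
    by (rule gs_entire_shift_bound[OF assms]) (rule that)
  \<comment> \<open>Only the imaginary part of the shift needs continuation in l: real multiples of
    v and the real part of s are absorbed by translation invariance.\<close>
  define v where "v = cvec (Im_vec s)"
  have "(\<lambda>l. LINT t|lborel. \<Phi> (cvec t + l *s v)) holomorphic_on UNIV"
  proof (rule holomorphic_integral_UNIV)
    show "(\<lambda>l. \<Phi> (cvec t + l *s v)) holomorphic_on UNIV" for t
      using assms by (simp add: gs_entire_def line_holomorphic_def)
    show "(\<lambda>t. \<Phi> (cvec t + l *s v)) \<in> borel_measurable lborel" for l
      using gs_entire_measurable[OF assms] by simp
    fix R :: real
    let ?w = "\<lambda>t. K * exp (B * (R * norm v)\<^sup>2) * exp (- a * (norm t)\<^sup>2)"
    have "cmod (\<Phi> (cvec t + l *s v)) \<le> ?w t" if "cmod l \<le> R" for t l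
    proof -
      have "B * (cmod l * norm v)\<^sup>2 \<le> B * (R * norm v)\<^sup>2"
        using that K by (intro mult_left_mono power_mono mult_right_mono) auto
      then have "K * exp (B * (cmod l * norm v)\<^sup>2) * exp (- a * (norm t)\<^sup>2) \<le> ?w t"
        using K by (intro mult_right_mono mult_left_mono) auto
      then show ?thesis using bd[of t "l *s v"] by simp
    qed
    then show "\<exists>w. integrable lborel w \<and> (\<forall>t l. cmod l \<le> R \<longrightarrow> cmod (\<Phi> (cvec t + l *s v)) \<le> w t)"
      by (intro exI[of _ ?w] conjI integrable_mult_right integrable_gauss K) auto
  qed
  moreover have "(LINT t|lborel. \<Phi> (cvec t + complex_of_real r *s v)) = (LINT t|lborel. \<Phi> (cvec t))" for r
    using integral_lborel_shift[of "\<lambda>t. \<Phi> (cvec t)" "r *\<^sub>R Im_vec s"] gs_entire_measurable[OF assms, of 0]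
    by (simp add: v_def)
  ultimately have "(LINT t|lborel. \<Phi> (cvec t + \<i> *s v)) = (LINT t|lborel. \<Phi> (cvec t))"
    by (rule analytic_const_on_reals)
  moreover have "(LINT t|lborel. \<Phi> (cvec t + s)) = (LINT t|lborel. \<Phi> (cvec t + \<i> *s v))"
    using integral_lborel_shift[of "\<lambda>t. \<Phi> (cvec t + \<i> *s v)" "Re_vec s"] gs_entire_measurable[OF assms, of "\<i> *s v"]
    by (subst cvec_Re_Im[of s]) (simp add: v_def add.assoc)
  ultimately show ?thesis by simp
qed

text \<open>Quadratic growth is allowed at any rate in imaginary directions, but in real ones only
  at arbitrarily small rates \<epsilon>: taking \<epsilon> below the decay rate of a function in
  \<open>gs_entire\<close> leaves the product a positive rate.\<close>

definition tame_multiplier :: "(complex^'d \<Rightarrow> complex) \<Rightarrow> bool" where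
  "tame_multiplier m \<longleftrightarrow> line_holomorphic m \<and> (\<forall>\<epsilon>>0. \<exists>B K. \<forall>z.
     cmod (m z) \<le> K * exp (B * (norm (Im_vec z))\<^sup>2 + \<epsilon> * (norm (Re_vec z))\<^sup>2))"

lemma line_holomorphic_mult:
  "line_holomorphic f \<Longrightarrow> line_holomorphic g \<Longrightarrow> line_holomorphic (\<lambda>z. f z * g z)"
  by (auto simp: line_holomorphic_def intro!: holomorphic_intros)

lemma line_holomorphic_affine:
  assumes "line_holomorphic \<Phi>"
  shows "line_holomorphic (\<lambda>z. \<Phi> (A *v z + s))"
proof -
  have eq: "A *v (z + l *s v) + s = (A *v z + s) + l *s (A *v v)" for z v l
    by (simp add: vec_eq_iff matrix_vector_mult_def algebra_simps sum.distrib sum_distrib_left)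
  show ?thesis using assms unfolding line_holomorphic_def eq by blast
qed

lemma gs_entire_multiplier:
  assumes m: "tame_multiplier m" and \<Phi>: "gs_entire \<Phi>"
  shows "gs_entire (\<lambda>z. m z * \<Phi> z)"
proof -
  obtain a b C where abC: "a > 0" "b \<ge> 0" "C \<ge> 0"
    and bd: "\<And>z. cmod (\<Phi> z) \<le> C * exp (b * (norm (Im_vec z))\<^sup>2 - a * (norm (Re_vec z))\<^sup>2)"
    by (rule gs_entireE[OF \<Phi>]) (rule that)
  obtain B K where mb: "\<And>z. cmod (m z) \<le> K * exp (B * (norm (Im_vec z))\<^sup>2 + a / 2 * (norm (Re_vec z))\<^sup>2)"
    using m abC(1) unfolding tame_multiplier_def by (meson half_gt_zero)
  show ?thesis
  proof (rule gs_entireI[where a = "a / 2" and b = "B + b" and C = "K * C"])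
    show "line_holomorphic (\<lambda>z. m z * \<Phi> z)"
      using m \<Phi> by (auto simp: tame_multiplier_def gs_entire_def intro: line_holomorphic_mult)
    fix z
    have "cmod (m z * \<Phi> z) \<le> (K * exp (B * (norm (Im_vec z))\<^sup>2 + a / 2 * (norm (Re_vec z))\<^sup>2)) *
        (C * exp (b * (norm (Im_vec z))\<^sup>2 - a * (norm (Re_vec z))\<^sup>2))"
      unfolding norm_mult using order_trans[OF norm_ge_zero mb] by (intro mult_mono mb bd) auto
    also have "\<dots> = K * C * exp ((B + b) * (norm (Im_vec z))\<^sup>2 - a / 2 * (norm (Re_vec z))\<^sup>2)"
      by (simp add: mult_exp_exp algebra_simps)
    finally show "cmod (m z * \<Phi> z) \<le> \<dots>" .
  qed (use abC in auto)
qed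

lemma line_holomorphic_exp_quadratic:
  "line_holomorphic (\<lambda>z. exp (c * ((Q *v z) \<bullet>\<^sub>c z)))"
  unfolding line_holomorphic_def bdot_def matrix_vector_mult_def
  by (auto intro!: holomorphic_intros)

lemma line_holomorphic_exp_linear:
  "line_holomorphic (\<lambda>z. exp (c * (\<xi> \<bullet>\<^sub>c z)))"
  unfolding line_holomorphic_def bdot_def by (auto intro!: holomorphic_intros)

section \<open>Exponentials of linear and quadratic forms as multipliers\<close>

lemma bdot_Re: "Re (x \<bullet>\<^sub>c z) = Re_vec x \<bullet> Re_vec z - Im_vec x \<bullet> Im_vec z"
  and bdot_Im: "Im (x \<bullet>\<^sub>c z) = Re_vec x \<bullet> Im_vec z + Im_vec x \<bullet> Re_vec z"
  by (simp_all add: bdot_def inner_vec_def sum_subtractf sum.distrib)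

text \<open>Young's inequality with a free weight: it charges a mixed term to an arbitrarily small
  multiple of q^2.\<close>

lemma mult_le_eps:
  fixes p q \<epsilon> :: real
  assumes "\<epsilon> > 0" shows "p * q \<le> \<epsilon> * q\<^sup>2 + p\<^sup>2 / (4 * \<epsilon>)"
proof -
  have "0 \<le> (2 * \<epsilon> * q - p)\<^sup>2 / (4 * \<epsilon>)" using assms by simp
  also have "\<dots> = \<epsilon> * q\<^sup>2 + p\<^sup>2 / (4 * \<epsilon>) - p * q"
    using assms by (simp add: field_simps power2_eq_square)
  finally show ?thesis by simp
qed

lemma neg_inner_le:
  assumes "c \<ge> 0" shows "- (c * (x \<bullet> y)) \<le> c * norm x * norm y"
  using mult_left_mono[of "- (x \<bullet> y)" "norm x * norm y" c] Cauchy_Schwarz_ineq2[of x y] assms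
  by (simp add: abs_le_iff mult.assoc)

lemma tame_exp_linear:
  fixes \<xi> :: "complex^'d"
  shows "tame_multiplier (\<lambda>z. exp (2 * pi * \<i> * (\<xi> \<bullet>\<^sub>c z)))"
  unfolding tame_multiplier_def
proof (intro conjI allI impI)
  show "line_holomorphic (\<lambda>z. exp (2 * pi * \<i> * (\<xi> \<bullet>\<^sub>c z)))" by (rule line_holomorphic_exp_linear)
  fix \<epsilon> :: real assume e: "\<epsilon> > 0"
  let ?p = "2 * pi * norm (Im_vec \<xi>)" and ?q = "2 * pi * norm (Re_vec \<xi>)"
  have "cmod (exp (2 * pi * \<i> * (\<xi> \<bullet>\<^sub>c z))) \<le>
    exp (?p\<^sup>2 / (4 * \<epsilon>) + ?q\<^sup>2 / 4) * exp (1 * (norm (Im_vec z))\<^sup>2 + \<epsilon> * (norm (Re_vec z))\<^sup>2)" for z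
  proof -
    have "- (2 * pi * (Im_vec \<xi> \<bullet> Re_vec z)) \<le> ?p * norm (Re_vec z)"
      by (rule neg_inner_le) simp
    also have "\<dots> \<le> \<epsilon> * (norm (Re_vec z))\<^sup>2 + ?p\<^sup>2 / (4 * \<epsilon>)" by (rule mult_le_eps[OF e])
    finally have 1: "- (2 * pi * (Im_vec \<xi> \<bullet> Re_vec z)) \<le> \<epsilon> * (norm (Re_vec z))\<^sup>2 + ?p\<^sup>2 / (4 * \<epsilon>)" .
    have "- (2 * pi * (Re_vec \<xi> \<bullet> Im_vec z)) \<le> ?q * norm (Im_vec z)"
      by (rule neg_inner_le) simp
    also have "\<dots> \<le> 1 * (norm (Im_vec z))\<^sup>2 + ?q\<^sup>2 / (4 * 1)" by (rule mult_le_eps) simp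
    finally have 2: "- (2 * pi * (Re_vec \<xi> \<bullet> Im_vec z)) \<le> (norm (Im_vec z))\<^sup>2 + ?q\<^sup>2 / 4" by simp
    have "Re (2 * pi * \<i> * (\<xi> \<bullet>\<^sub>c z)) = - (2 * pi * (Im_vec \<xi> \<bullet> Re_vec z)) - 2 * pi * (Re_vec \<xi> \<bullet> Im_vec z)"
      by (simp add: bdot_Im algebra_simps)
    also have "\<dots> \<le> (?p\<^sup>2 / (4 * \<epsilon>) + ?q\<^sup>2 / 4) + (1 * (norm (Im_vec z))\<^sup>2 + \<epsilon> * (norm (Re_vec z))\<^sup>2)"
      using 1 2 by linarith
    finally show ?thesis unfolding norm_exp_eq_Re exp_add[symmetric] by simp
  qed
  then show "\<exists>B K. \<forall>z. cmod (exp (2 * pi * \<i> * (\<xi> \<bullet>\<^sub>c z))) \<le> K * exp (B * (norm (Im_vec z))\<^sup>2 + \<epsilon> * (norm (Re_vec z))\<^sup>2)"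
    by blast
qed

lemma gs_entire_translate:
  assumes "gs_entire \<Phi>"
  shows "gs_entire (\<lambda>z. \<Phi> (z + s))"
proof -
  obtain a b C where abC: "a > 0" "b \<ge> 0" "C \<ge> 0"
    and bd: "\<And>z. cmod (\<Phi> z) \<le> C * exp (b * (norm (Im_vec z))\<^sup>2 - a * (norm (Re_vec z))\<^sup>2)"
    by (rule gs_entireE[OF assms]) (rule that)
  show ?thesis
  proof (rule gs_entireI[where a = "a / 2" and b = "2 * b"
        and C = "C * exp (2 * b * (norm (Im_vec s))\<^sup>2 + a * (norm (Re_vec s))\<^sup>2)"])
    show "line_holomorphic (\<lambda>z. \<Phi> (z + s))"
      using assms line_holomorphic_affine[of \<Phi> "mat 1" s] by (simp add: gs_entire_def)
    fix z
    have "b * (norm (Im_vec z + Im_vec s))\<^sup>2 \<le> b * (2 * (norm (Im_vec z))\<^sup>2 + 2 * (norm (Im_vec s))\<^sup>2)"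
      using norm_add_power2_le abC by (intro mult_left_mono) auto
    moreover have "a * ((norm (Re_vec z))\<^sup>2 / 2 - (norm (Re_vec s))\<^sup>2) \<le> a * (norm (Re_vec z + Re_vec s))\<^sup>2"
      using norm_add_power2_ge abC by (intro mult_left_mono) auto
    ultimately have "b * (norm (Im_vec (z + s)))\<^sup>2 - a * (norm (Re_vec (z + s)))\<^sup>2 \<le>
        (2 * b * (norm (Im_vec s))\<^sup>2 + a * (norm (Re_vec s))\<^sup>2) +
        (2 * b * (norm (Im_vec z))\<^sup>2 - a / 2 * (norm (Re_vec z))\<^sup>2)"
      by (simp add: algebra_simps)
    then have "C * exp (b * (norm (Im_vec (z + s)))\<^sup>2 - a * (norm (Re_vec (z + s)))\<^sup>2) \<le>
        C * exp ((2 * b * (norm (Im_vec s))\<^sup>2 + a * (norm (Re_vec s))\<^sup>2) +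
        (2 * b * (norm (Im_vec z))\<^sup>2 - a / 2 * (norm (Re_vec z))\<^sup>2))"
      using abC by (intro mult_left_mono) auto
    then show "cmod (\<Phi> (z + s)) \<le> C * exp (2 * b * (norm (Im_vec s))\<^sup>2 + a * (norm (Re_vec s))\<^sup>2) *
        exp (2 * b * (norm (Im_vec z))\<^sup>2 - a / 2 * (norm (Re_vec z))\<^sup>2)"
      using bd[of "z + s"] unfolding exp_add mult.assoc by linarith
  qed (use abC in auto)
qed

lemma Re_Im_vec_real_matrix:
  "Re_vec (map_matrix complex_of_real E *v z) = E *v Re_vec z"
  "Im_vec (map_matrix complex_of_real E *v z) = E *v Im_vec z"
  by (simp_all add: vec_eq_iff matrix_vector_mult_def map_matrix_def)

lemma cvec_matrix: "cvec (E *v x) = map_matrix complex_of_real E *v cvec x"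
  by (simp add: vec_eq_iff matrix_vector_mult_def map_matrix_def)

lemma matrix_bounded:
  fixes A :: "real^'n^'m"
  obtains K where "K > 0" "\<And>x. norm (A *v x) \<le> K * norm x"
  using linear_bounded_pos[OF matrix_vector_mul_linear[of A]] that by blast

text \<open>A real matrix acts on real and imaginary parts separately. Its operator bound controls
  the new growth in imaginary directions, and injectivity gives the lower bound \<open>c\<close>
  that keeps decay in the real ones.\<close>

lemma gs_entire_linear:
  fixes E :: "real^'d^'d"
  assumes "gs_entire \<Phi>" and E: "invertible E"
  shows "gs_entire (\<lambda>z. \<Phi> (map_matrix complex_of_real E *v z))"
proof -
  obtain a b C where abC: "a > 0" "b \<ge> 0" "C \<ge> 0"
    and bd: "\<And>z. cmod (\<Phi> z) \<le> C * exp (b * (norm (Im_vec z))\<^sup>2 - a * (norm (Re_vec z))\<^sup>2)"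
    by (rule gs_entireE[OF assms(1)]) (rule that)
  obtain K where K: "K > 0" "\<And>x. norm (E *v x) \<le> K * norm x"
    using matrix_bounded by blast
  obtain c where c: "c > 0" "\<And>x. norm (E *v x) \<ge> c * norm x"
  proof -
    have "inj ((*v) E)" using E by (simp add: inj_matrix_vector_mult)
    then show ?thesis
      using linear_inj_bounded_below_pos[OF matrix_vector_mul_linear[of E]] that by blast
  qed
  show ?thesis
  proof (rule gs_entireI[where a = "a * c\<^sup>2" and b = "b * K\<^sup>2" and C = C])
    show "line_holomorphic (\<lambda>z. \<Phi> (map_matrix complex_of_real E *v z))"
      using assms line_holomorphic_affine[of \<Phi> "map_matrix complex_of_real E" 0] by (simp add: gs_entire_def)
    fix z
    have "b * (norm (E *v Im_vec z))\<^sup>2 \<le> b * (K * norm (Im_vec z))\<^sup>2"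
      using K abC by (intro mult_left_mono power_mono) auto
    moreover have "a * (c * norm (Re_vec z))\<^sup>2 \<le> a * (norm (E *v Re_vec z))\<^sup>2"
      using c abC by (intro mult_left_mono power_mono) auto
    ultimately have "b * (norm (E *v Im_vec z))\<^sup>2 - a * (norm (E *v Re_vec z))\<^sup>2 \<le>
        b * K\<^sup>2 * (norm (Im_vec z))\<^sup>2 - a * c\<^sup>2 * (norm (Re_vec z))\<^sup>2"
      by (simp add: power_mult_distrib mult.assoc)
    then have "C * exp (b * (norm (E *v Im_vec z))\<^sup>2 - a * (norm (E *v Re_vec z))\<^sup>2) \<le>
        C * exp (b * K\<^sup>2 * (norm (Im_vec z))\<^sup>2 - a * c\<^sup>2 * (norm (Re_vec z))\<^sup>2)"
      using abC by (intro mult_left_mono) auto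
    then show "cmod (\<Phi> (map_matrix complex_of_real E *v z)) \<le>
        C * exp (b * K\<^sup>2 * (norm (Im_vec z))\<^sup>2 - a * c\<^sup>2 * (norm (Re_vec z))\<^sup>2)"
      using bd[of "map_matrix complex_of_real E *v z"] unfolding Re_Im_vec_real_matrix by linarith
  qed (use abC c in auto)
qed

lemma gs_entire_scale:
  assumes "gs_entire \<Phi>" shows "gs_entire (\<lambda>z. c * \<Phi> z)"
proof -
  have "tame_multiplier (\<lambda>z::complex^'a. c)"
    unfolding tame_multiplier_def
  proof (intro conjI allI impI)
    fix \<epsilon> :: real assume that: "\<epsilon> > 0"
    show "\<exists>B K. \<forall>z::complex^'a. cmod c \<le> K * exp (B * (norm (Im_vec z))\<^sup>2 + \<epsilon> * (norm (Re_vec z))\<^sup>2)"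
    proof (rule exI[of _ 0], rule exI[of _ "cmod c"], rule allI)
      fix z :: "complex^'a"
      have "cmod c * 1 \<le> cmod c * exp (0 * (norm (Im_vec z))\<^sup>2 + \<epsilon> * (norm (Re_vec z))\<^sup>2)"
        using that by (intro mult_left_mono) auto
      then show "cmod c \<le> cmod c * exp (0 * (norm (Im_vec z))\<^sup>2 + \<epsilon> * (norm (Re_vec z))\<^sup>2)" by simp
    qed
  qed (simp add: line_holomorphic_def)
  then show ?thesis using assms by (rule gs_entire_multiplier)
qed

lemma gs_entire_add:
  fixes \<Phi> \<Psi> :: "complex^'d \<Rightarrow> complex"
  assumes "gs_entire \<Phi>" "gs_entire \<Psi>" shows "gs_entire (\<lambda>z. \<Phi> z + \<Psi> z)"
proof -
  obtain a b C where 1: "a > 0" "b \<ge> 0" "C \<ge> 0"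
    "\<And>z. cmod (\<Phi> z) \<le> C * exp (b * (norm (Im_vec z))\<^sup>2 - a * (norm (Re_vec z))\<^sup>2)"
    by (rule gs_entireE[OF assms(1)]) (rule that)
  obtain a' b' C' where 2: "a' > 0" "b' \<ge> 0" "C' \<ge> 0"
    "\<And>z. cmod (\<Psi> z) \<le> C' * exp (b' * (norm (Im_vec z))\<^sup>2 - a' * (norm (Re_vec z))\<^sup>2)"
    by (rule gs_entireE[OF assms(2)]) (rule that)
  let ?b = "max b b'" and ?a = "min a a'"
  show ?thesis
  proof (rule gs_entireI[where a = ?a and b = ?b and C = "C + C'"])
    show "line_holomorphic (\<lambda>z. \<Phi> z + \<Psi> z)"
      using assms by (auto simp: gs_entire_def line_holomorphic_def intro!: holomorphic_intros)
    fix z :: "complex^'d"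
    let ?e = "exp (?b * (norm (Im_vec z))\<^sup>2 - ?a * (norm (Re_vec z))\<^sup>2)"
    have "C * exp (b * (norm (Im_vec z))\<^sup>2 - a * (norm (Re_vec z))\<^sup>2) \<le> C * ?e"
      using 1 by (intro mult_left_mono iffD2[OF exp_le_cancel_iff] diff_mono mult_right_mono) auto
    moreover have "C' * exp (b' * (norm (Im_vec z))\<^sup>2 - a' * (norm (Re_vec z))\<^sup>2) \<le> C' * ?e"
      using 2 by (intro mult_left_mono iffD2[OF exp_le_cancel_iff] diff_mono mult_right_mono) auto
    ultimately show "cmod (\<Phi> z + \<Psi> z) \<le> (C + C') * ?e"
      using norm_triangle_ineq[of "\<Phi> z" "\<Psi> z"] 1(4)[of z] 2(4)[of z] unfolding distrib_right by linarith
  qed (use 1 2 in auto)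
qed

text \<open>With z = x + i y and Q = A + i B, the real part of i pi (Q z).z is -pi times (B x).x -
  (B y).y + (A x).y + (A y).x. The first term has the right sign by \<open>im_nonneg\<close>, the
  second grows only in y, and the mixed terms cost an arbitrarily small multiple of |x|^2.\<close>

lemma tame_exp_quadratic:
  fixes Q :: "complex^'d^'d"
  assumes "im_nonneg Q"
  shows "tame_multiplier (\<lambda>z. exp (\<i> * pi * ((Q *v z) \<bullet>\<^sub>c z)))"
  unfolding tame_multiplier_def
proof (intro conjI allI impI)
  show "line_holomorphic (\<lambda>z. exp (\<i> * pi * ((Q *v z) \<bullet>\<^sub>c z)))" by (rule line_holomorphic_exp_quadratic)
  fix \<epsilon> :: real assume e: "\<epsilon> > 0"
  define A where "A = map_matrix Re Q"
  define B where "B = map_matrix Im Q"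
  obtain K where K: "K > 0" "\<And>x. norm (A *v x) \<le> K * norm x" using matrix_bounded by blast
  obtain L where L: "L > 0" "\<And>x. norm (B *v x) \<le> L * norm x" using matrix_bounded by blast
  let ?P = "pi * L + (2 * pi * K)\<^sup>2 / (4 * \<epsilon>)"
  have "cmod (exp (\<i> * pi * ((Q *v z) \<bullet>\<^sub>c z))) \<le> 1 * exp (?P * (norm (Im_vec z))\<^sup>2 + \<epsilon> * (norm (Re_vec z))\<^sup>2)" for z
  proof -
    define x y where "x = Re_vec z" and "y = Im_vec z"
    have "Re_vec (Q *v z) = A *v x - B *v y" "Im_vec (Q *v z) = A *v y + B *v x"
      by (simp_all add: vec_eq_iff matrix_vector_mult_def map_matrix_def A_def B_def x_def y_def
          sum_subtractf sum.distrib)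
    then have im: "Im ((Q *v z) \<bullet>\<^sub>c z) = (A *v x) \<bullet> y - (B *v y) \<bullet> y + (A *v y) \<bullet> x + (B *v x) \<bullet> x"
      by (simp add: bdot_Im x_def[symmetric] y_def[symmetric] inner_simps)
    have "Re (\<i> * pi * ((Q *v z) \<bullet>\<^sub>c z)) = - (pi * Im ((Q *v z) \<bullet>\<^sub>c z))" by simp
    then have eq: "Re (\<i> * pi * ((Q *v z) \<bullet>\<^sub>c z)) =
        - (pi * ((A *v x) \<bullet> y)) - pi * ((A *v y) \<bullet> x) - pi * ((B *v x) \<bullet> x) + pi * ((B *v y) \<bullet> y)"
      unfolding im by (simp add: algebra_simps)
    have A: "- (pi * ((A *v u) \<bullet> v)) \<le> pi * (K * norm u) * norm v" for u v
      by (rule order_trans[OF neg_inner_le mult_right_mono[OF mult_left_mono[OF K(2)]]]) auto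
    note 1 = A[of x y] and 2 = A[of y x]
    have 3: "0 \<le> pi * ((B *v x) \<bullet> x)"
      using assms by (simp add: im_nonneg_def B_def)
    have "pi * ((B *v y) \<bullet> y) \<le> pi * (L * norm y * norm y)"
      by (intro mult_left_mono order_trans[OF norm_cauchy_schwarz] mult_right_mono L) auto
    then have 4: "pi * ((B *v y) \<bullet> y) \<le> pi * L * (norm y)\<^sup>2"
      by (simp only: power2_eq_square mult.assoc)
    have 5: "(2 * pi * K * norm y) * norm x \<le> \<epsilon> * (norm x)\<^sup>2 + (2 * pi * K * norm y)\<^sup>2 / (4 * \<epsilon>)"
      by (rule mult_le_eps[OF e])
    have 6: "(2 * pi * K * norm y)\<^sup>2 / (4 * \<epsilon>) = (2 * pi * K)\<^sup>2 / (4 * \<epsilon>) * (norm y)\<^sup>2"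
      by (simp add: power_mult_distrib)
    have 7: "(2 * pi * K * norm y) * norm x = pi * (K * norm x) * norm y + pi * (K * norm y) * norm x"
      by (simp add: algebra_simps)
    have "Re (\<i> * pi * ((Q *v z) \<bullet>\<^sub>c z)) \<le> ?P * (norm y)\<^sup>2 + \<epsilon> * (norm x)\<^sup>2"
      using 1 2 3 4 5 unfolding eq 6 7 distrib_right by linarith
    then show ?thesis by (simp add: norm_exp_eq_Re x_def y_def)
  qed
  then show "\<exists>B K. \<forall>z. cmod (exp (\<i> * pi * ((Q *v z) \<bullet>\<^sub>c z))) \<le> K * exp (B * (norm (Im_vec z))\<^sup>2 + \<epsilon> * (norm (Re_vec z))\<^sup>2)"
    by blast
qed

lemma bdot_simps:
  "(x + y) \<bullet>\<^sub>c z = x \<bullet>\<^sub>c z + y \<bullet>\<^sub>c z" "z \<bullet>\<^sub>c (x + y) = z \<bullet>\<^sub>c x + z \<bullet>\<^sub>c y"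
  "(x - y) \<bullet>\<^sub>c z = x \<bullet>\<^sub>c z - y \<bullet>\<^sub>c z" "z \<bullet>\<^sub>c (x - y) = z \<bullet>\<^sub>c x - z \<bullet>\<^sub>c y"
  "(- x) \<bullet>\<^sub>c z = - (x \<bullet>\<^sub>c z)" "z \<bullet>\<^sub>c (- x) = - (z \<bullet>\<^sub>c x)"
  "(c *s x) \<bullet>\<^sub>c z = c * (x \<bullet>\<^sub>c z)" "z \<bullet>\<^sub>c (c *s x) = c * (z \<bullet>\<^sub>c x)"
  "cvec t \<bullet>\<^sub>c cvec u = complex_of_real (t \<bullet> u)" "0 \<bullet>\<^sub>c z = 0" "z \<bullet>\<^sub>c 0 = 0"
  by (simp_all add: bdot_def algebra_simps sum.distrib sum_subtractf sum_negf sum_distrib_left inner_vec_def)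

lemma bdot_commute: "x \<bullet>\<^sub>c y = y \<bullet>\<^sub>c x"
  by (simp add: bdot_def mult.commute)

lemma gs_entire_gauss:
  assumes "c > 0"
  shows "gs_entire (\<lambda>z. exp (- complex_of_real c * (z \<bullet>\<^sub>c z)))"
proof (rule gs_entireI[where a = c and b = c and C = 1])
  show "line_holomorphic (\<lambda>z::complex^'a. exp (- complex_of_real c * (z \<bullet>\<^sub>c z)))"
    using line_holomorphic_exp_quadratic[of "- complex_of_real c" "mat 1"] by simp
qed (use assms in \<open>auto simp: norm_exp_eq_Re bdot_Re bdot_Im dot_square_norm algebra_simps\<close>)

subsection \<open>Fourier inversion\<close>

lemma integral_lborel_scaleR:
  fixes f :: "'a::euclidean_space \<Rightarrow> 'b::{banach, second_countable_topology}"
  assumes [measurable]: "f \<in> borel_measurable borel" and c: "c \<noteq> 0"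
  shows "(LINT x|lborel. f x) = \<bar>c\<bar> ^ DIM('a) *\<^sub>R (LINT x|lborel. f (t + c *\<^sub>R x))"
  by (subst lborel_affine[OF c, of t])
     (simp add: integral_density integral_distr)

lemma norm_exp_i [simp]: "cmod (exp (2 * pi * \<i> * complex_of_real r)) = 1"
  "cmod (exp (- (2 * pi * \<i> * complex_of_real r))) = 1"
  by (simp_all add: norm_exp_eq_Re)

lemma fourier_pairing:
  fixes \<phi> \<psi> :: "real^'d \<Rightarrow> complex"
  assumes \<phi>: "integrable lborel \<phi>" and \<psi>: "integrable lborel \<psi>"
  shows "(LINT \<omega>|lborel. fourier \<phi> \<omega> * \<psi> \<omega>) = (LINT t|lborel. \<phi> t * fourier \<psi> t)"
proof -
  have [measurable]: "\<phi> \<in> borel_measurable borel" "\<psi> \<in> borel_measurable borel"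
    using \<phi> \<psi> by auto
  define f where "f \<omega> t = \<phi> t * exp (- (2 * pi * \<i> * complex_of_real (\<omega> \<bullet> t))) * \<psi> \<omega>" for \<omega> t
  have [measurable]: "(\<lambda>(\<omega>, t). f \<omega> t) \<in> borel_measurable (lborel \<Otimes>\<^sub>M lborel)"
    unfolding f_def by measurable
  have nf: "norm (f \<omega> t) = norm (\<phi> t) * norm (\<psi> \<omega>)" for \<omega> t by (simp add: f_def norm_mult)
  have "integrable (lborel \<Otimes>\<^sub>M lborel) (\<lambda>(\<omega>, t). f \<omega> t)"
  proof (rule lborel_pair.Fubini_integrable)
    show "integrable lborel (\<lambda>\<omega>. LINT t|lborel. norm (case (\<omega>, t) of (\<omega>, t) \<Rightarrow> f \<omega> t))"
      using \<psi> by (simp add: nf)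
    show "AE \<omega> in lborel. integrable lborel (\<lambda>t. case (\<omega>, t) of (\<omega>, t) \<Rightarrow> f \<omega> t)"
    proof (intro AE_I2)
      fix \<omega>
      have "integrable lborel (f \<omega>)"
        by (rule Bochner_Integration.integrable_bound[of _ "\<lambda>t. norm (\<phi> t) * norm (\<psi> \<omega>)"])
           (use \<phi> in \<open>auto simp: nf\<close>)
      then show "integrable lborel (\<lambda>t. case (\<omega>, t) of (\<omega>, t) \<Rightarrow> f \<omega> t)" by simp
    qed
  qed measurable
  from lborel_pair.Fubini_integral[OF this]
  have "(LINT t|lborel. LINT \<omega>|lborel. f \<omega> t) = (LINT \<omega>|lborel. LINT t|lborel. f \<omega> t)" .
  moreover have "(LINT t|lborel. f \<omega> t) = fourier \<phi> \<omega> * \<psi> \<omega>" for \<omega>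
    by (simp add: f_def fourier_def)
  moreover have "(LINT \<omega>|lborel. f \<omega> t) = \<phi> t * fourier \<psi> t" for t
    unfolding f_def fourier_def
    by (subst integral_mult_right_zero[symmetric]) (simp add: mult_ac inner_commute)
  ultimately show ?thesis by simp
qed

lemma integral_gauss_pi_complex:
  "(LINT t::real^'d|lborel. complex_of_real (exp (- pi * (norm t)\<^sup>2))) = 1"
  using integral_gauss_pi[where 'a="real^'d"] by (subst integral_complex_of_real) simp

lemma gauss_cvec: "exp (- complex_of_real c * (cvec t \<bullet>\<^sub>c cvec t)) = complex_of_real (exp (- c * (norm t)\<^sup>2))"
  by (simp add: bdot_simps dot_square_norm exp_of_real[symmetric])

text \<open>Completing the square turns the Fourier integral into exp (- pi |\<omega>|^2) times the
  Gaussian integral over the contour R^d + i \<omega>, which \<open>contour_shift\<close> moves back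
  to R^d.\<close>

lemma fourier_gauss:
  "fourier (\<lambda>t::real^'d. complex_of_real (exp (- pi * (norm t)\<^sup>2))) \<omega> = complex_of_real (exp (- pi * (norm \<omega>)\<^sup>2))"
proof -
  define \<Phi> :: "complex^'d \<Rightarrow> complex" where "\<Phi> z = exp (- complex_of_real pi * (z \<bullet>\<^sub>c z))" for z
  have "gs_entire \<Phi>" unfolding \<Phi>_def[abs_def] by (rule gs_entire_gauss) simp
  then have "(LINT t|lborel. \<Phi> (cvec t + \<i> *s cvec \<omega>)) = (LINT t|lborel. \<Phi> (cvec t))"
    by (rule contour_shift)
  also have "\<dots> = 1"
    by (simp only: \<Phi>_def gauss_cvec integral_gauss_pi_complex)
  finally have "(LINT t|lborel. \<Phi> (cvec t + \<i> *s cvec \<omega>)) = 1" .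
  moreover have "\<Phi> (cvec t + \<i> *s cvec \<omega>) =
      complex_of_real (exp (pi * (norm \<omega>)\<^sup>2)) * (complex_of_real (exp (- pi * (norm t)\<^sup>2)) * exp (- (2 * pi * \<i> * complex_of_real (\<omega> \<bullet> t))))" for t
    by (simp add: \<Phi>_def bdot_simps dot_square_norm exp_of_real[symmetric] mult_exp_exp algebra_simps inner_commute)
  ultimately have "complex_of_real (exp (pi * (norm \<omega>)\<^sup>2)) *
      fourier (\<lambda>t::real^'d. complex_of_real (exp (- pi * (norm t)\<^sup>2))) \<omega> = 1"
    by (simp add: fourier_def)
  moreover have "complex_of_real (exp (- pi * (norm \<omega>)\<^sup>2)) * complex_of_real (exp (pi * (norm \<omega>)\<^sup>2)) = 1"
    unfolding of_real_mult[symmetric] by (simp add: mult_exp_exp)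
  moreover have "f = b" if "a * f = 1" "b * a = 1" for a b f :: complex
    using that by (metis mult.assoc mult_1 mult_1_right)
  ultimately show ?thesis by blast
qed

text \<open>After the rescaling \<open>s = t + \<epsilon> u\<close>, the inversion integral damped by \<open>exp (- \<pi> |\<epsilon> \<omega>|\<^sup>2)\<close> equals the
  mean of \<open>\<phi> (t + \<epsilon> u)\<close> with respect to the Gaussian weight in \<open>u\<close>.\<close>

lemma fourier_inversion:
  fixes \<phi> :: "real^'d \<Rightarrow> complex"
  assumes \<phi>: "integrable lborel \<phi>" "continuous_on UNIV \<phi>" "\<And>t. cmod (\<phi> t) \<le> B"
    and hat: "integrable lborel (fourier \<phi>)"
  shows "inv_fourier (fourier \<phi>) t = \<phi> t"
proof -
  have [measurable]: "\<phi> \<in> borel_measurable borel" using \<phi> by auto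
  have [measurable]: "fourier \<phi> \<in> borel_measurable borel" using hat by auto
  define g :: "real^'d \<Rightarrow> complex" where "g u = complex_of_real (exp (- pi * (norm u)\<^sup>2))" for u
  have gi: "integrable lborel g" unfolding g_def[abs_def] using integrable_gauss[of pi] by auto
  have [measurable]: "g \<in> borel_measurable borel" using gi by auto
  have g1: "cmod (g u) \<le> 1" for u by (simp add: g_def)
  define \<epsilon> :: "nat \<Rightarrow> real" where "\<epsilon> n = 1 / Suc n" for n
  have e0: "\<epsilon> n > 0" for n by (simp add: \<epsilon>_def)
  have elim: "\<epsilon> \<longlonglongrightarrow> 0" unfolding \<epsilon>_def by (rule LIMSEQ_Suc[OF lim_1_over_n])
  \<comment> \<open>The damped inversion integrals. Their limit is computed once directly and once
    after passing the Fourier transform to the Gaussian, which is its own transform.\<close>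
  define J where "J n = (LINT \<omega>|lborel. g (\<epsilon> n *\<^sub>R \<omega>) * (fourier \<phi> \<omega> * exp (2 * pi * \<i> * complex_of_real (\<omega> \<bullet> t))))" for n
  have lim1: "J \<longlonglongrightarrow> inv_fourier (fourier \<phi>) t"
    unfolding J_def inv_fourier_def
  proof (rule integral_dominated_convergence[where w = "\<lambda>\<omega>. cmod (fourier \<phi> \<omega>)"])
    show "AE \<omega> in lborel. (\<lambda>n. g (\<epsilon> n *\<^sub>R \<omega>) * (fourier \<phi> \<omega> * exp (2 * pi * \<i> * complex_of_real (\<omega> \<bullet> t))))
      \<longlonglongrightarrow> fourier \<phi> \<omega> * exp (2 * pi * \<i> * complex_of_real (\<omega> \<bullet> t))"
    proof (intro AE_I2)
      fix \<omega>
      have "(\<lambda>n. g (\<epsilon> n *\<^sub>R \<omega>)) \<longlonglongrightarrow> complex_of_real (exp (- pi * (norm (0 *\<^sub>R \<omega>))\<^sup>2))"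
        unfolding g_def by (intro tendsto_intros elim)
      then have "(\<lambda>n. g (\<epsilon> n *\<^sub>R \<omega>) * (fourier \<phi> \<omega> * exp (2 * pi * \<i> * complex_of_real (\<omega> \<bullet> t))))
        \<longlonglongrightarrow> complex_of_real (exp (- pi * (norm (0 *\<^sub>R \<omega>))\<^sup>2)) * (fourier \<phi> \<omega> * exp (2 * pi * \<i> * complex_of_real (\<omega> \<bullet> t)))"
        by (rule tendsto_mult_right)
      then show "(\<lambda>n. g (\<epsilon> n *\<^sub>R \<omega>) * (fourier \<phi> \<omega> * exp (2 * pi * \<i> * complex_of_real (\<omega> \<bullet> t))))
        \<longlonglongrightarrow> fourier \<phi> \<omega> * exp (2 * pi * \<i> * complex_of_real (\<omega> \<bullet> t))" by simp
    qed
    show "AE \<omega> in lborel. cmod (g (\<epsilon> n *\<^sub>R \<omega>) * (fourier \<phi> \<omega> * exp (2 * pi * \<i> * complex_of_real (\<omega> \<bullet> t)))) \<le> cmod (fourier \<phi> \<omega>)" for n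
      using g1 by (auto simp: norm_mult intro!: mult_left_le_one_le)
  qed (use hat in auto)
  have J: "J n = (LINT u|lborel. \<phi> (t + \<epsilon> n *\<^sub>R u) * g u)" for n
  proof -
    define \<psi> where "\<psi> u = \<phi> (t + \<epsilon> n *\<^sub>R u)" for u
    have \<psi>i: "integrable lborel \<psi>"
    proof -
      have "integrable (density (distr lborel borel (\<lambda>x. t + \<epsilon> n *\<^sub>R x)) (\<lambda>_. ennreal (\<bar>\<epsilon> n\<bar> ^ DIM(real^'d)))) \<phi>"
        using \<phi>(1) lborel_affine[of "\<epsilon> n" t] e0[of n] by simp
      then have "integrable lborel (\<lambda>u. (\<bar>\<epsilon> n\<bar> ^ DIM(real^'d)) *\<^sub>R \<psi> u)" using e0[of n]
        by (subst (asm) integrable_density, simp, simp, simp, subst (asm) integrable_distr_eq)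
           (auto simp: \<psi>_def[abs_def])
      from integrable_scaleR_right[OF this, of "inverse (\<bar>\<epsilon> n\<bar> ^ DIM(real^'d))"]
      show ?thesis using e0[of n] by simp
    qed
    let ?c = "\<bar>\<epsilon> n\<bar> ^ DIM(real^'d)"
    \<comment> \<open>The substitution centres the integral at t; its phase cancels the exponential
      of the inversion formula, and the Jacobian is used up again when \<omega> is rescaled.\<close>
    have "fourier \<phi> \<omega> * exp (2 * pi * \<i> * complex_of_real (\<omega> \<bullet> t)) = ?c *\<^sub>R fourier \<psi> (\<epsilon> n *\<^sub>R \<omega>)" for \<omega>
    proof -
      have "fourier \<phi> \<omega> = ?c *\<^sub>R (LINT u|lborel. \<phi> (t + \<epsilon> n *\<^sub>R u) * exp (- (2 * pi * \<i> * complex_of_real (\<omega> \<bullet> (t + \<epsilon> n *\<^sub>R u)))))"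
        unfolding fourier_def using e0[of n] by (subst integral_lborel_scaleR[where c = "\<epsilon> n" and t = t]) auto
      also have "(LINT u|lborel. \<phi> (t + \<epsilon> n *\<^sub>R u) * exp (- (2 * pi * \<i> * complex_of_real (\<omega> \<bullet> (t + \<epsilon> n *\<^sub>R u)))))
          = (LINT u|lborel. exp (- (2 * pi * \<i> * complex_of_real (\<omega> \<bullet> t))) * (\<psi> u * exp (- (2 * pi * \<i> * complex_of_real ((\<epsilon> n *\<^sub>R \<omega>) \<bullet> u)))))"
        by (intro Bochner_Integration.integral_cong)
           (auto simp: \<psi>_def inner_simps mult_exp_exp algebra_simps)
      also have "\<dots> = exp (- (2 * pi * \<i> * complex_of_real (\<omega> \<bullet> t))) * fourier \<psi> (\<epsilon> n *\<^sub>R \<omega>)"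
        by (simp add: fourier_def)
      finally have "fourier \<phi> \<omega> * exp (2 * pi * \<i> * complex_of_real (\<omega> \<bullet> t)) =
          ?c *\<^sub>R fourier \<psi> (\<epsilon> n *\<^sub>R \<omega>) * (exp (- (2 * pi * \<i> * complex_of_real (\<omega> \<bullet> t))) * exp (2 * pi * \<i> * complex_of_real (\<omega> \<bullet> t)))"
        by (simp add: mult_ac scaleR_conv_of_real)
      then show ?thesis by (simp add: mult_exp_exp)
    qed
    then have "J n = (LINT \<omega>|lborel. ?c *\<^sub>R (g (\<epsilon> n *\<^sub>R \<omega>) * fourier \<psi> (\<epsilon> n *\<^sub>R \<omega>)))"
      by (simp add: J_def)
    also have "\<dots> = ?c *\<^sub>R (LINT \<omega>|lborel. g (0 + \<epsilon> n *\<^sub>R \<omega>) * fourier \<psi> (0 + \<epsilon> n *\<^sub>R \<omega>))"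
      by simp
    also have "\<dots> = (LINT \<omega>|lborel. g \<omega> * fourier \<psi> \<omega>)"
    proof (rule integral_lborel_scaleR[symmetric])
      show "(\<lambda>\<omega>. g \<omega> * fourier \<psi> \<omega>) \<in> borel_measurable borel"
        unfolding fourier_def \<psi>_def by measurable
    qed (use e0[of n] in simp)
    also have "\<dots> = (LINT u|lborel. \<psi> u * fourier g u)"
      using fourier_pairing[OF \<psi>i gi] by (simp add: mult.commute)
    also have "\<dots> = (LINT u|lborel. \<psi> u * g u)"
      unfolding g_def[abs_def] fourier_gauss ..
    finally show ?thesis by (simp add: \<psi>_def)
  qed
  have lim2: "J \<longlonglongrightarrow> (LINT u|lborel. \<phi> t * g u)"
    unfolding J
  proof (rule integral_dominated_convergence[where w = "\<lambda>u. B * cmod (g u)"])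
    show "AE u in lborel. (\<lambda>n. \<phi> (t + \<epsilon> n *\<^sub>R u) * g u) \<longlonglongrightarrow> \<phi> t * g u"
    proof (intro AE_I2 tendsto_mult_right)
      fix u
      have "(\<lambda>n. t + \<epsilon> n *\<^sub>R u) \<longlonglongrightarrow> t + 0 *\<^sub>R u" by (intro tendsto_intros elim)
      then show "(\<lambda>n. \<phi> (t + \<epsilon> n *\<^sub>R u)) \<longlonglongrightarrow> \<phi> t"
        using \<phi>(2) by (intro continuous_on_tendsto_compose[of UNIV \<phi>]) auto
    qed
    show "AE u in lborel. norm (\<phi> (t + \<epsilon> n *\<^sub>R u) * g u) \<le> B * cmod (g u)" for n
      using \<phi>(3) by (auto simp: norm_mult intro!: mult_right_mono)
  qed (use gi in auto)
  have "(LINT u|lborel. \<phi> t * g u) = \<phi> t"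
    unfolding g_def integral_mult_right_zero integral_gauss_pi_complex by simp
  then show ?thesis using LIMSEQ_unique[OF lim1 lim2] by simp
qed

subsection \<open>Fourier transforms of entire functions with Gaussian growth\<close>

text \<open>The Fourier--Laplace transform, written as modulation by - \<zeta> so that the lemmas on
  modulated entire functions apply to the integrand as it stands.\<close>

definition cfourier :: "(complex^'d \<Rightarrow> complex) \<Rightarrow> complex^'d \<Rightarrow> complex" where
  "cfourier \<Phi> \<zeta> = (LINT t|lborel. exp (2 * pi * \<i> * (- \<zeta> \<bullet>\<^sub>c cvec t)) * \<Phi> (cvec t))"

lemma fourier_cvec: "fourier (\<lambda>t. \<Phi> (cvec t)) \<omega> = cfourier \<Phi> (cvec \<omega>)"
  by (simp add: fourier_def cfourier_def bdot_simps mult.commute)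

lemma gs_entire_modulation:
  "gs_entire \<Phi> \<Longrightarrow> gs_entire (\<lambda>z. exp (2 * pi * \<i> * (\<xi> \<bullet>\<^sub>c z)) * \<Phi> z)"
  by (rule gs_entire_multiplier[OF tame_exp_linear])

lemma cmod_bdot_le: "cmod (x \<bullet>\<^sub>c z) \<le> norm x * norm z"
proof -
  have "cmod (x \<bullet>\<^sub>c z) \<le> (\<Sum>j\<in>UNIV. \<bar>norm (x $ j)\<bar> * \<bar>norm (z $ j)\<bar>)"
    unfolding bdot_def by (rule order_trans[OF norm_sum]) (simp add: norm_mult)
  also have "\<dots> \<le> norm x * norm z"
    unfolding norm_vec_def by (rule L2_set_mult_ineq)
  finally show ?thesis .
qed

section \<open>Fourier--Laplace integrals of functions with Gaussian decay\<close>

definition gauss_bounded :: "(real^'d \<Rightarrow> complex) \<Rightarrow> bool" where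
  "gauss_bounded h \<longleftrightarrow> h \<in> borel_measurable borel \<and>
     (\<exists>a>0. \<exists>C. \<forall>t. cmod (h t) \<le> C * exp (- a * (norm t)\<^sup>2))"

text \<open>The inverse transform at complex arguments, with a density given on R^d only. A
  Gelfand--Shilov function is written in this form before any entire extension of it is known; the
  integral then is the extension.\<close>

definition exp_integral :: "(real^'d \<Rightarrow> complex) \<Rightarrow> complex^'d \<Rightarrow> complex" where
  "exp_integral h z = (LINT t|lborel. exp (2 * pi * \<i> * (z \<bullet>\<^sub>c cvec t)) * h t)"

lemma gauss_bounded_integrable: "gauss_bounded h \<Longrightarrow> integrable lborel h"
  unfolding gauss_bounded_def using integrable_gauss_bound by blast

lemma exp_bdot_measurable [measurable]:
  "(\<lambda>t. exp (2 * pi * \<i> * (z \<bullet>\<^sub>c cvec t))) \<in> borel_measurable borel"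
  unfolding bdot_def by (intro borel_measurable_continuous_onI continuous_intros)

lemma cmod_exp_bdot_le:
  "cmod (exp (2 * pi * \<i> * (z \<bullet>\<^sub>c cvec t))) \<le> exp (2 * pi * norm z * norm t)"
proof -
  have "Re (2 * pi * \<i> * (z \<bullet>\<^sub>c cvec t)) \<le> 2 * pi * cmod (z \<bullet>\<^sub>c cvec t)"
    using complex_Re_le_cmod[of "2 * pi * \<i> * (z \<bullet>\<^sub>c cvec t)"] by (simp add: norm_mult)
  also have "\<dots> \<le> 2 * pi * (norm z * norm (cvec t))"
    by (intro mult_left_mono cmod_bdot_le) simp
  finally show ?thesis by (simp only: norm_exp_eq_Re exp_le_cancel_iff norm_cvec mult.assoc)
qed

lemma exp_integral_dominated:
  fixes h :: "real^'d \<Rightarrow> complex"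
  assumes "gauss_bounded h"
  obtains w where "integrable lborel w"
    "\<And>z t. norm z \<le> R \<Longrightarrow> cmod (exp (2 * pi * \<i> * (z \<bullet>\<^sub>c cvec t)) * h t) \<le> w t"
proof -
  obtain a C where a: "a > 0" and bd: "\<And>t. cmod (h t) \<le> C * exp (- a * (norm t)\<^sup>2)"
    using assms by (auto simp: gauss_bounded_def)
  define M where "M = 2 * pi * R"
  let ?w = "\<lambda>t::real^'d. (\<bar>C\<bar> * exp (M\<^sup>2 / (4 * (a / 2)))) * exp (- (a / 2) * (norm t)\<^sup>2)"
  have "cmod (exp (2 * pi * \<i> * (z \<bullet>\<^sub>c cvec t)) * h t) \<le> ?w t" if z: "norm z \<le> R" for z t
  proof -
    have "2 * pi * norm z * norm t \<le> M * norm t"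
      using z unfolding M_def by (intro mult_right_mono mult_left_mono) auto
    also have "\<dots> \<le> a / 2 * (norm t)\<^sup>2 + M\<^sup>2 / (4 * (a / 2))" using a by (intro mult_le_eps) simp
    finally have "cmod (exp (2 * pi * \<i> * (z \<bullet>\<^sub>c cvec t)) * h t) \<le>
        exp (a / 2 * (norm t)\<^sup>2 + M\<^sup>2 / (4 * (a / 2))) * (\<bar>C\<bar> * exp (- a * (norm t)\<^sup>2))"
      unfolding norm_mult
      by (intro mult_mono order_trans[OF bd] order_trans[OF cmod_exp_bdot_le] mult_right_mono) auto
    also have "\<dots> = \<bar>C\<bar> * exp ((a / 2 * (norm t)\<^sup>2 + M\<^sup>2 / (4 * (a / 2))) + (- a * (norm t)\<^sup>2))"
      by (simp only: exp_add mult_ac)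
    also have "(a / 2 * (norm t)\<^sup>2 + M\<^sup>2 / (4 * (a / 2))) + (- a * (norm t)\<^sup>2)
        = M\<^sup>2 / (4 * (a / 2)) + - (a / 2) * (norm t)\<^sup>2" by (simp add: field_simps)
    finally show ?thesis by (simp only: exp_add mult_ac)
  qed
  moreover have "integrable lborel ?w"
    using a by (intro integrable_mult_right integrable_gauss) auto
  ultimately show ?thesis using that by blast
qed

lemma exp_integral_integrable:
  assumes "gauss_bounded h"
  shows "integrable lborel (\<lambda>t. exp (2 * pi * \<i> * (z \<bullet>\<^sub>c cvec t)) * h t)"
proof -
  obtain w where w: "integrable lborel w"
    "\<And>t. cmod (exp (2 * pi * \<i> * (z \<bullet>\<^sub>c cvec t)) * h t) \<le> w t"
    using exp_integral_dominated[OF assms, of "norm z"] by (metis order_refl)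
  have [measurable]: "h \<in> borel_measurable borel" using assms by (simp add: gauss_bounded_def)
  show ?thesis
    by (rule Bochner_Integration.integrable_bound[OF w(1)])
       (measurable, use w(2) in \<open>auto intro: order_trans[OF _ abs_ge_self]\<close>)
qed

lemma exp_integral_has_field_derivative:
  fixes h :: "real^'d \<Rightarrow> complex"
  assumes h: "gauss_bounded h"
  shows "((\<lambda>l. exp_integral h (z + l *s v)) has_field_derivative
    exp_integral (\<lambda>t. 2 * pi * \<i> * (v \<bullet>\<^sub>c cvec t) * h t) (z + l *s v)) (at l)"
proof -
  define G where "G t l = exp (2 * pi * \<i> * ((z + l *s v) \<bullet>\<^sub>c cvec t)) * h t" for t l
  have G': "(G t has_field_derivative
      exp (2 * pi * \<i> * ((z + l *s v) \<bullet>\<^sub>c cvec t)) * (2 * pi * \<i> * (v \<bullet>\<^sub>c cvec t) * h t)) (at l)" for t l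
    unfolding G_def[abs_def] bdot_simps by (auto intro!: derivative_eq_intros)
  have "((\<lambda>l. LINT t|lborel. G t l) has_field_derivative (LINT t|lborel. deriv (G t) l)) (at l)"
  proof (rule holomorphic_integral)
    show "G t holomorphic_on UNIV" for t
      unfolding holomorphic_on_open[OF open_UNIV] using G' by blast
    have [measurable]: "h \<in> borel_measurable borel" using h by (simp add: gauss_bounded_def)
    show "(\<lambda>t. G t l) \<in> borel_measurable lborel" for l unfolding G_def by measurable
    fix R :: real
    obtain w where w: "integrable lborel w"
      "\<And>z' t. norm z' \<le> norm z + R * norm v \<Longrightarrow> cmod (exp (2 * pi * \<i> * (z' \<bullet>\<^sub>c cvec t)) * h t) \<le> w t"
      using exp_integral_dominated[OF h] by blast
    have "cmod (G t l) \<le> w t" if "cmod l \<le> R" for t l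
      unfolding G_def using norm_triangle_ineq[of z "l *s v"] mult_right_mono[OF that, of "norm v"]
      by (intro w) simp
    then show "\<exists>w. integrable lborel w \<and> (\<forall>t l. cmod l \<le> R \<longrightarrow> cmod (G t l) \<le> w t)"
      using w(1) by blast
  qed
  then show ?thesis unfolding DERIV_imp_deriv[OF G'] exp_integral_def by (simp only: G_def)
qed

lemma line_holomorphic_exp_integral: "gauss_bounded h \<Longrightarrow> line_holomorphic (exp_integral h)"
  unfolding line_holomorphic_def holomorphic_on_open[OF open_UNIV]
  using exp_integral_has_field_derivative by blast

lemma gs_entire_gauss_bounded: "gs_entire \<Phi> \<Longrightarrow> gauss_bounded (\<lambda>t. \<Phi> (cvec t))"
  unfolding gauss_bounded_def
proof
  assume \<Phi>: "gs_entire \<Phi>"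
  show "(\<lambda>t. \<Phi> (cvec t)) \<in> borel_measurable borel" using gs_entire_measurable[OF \<Phi>, of 0] by simp
  obtain a b C where a: "a > 0" "b \<ge> 0" "C \<ge> 0"
    and bd: "\<And>z. cmod (\<Phi> z) \<le> C * exp (b * (norm (Im_vec z))\<^sup>2 - a * (norm (Re_vec z))\<^sup>2)"
    by (rule gs_entireE[OF \<Phi>]) (rule that)
  have "cmod (\<Phi> (cvec t)) \<le> C * exp (- a * (norm t)\<^sup>2)" for t
    using bd[of "cvec t"] by simp
  with a show "\<exists>a>0. \<exists>C. \<forall>t. cmod (\<Phi> (cvec t)) \<le> C * exp (- a * (norm t)\<^sup>2)"
    by blast
qed

text \<open>Gaussian decay of the Fourier transform comes from shifting the contour by a multiple of
  \<open>-i Re \<zeta>\<close>.\<close>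

lemma gs_entire_cfourier:
  fixes \<Phi> :: "complex^'d \<Rightarrow> complex"
  assumes "gs_entire \<Phi>" shows "gs_entire (cfourier \<Phi>)"
proof -
  obtain a b C where abC: "a > 0" "b \<ge> 0" "C \<ge> 0"
    and bd: "\<And>z. cmod (\<Phi> z) \<le> C * exp (b * (norm (Im_vec z))\<^sup>2 - a * (norm (Re_vec z))\<^sup>2)"
    by (rule gs_entireE[OF assms(1)]) (rule that)
  \<comment> \<open>Shifting by - i \<delta> x gains exp (- 2 pi \<delta> |x|^2) from the character
    and costs at most exp (b \<delta>^2 |x|^2) from \<Phi>; b \<delta> <= pi makes the cost at most
    half of the gain.\<close>
  define \<delta> where "\<delta> = pi / (b + 1)"
  have \<delta>: "\<delta> > 0" "b * \<delta> \<le> pi" using abC by (simp_all add: \<delta>_def field_simps)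
  define G where "G = (LINT t::real^'d|lborel. exp (- (a / 2) * (norm t)\<^sup>2))"
  show ?thesis
  proof (rule gs_entireI[where a = "pi * \<delta>" and b = "(2 * pi)\<^sup>2 / (2 * a)" and C = "C * G"])
    note L = line_holomorphic_affine[OF line_holomorphic_exp_integral[OF gs_entire_gauss_bounded[OF assms]], of "0 - mat 1" 0]
    have neg: "(0 - mat 1) *v z + 0 = - z" for z :: "complex^'d"
      unfolding matrix_vector_mult_diff_rdistrib by simp
    show "line_holomorphic (cfourier \<Phi>)"
      using L unfolding neg exp_integral_def cfourier_def[abs_def] .
    fix \<zeta> :: "complex^'d"
    define \<Psi> where "\<Psi> z = exp (2 * pi * \<i> * (- \<zeta> \<bullet>\<^sub>c z)) * \<Phi> z" for z
    have \<Psi>: "gs_entire \<Psi>" unfolding \<Psi>_def[abs_def] by (rule gs_entire_modulation[OF assms])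
    define x y where "x = Re_vec \<zeta>" and "y = Im_vec \<zeta>"
    define s where "s = (- \<i> * complex_of_real \<delta>) *s cvec x"
    have s: "Re_vec s = 0" "Im_vec s = (- \<delta>) *\<^sub>R x"
      by (simp_all add: vec_eq_iff s_def)
    have bound: "cmod (\<Psi> (cvec t + s)) \<le> (C * exp ((2 * pi)\<^sup>2 / (2 * a) * (norm y)\<^sup>2 - pi * \<delta> * (norm x)\<^sup>2)) * exp (- (a / 2) * (norm t)\<^sup>2)" for t
    proof -
      have "Re (2 * pi * \<i> * (- \<zeta> \<bullet>\<^sub>c (cvec t + s))) = 2 * pi * (y \<bullet> t) - 2 * pi * \<delta> * (norm x)\<^sup>2"
        by (simp add: bdot_simps(5) bdot_Im s x_def y_def algebra_simps dot_square_norm)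
      also have "2 * pi * (y \<bullet> t) \<le> (2 * pi * norm y) * norm t"
        using norm_cauchy_schwarz[of y t] by simp
      also have "(2 * pi * norm y) * norm t \<le> a / 2 * (norm t)\<^sup>2 + (2 * pi * norm y)\<^sup>2 / (4 * (a / 2))"
        using abC by (intro mult_le_eps) simp
      also have "(2 * pi * norm y)\<^sup>2 / (4 * (a / 2)) = (2 * pi)\<^sup>2 / (2 * a) * (norm y)\<^sup>2"
        by (simp add: power_mult_distrib)
      finally have 1: "Re (2 * pi * \<i> * (- \<zeta> \<bullet>\<^sub>c (cvec t + s))) \<le>
          a / 2 * (norm t)\<^sup>2 + (2 * pi)\<^sup>2 / (2 * a) * (norm y)\<^sup>2 - 2 * pi * \<delta> * (norm x)\<^sup>2" by simp
      have 2: "b * (norm (Im_vec s))\<^sup>2 \<le> pi * \<delta> * (norm x)\<^sup>2"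
      proof -
        have "b * (norm (Im_vec s))\<^sup>2 = (b * \<delta>) * (\<delta> * (norm x)\<^sup>2)"
          using \<delta> by (simp add: s power_mult_distrib power2_eq_square)
        also have "\<dots> \<le> pi * (\<delta> * (norm x)\<^sup>2)" using \<delta> by (intro mult_right_mono) auto
        finally show ?thesis by simp
      qed
      have "cmod (\<Psi> (cvec t + s)) \<le> exp (Re (2 * pi * \<i> * (- \<zeta> \<bullet>\<^sub>c (cvec t + s)))) *
          (C * exp (b * (norm (Im_vec s))\<^sup>2 - a * (norm t)\<^sup>2))"
        unfolding \<Psi>_def norm_mult norm_exp_eq_Re
        using bd[of "cvec t + s"] by (intro mult_left_mono) (auto simp: s)
      also have "\<dots> = C * exp (Re (2 * pi * \<i> * (- \<zeta> \<bullet>\<^sub>c (cvec t + s))) + (b * (norm (Im_vec s))\<^sup>2 - a * (norm t)\<^sup>2))"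
        by (simp only: exp_add mult_ac)
      also have "\<dots> \<le> C * exp (((2 * pi)\<^sup>2 / (2 * a) * (norm y)\<^sup>2 - pi * \<delta> * (norm x)\<^sup>2) + - (a / 2) * (norm t)\<^sup>2)"
        using 1 2 abC(3) by (intro mult_left_mono iffD2[OF exp_le_cancel_iff]) linarith+
      finally show ?thesis by (simp only: exp_add mult_ac)
    qed
    have "cmod (cfourier \<Phi> \<zeta>) = cmod (LINT t|lborel. \<Psi> (cvec t + s))"
      using contour_shift[OF \<Psi>, of s] by (simp add: cfourier_def \<Psi>_def)
    also have "\<dots> \<le> (LINT t|lborel. (C * exp ((2 * pi)\<^sup>2 / (2 * a) * (norm y)\<^sup>2 - pi * \<delta> * (norm x)\<^sup>2)) * exp (- (a / 2) * (norm (t::real^'d))\<^sup>2))"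
      using abC by (intro Bochner_Integration.integral_norm_bound_integral gs_entire_integrable[OF \<Psi>] integrable_mult_right integrable_gauss bound) auto
    also have "\<dots> = C * G * exp ((2 * pi)\<^sup>2 / (2 * a) * (norm y)\<^sup>2 - pi * \<delta> * (norm x)\<^sup>2)"
      by (simp add: G_def)
    finally show "cmod (cfourier \<Phi> \<zeta>) \<le> C * G * exp ((2 * pi)\<^sup>2 / (2 * a) * (norm (Im_vec \<zeta>))\<^sup>2 - pi * \<delta> * (norm (Re_vec \<zeta>))\<^sup>2)"
      by (simp add: x_def y_def)
  qed (use \<delta> in auto)
qed

lemma gs_entire_bounded: assumes "gs_entire \<Phi>" shows "\<exists>B. \<forall>t. cmod (\<Phi> (cvec t)) \<le> B"
proof -
  obtain a b C where abC: "a > 0" "b \<ge> 0" "C \<ge> 0"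
    and bd: "\<And>z. cmod (\<Phi> z) \<le> C * exp (b * (norm (Im_vec z))\<^sup>2 - a * (norm (Re_vec z))\<^sup>2)"
    by (rule gs_entireE[OF assms(1)]) (rule that)
  have "cmod (\<Phi> (cvec t)) \<le> C" for t
  proof -
    have "C * exp (- (a * (norm t)\<^sup>2)) \<le> C * 1" using abC by (intro mult_left_mono) auto
    then show ?thesis using bd[of "cvec t"] by simp
  qed
  then show ?thesis by blast
qed

lemma gs_entire_fourier_inversion:
  assumes "gs_entire \<Phi>"
  shows "inv_fourier (fourier (\<lambda>t. \<Phi> (cvec t))) t = \<Phi> (cvec t)"
proof -
  obtain B where B: "\<And>t. cmod (\<Phi> (cvec t)) \<le> B" using gs_entire_bounded[OF assms] by auto
  show ?thesis
  proof (rule fourier_inversion[OF _ _ B])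
    show "integrable lborel (\<lambda>t. \<Phi> (cvec t))" using gs_entire_integrable[OF assms, of 0] by simp
    show "continuous_on UNIV (\<lambda>t. \<Phi> (cvec t))"
      by (intro continuous_on_compose2[OF gs_entire_continuous[OF assms]] continuous_intros) auto
    show "integrable lborel (fourier (\<lambda>t. \<Phi> (cvec t)))"
      unfolding fourier_cvec[abs_def]
      using gs_entire_integrable[OF gs_entire_cfourier[OF assms], of 0] by simp
  qed
qed

text \<open>For complex s the substitution t |-> t - s is a contour shift of the modulated function,
  not a change of variables in R^d.\<close>

lemma cfourier_translate:
  assumes "gs_entire \<Phi>"
  shows "cfourier (\<lambda>z. \<Phi> (z + s)) \<zeta> = exp (2 * pi * \<i> * (\<zeta> \<bullet>\<^sub>c s)) * cfourier \<Phi> \<zeta>"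
proof -
  have "exp (2 * pi * \<i> * (- \<zeta> \<bullet>\<^sub>c cvec t)) * \<Phi> (cvec t + s) =
      exp (2 * pi * \<i> * (\<zeta> \<bullet>\<^sub>c s)) * (exp (2 * pi * \<i> * (- \<zeta> \<bullet>\<^sub>c (cvec t + s))) * \<Phi> (cvec t + s))" for t
    unfolding mult.assoc[symmetric] exp_add[symmetric] by (simp add: bdot_simps(2,5) algebra_simps)
  then have "cfourier (\<lambda>z. \<Phi> (z + s)) \<zeta> = exp (2 * pi * \<i> * (\<zeta> \<bullet>\<^sub>c s)) *
      (LINT t|lborel. exp (2 * pi * \<i> * (- \<zeta> \<bullet>\<^sub>c (cvec t + s))) * \<Phi> (cvec t + s))"
    unfolding cfourier_def by (simp only: integral_mult_right_zero)
  also have "(LINT t|lborel. exp (2 * pi * \<i> * (- \<zeta> \<bullet>\<^sub>c (cvec t + s))) * \<Phi> (cvec t + s)) = cfourier \<Phi> \<zeta>"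
    unfolding cfourier_def by (rule contour_shift[OF gs_entire_modulation[OF assms]])
  finally show ?thesis .
qed

text \<open>The multiplier that defines \<open>trans_fun\<close> is the one
  \<open>cfourier_translate\<close> produces for the shift by - x, so Fourier inversion of the
  translated function returns an honest complex translation.\<close>

lemma trans_fun_gs_entire:
  assumes "gs_entire \<Phi>"
  shows "trans_fun x (\<lambda>t. \<Phi> (cvec t)) t = \<Phi> (cvec t - x)"
proof -
  have "trans_fun x (\<lambda>t. \<Phi> (cvec t)) t = inv_fourier (fourier (\<lambda>t. \<Phi> (cvec t + - x))) t"
    unfolding trans_fun_def fourier_cvec cfourier_translate[OF assms]
      fourier_cvec[of "\<lambda>z. \<Phi> (z + - x)"]
    by (simp add: bdot_simps bdot_commute[of x])
  also have "\<dots> = \<Phi> (cvec t + - x)"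
    by (rule gs_entire_fourier_inversion[OF gs_entire_translate[OF assms]])
  finally show ?thesis by simp
qed

subsection \<open>Derivatives of Fourier--Laplace integrals\<close>

text \<open>A factor bounded by A |t| <= exp (A |t|) costs half of the Gaussian rate. Iterated, this
  covers the polynomial factors that differentiation under the integral produces.\<close>

lemma gauss_bounded_mult_linear:
  assumes h: "gauss_bounded h" and [measurable]: "m \<in> borel_measurable borel"
    and m: "\<And>t. cmod (m t) \<le> A * norm t"
  shows "gauss_bounded (\<lambda>t. m t * h t)"
proof -
  obtain a C where a: "a > 0" and bd: "\<And>t. cmod (h t) \<le> C * exp (- a * (norm t)\<^sup>2)"
    using h by (auto simp: gauss_bounded_def)
  have [measurable]: "h \<in> borel_measurable borel" using h by (simp add: gauss_bounded_def)
  have "cmod (m t * h t) \<le> (\<bar>C\<bar> * exp (A\<^sup>2 / (4 * (a / 2)))) * exp (- (a / 2) * (norm t)\<^sup>2)" for t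
  proof -
    have "cmod (m t) \<le> exp (A * norm t)"
      using m[of t] exp_ge_add_one_self[of "A * norm t"] by linarith
    also have "\<dots> \<le> exp (a / 2 * (norm t)\<^sup>2 + A\<^sup>2 / (4 * (a / 2)))"
      using a by (intro iffD2[OF exp_le_cancel_iff] mult_le_eps) simp
    finally have "cmod (m t * h t) \<le> exp (a / 2 * (norm t)\<^sup>2 + A\<^sup>2 / (4 * (a / 2))) * (\<bar>C\<bar> * exp (- a * (norm t)\<^sup>2))"
      unfolding norm_mult by (intro mult_mono order_trans[OF bd] mult_right_mono) auto
    also have "\<dots> = \<bar>C\<bar> * exp ((a / 2 * (norm t)\<^sup>2 + A\<^sup>2 / (4 * (a / 2))) + (- a * (norm t)\<^sup>2))"
      by (simp only: exp_add mult_ac)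
    also have "(a / 2 * (norm t)\<^sup>2 + A\<^sup>2 / (4 * (a / 2))) + (- a * (norm t)\<^sup>2)
        = A\<^sup>2 / (4 * (a / 2)) + - (a / 2) * (norm t)\<^sup>2" by (simp add: field_simps)
    finally show ?thesis by (simp only: exp_add mult_ac)
  qed
  then show ?thesis unfolding gauss_bounded_def using a
    by (intro conjI exI[of _ "a / 2"] exI allI) (measurable, auto)
qed

lemma bdot_measurable [measurable]: "(\<lambda>t. v \<bullet>\<^sub>c cvec t) \<in> borel_measurable borel"
  unfolding bdot_def by (intro borel_measurable_continuous_onI continuous_intros)

lemma gauss_bounded_bdot:
  assumes "gauss_bounded h"
  shows "gauss_bounded (\<lambda>t. 2 * pi * \<i> * (v \<bullet>\<^sub>c cvec t) * h t)"
proof (rule gauss_bounded_mult_linear[OF assms, where A = "2 * pi * norm v"])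
  show "cmod (2 * pi * \<i> * (v \<bullet>\<^sub>c cvec t)) \<le> 2 * pi * norm v * norm t" for t
    using mult_left_mono[OF cmod_bdot_le[of v "cvec t"], of "2 * pi"] by (simp add: norm_mult mult.assoc)
qed measurable

lemma exp_integral_add:
  assumes "gauss_bounded f" "gauss_bounded g"
  shows "exp_integral (\<lambda>t. f t + g t) z = exp_integral f z + exp_integral g z"
  unfolding exp_integral_def distrib_left
  by (rule Bochner_Integration.integral_add[OF exp_integral_integrable[OF assms(1)] exp_integral_integrable[OF assms(2)]])

lemma exp_integral_scale: "exp_integral (\<lambda>t. c * f t) z = c * exp_integral f z"
  unfolding exp_integral_def by (simp add: mult.left_commute[of _ c])

text \<open>\<open>smooth\<close> asks for total real derivatives, beyond holomorphy on lines. The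
  remainder of order |v|^2 comes from |exp (i \<theta>) - 1 - i \<theta>| <= \<theta>^2 / 2 and the
  second moment of h.\<close>

lemma exp_integral_has_derivative:
  fixes h :: "real^'d \<Rightarrow> complex"
  assumes h: "gauss_bounded h"
  shows "((\<lambda>t. exp_integral h (cvec t)) has_derivative
    (\<lambda>v. exp_integral (\<lambda>s. 2 * pi * \<i> * (cvec v \<bullet>\<^sub>c cvec s) * h s) (cvec t))) (at t)"
proof -
  let ?L = "\<lambda>v. exp_integral (\<lambda>s. 2 * pi * \<i> * (cvec v \<bullet>\<^sub>c cvec s) * h s) (cvec t)"
  have hm [measurable]: "h \<in> borel_measurable borel" using h by (simp add: gauss_bounded_def)
  \<comment> \<open>The density of the first moment of h; one more factor \<open>norm s\<close>
    gives the second. They majorize the candidate derivative and the remainder respectively.\<close>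
  define k where "k s = complex_of_real (norm s) * h s" for s
  have k: "gauss_bounded k" unfolding k_def[abs_def]
    by (rule gauss_bounded_mult_linear[OF h, where A = 1]) auto
  have k2: "gauss_bounded (\<lambda>s. complex_of_real (norm s) * k s)"
    by (rule gauss_bounded_mult_linear[OF k, where A = 1]) auto
  have bl: "bounded_linear ?L"
  proof (rule bounded_linear_intro)
    fix v w :: "real^'d" and r :: real
    show "?L (v + w) = ?L v + ?L w"
      by (subst exp_integral_add[OF gauss_bounded_bdot[OF h] gauss_bounded_bdot[OF h], symmetric])
         (simp add: bdot_simps(1) algebra_simps)
    show "?L (r *\<^sub>R v) = r *\<^sub>R ?L v"
      unfolding scaleR_conv_of_real[where 'a=complex]
      by (subst exp_integral_scale[symmetric]) (simp add: bdot_simps(7) mult_ac)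
    show "norm (?L v) \<le> norm v * (LINT s|lborel. 2 * pi * cmod (k s))"
    proof -
      have "norm (?L v) \<le> (LINT s|lborel. norm v * (2 * pi * cmod (k s)))"
        unfolding exp_integral_def
      proof (rule Bochner_Integration.integral_norm_bound_integral)
        fix s :: "real^'d"
        have "cmod (cvec v \<bullet>\<^sub>c cvec s) \<le> norm v * norm s" using cmod_bdot_le[of "cvec v" "cvec s"] by simp
        then have "2 * pi * cmod (cvec v \<bullet>\<^sub>c cvec s) * cmod (h s) \<le> 2 * pi * (norm v * norm s) * cmod (h s)"
          by (intro mult_right_mono mult_left_mono) auto
        then show "cmod (exp (2 * pi * \<i> * (cvec t \<bullet>\<^sub>c cvec s)) * (2 * pi * \<i> * (cvec v \<bullet>\<^sub>c cvec s) * h s)) \<le> norm v * (2 * pi * cmod (k s))"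
          by (simp add: norm_mult k_def bdot_simps(9) mult_ac)
      qed (use gauss_bounded_integrable[OF k] exp_integral_integrable[OF gauss_bounded_bdot[OF h]] in auto)
      then show ?thesis by simp
    qed
  qed
  define K where "K = (LINT s|lborel. (2 * pi)\<^sup>2 / 2 * cmod (complex_of_real (norm s) * k s))"
  have rem: "norm (exp_integral h (cvec (t + v)) - exp_integral h (cvec t) - ?L v) \<le> K * (norm v)\<^sup>2" for v
  proof -
    let ?e = "\<lambda>z s. exp (2 * pi * \<i> * (z \<bullet>\<^sub>c cvec s))"
    note i = exp_integral_integrable[OF h] exp_integral_integrable[OF gauss_bounded_bdot[OF h]]
    have eq: "exp_integral h (cvec (t + v)) - exp_integral h (cvec t) - ?L v =
        (LINT s|lborel. ?e (cvec (t + v)) s * h s - ?e (cvec t) s * h s - ?e (cvec t) s * (2 * pi * \<i> * (cvec v \<bullet>\<^sub>c cvec s) * h s))"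
      unfolding exp_integral_def
      by (subst Bochner_Integration.integral_diff, intro Bochner_Integration.integrable_diff i, rule i,
          subst Bochner_Integration.integral_diff, rule i, rule i, rule refl)
    have "norm (exp_integral h (cvec (t + v)) - exp_integral h (cvec t) - ?L v) \<le> (LINT s|lborel. (norm v)\<^sup>2 * ((2 * pi)\<^sup>2 / 2 * cmod (complex_of_real (norm s) * k s)))"
      unfolding eq
    proof (rule Bochner_Integration.integral_norm_bound_integral)
      fix s :: "real^'d"
      define \<theta> where "\<theta> = 2 * pi * (v \<bullet> s)"
      have e: "?e (cvec (t + v)) s * h s - ?e (cvec t) s * h s - ?e (cvec t) s * (2 * pi * \<i> * (cvec v \<bullet>\<^sub>c cvec s) * h s)
          = ?e (cvec t) s * (exp (\<i> * complex_of_real \<theta>) - (1 + \<i> * complex_of_real \<theta>)) * h s"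
        by (simp add: bdot_simps \<theta>_def exp_add algebra_simps)
      have "cmod (exp (\<i> * complex_of_real \<theta>) - (1 + \<i> * complex_of_real \<theta>)) \<le> \<theta>\<^sup>2 / 2"
        using iexp_approx1[of \<theta> 1] by (simp add: numeral_2_eq_2)
      also have "\<theta>\<^sup>2 \<le> (2 * pi * (norm v * norm s))\<^sup>2"
        unfolding abs_le_square_iff[symmetric] \<theta>_def using Cauchy_Schwarz_ineq2[of v s]
        by (simp add: abs_mult)
      finally have "cmod (exp (\<i> * complex_of_real \<theta>) - (1 + \<i> * complex_of_real \<theta>)) * cmod (h s) \<le>
          ((2 * pi * (norm v * norm s))\<^sup>2 / 2) * cmod (h s)" by (intro mult_right_mono) auto
      then show "cmod (?e (cvec (t + v)) s * h s - ?e (cvec t) s * h s - ?e (cvec t) s * (2 * pi * \<i> * (cvec v \<bullet>\<^sub>c cvec s) * h s))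
          \<le> (norm v)\<^sup>2 * ((2 * pi)\<^sup>2 / 2 * cmod (complex_of_real (norm s) * k s))"
        unfolding e by (simp add: norm_mult k_def bdot_simps(9) power_mult_distrib power2_eq_square mult_ac)
    next
      show "integrable lborel (\<lambda>s. (norm v)\<^sup>2 * ((2 * pi)\<^sup>2 / 2 * cmod (complex_of_real (norm s) * k s)))"
        using gauss_bounded_integrable[OF k2] by (intro integrable_mult_right integrable_norm)
    qed (intro Bochner_Integration.integrable_diff i)
    also have "\<dots> = K * (norm v)\<^sup>2"
      unfolding K_def integral_mult_right_zero by (rule mult.commute)
    finally show ?thesis .
  qed
  show ?thesis
  proof (rule has_derivativeI_sandwich[where e = 1 and H = "\<lambda>y. K * norm (y - t)"])
    fix y assume "y \<noteq> t"
    then show "norm (exp_integral h (cvec y) - exp_integral h (cvec t) - ?L (y - t)) / norm (y - t) \<le> K * norm (y - t)"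
      using rem[of "y - t"] by (simp add: pos_divide_le_eq power2_eq_square mult.assoc)
  next
    have "((\<lambda>y. K * norm (y - t)) \<longlongrightarrow> K * norm (t - t)) (at t)" by (intro tendsto_intros)
    then show "((\<lambda>y. K * norm (y - t)) \<longlongrightarrow> 0) (at t)" by simp
  qed (use bl in auto)
qed

lemma bdot_axis [simp]: "axis j 1 \<bullet>\<^sub>c z = z $ j"
  by (simp add: bdot_def axis_def if_distrib[of "\<lambda>x. x * _"] cong: if_cong)

lemma cvec_axis [simp]: "cvec (axis j 1) = axis j 1"
  by (simp add: vec_eq_iff axis_def)

text \<open>The Fourier symbol of \<open>iter_deriv js\<close>. It is symmetric in the list, and
  that is how the order of partial derivatives becomes irrelevant.\<close>

definition deriv_factor :: "'d list \<Rightarrow> real^'d \<Rightarrow> complex" where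
  "deriv_factor js s = prod_list (map (\<lambda>j. 2 * pi * \<i> * complex_of_real (s $ j)) js)"

lemma deriv_factor_simps [simp]:
  "deriv_factor [] s = 1"
  "deriv_factor (j # js) s = 2 * pi * \<i> * complex_of_real (s $ j) * deriv_factor js s"
  by (simp_all add: deriv_factor_def)

lemma deriv_factor_mset: "mset js = mset ks \<Longrightarrow> deriv_factor js = deriv_factor ks"
  unfolding deriv_factor_def prod_mset_prod_list[symmetric] mset_map by simp

lemma gauss_bounded_deriv_factor:
  "gauss_bounded h \<Longrightarrow> gauss_bounded (\<lambda>s. deriv_factor js s * h s)"
proof (induction js)
  case (Cons j js)
  then show ?case
    using gauss_bounded_bdot[of "\<lambda>s. deriv_factor js s * h s" "axis j 1"] by (simp add: mult_ac)
qed simp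

lemma partial_deriv_exp_integral:
  assumes "gauss_bounded h"
  shows "partial_deriv j (\<lambda>t. exp_integral h (cvec t)) t =
    exp_integral (\<lambda>s. 2 * pi * \<i> * complex_of_real (s $ j) * h s) (cvec t)"
proof -
  have "((\<lambda>r. exp_integral h (cvec (t + r *\<^sub>R axis j 1))) has_derivative
      (\<lambda>r. exp_integral (\<lambda>s. 2 * pi * \<i> * (cvec (r *\<^sub>R axis j 1) \<bullet>\<^sub>c cvec s) * h s) (cvec (t + 0 *\<^sub>R axis j 1)))) (at 0)"
    by (rule has_derivative_compose[OF _ exp_integral_has_derivative[OF assms], of "\<lambda>r. t + r *\<^sub>R axis j 1"])
       (auto intro!: derivative_eq_intros)
  also have "(\<lambda>r. exp_integral (\<lambda>s. 2 * pi * \<i> * (cvec (r *\<^sub>R axis j 1) \<bullet>\<^sub>c cvec s) * h s) (cvec (t + 0 *\<^sub>R axis j 1)))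
      = (\<lambda>r. r *\<^sub>R exp_integral (\<lambda>s. 2 * pi * \<i> * complex_of_real (s $ j) * h s) (cvec t))"
    unfolding scaleR_conv_of_real[where 'a=complex] exp_integral_scale[symmetric] by (simp add: bdot_simps(7) mult_ac)
  finally show ?thesis
    unfolding partial_deriv_def by (intro vector_derivative_at) (simp add: has_vector_derivative_def)
qed

lemma iter_deriv_Cons: "iter_deriv (j # js) \<phi> = partial_deriv j (iter_deriv js \<phi>)"
  and iter_deriv_Nil [simp]: "iter_deriv [] \<phi> = \<phi>"
  by (simp_all add: iter_deriv_def)

lemma iter_deriv_exp_integral:
  assumes "gauss_bounded h"
  shows "iter_deriv js (\<lambda>t. exp_integral h (cvec t)) = (\<lambda>t. exp_integral (\<lambda>s. deriv_factor js s * h s) (cvec t))"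
proof (induction js)
  case (Cons j js)
  show ?case unfolding iter_deriv_Cons Cons
    by (rule ext, subst partial_deriv_exp_integral[OF gauss_bounded_deriv_factor[OF assms]]) (simp add: mult_ac)
qed simp

lemma smooth_exp_integral:
  assumes "gauss_bounded h" shows "smooth (\<lambda>t. exp_integral h (cvec t))"
  unfolding smooth_def iter_deriv_exp_integral[OF assms] differentiable_on_def differentiable_def
  using exp_integral_has_derivative[OF gauss_bounded_deriv_factor[OF assms]] by blast

text \<open>On the line through Re z in direction Im z both functions agree at real parameters; z
  itself sits at parameter i.\<close>

lemma line_holomorphic_eqI:
  assumes "line_holomorphic \<Phi>" "line_holomorphic \<Psi>" "\<And>t. \<Phi> (cvec t) = \<Psi> (cvec t)"
  shows "\<Phi> z = \<Psi> z"
proof -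
  have "(\<lambda>l. \<Phi> (cvec (Re_vec z) + l *s cvec (Im_vec z)) - \<Psi> (cvec (Re_vec z) + l *s cvec (Im_vec z))) holomorphic_on UNIV"
    using assms(1,2) by (auto simp: line_holomorphic_def intro!: holomorphic_intros)
  then have "\<Phi> (cvec (Re_vec z) + \<i> *s cvec (Im_vec z)) - \<Psi> (cvec (Re_vec z) + \<i> *s cvec (Im_vec z)) = 0"
  proof (rule analytic_const_on_reals)
    fix r :: real
    show "\<Phi> (cvec (Re_vec z) + complex_of_real r *s cvec (Im_vec z)) - \<Psi> (cvec (Re_vec z) + complex_of_real r *s cvec (Im_vec z)) = 0"
      using assms(3)[of "Re_vec z + r *\<^sub>R Im_vec z"] by simp
  qed
  then show ?thesis unfolding cvec_Re_Im[symmetric] by simp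
qed

lemma inv_fourier_exp_integral: "inv_fourier g t = exp_integral g (cvec t)"
  by (simp add: inv_fourier_def exp_integral_def bdot_simps inner_commute mult.commute)

text \<open>Fourier inversion gives the identity on R^d and the identity theorem carries it to C^d.
  All derivatives of \<Phi> then come from differentiation under one integral.\<close>

lemma gs_entire_eq_exp_integral:
  assumes "gs_entire \<Phi>"
  obtains h where "gauss_bounded h" "\<And>z. \<Phi> z = exp_integral h z"
proof
  let ?h = "fourier (\<lambda>t. \<Phi> (cvec t))"
  show h: "gauss_bounded ?h"
    using gs_entire_gauss_bounded[OF gs_entire_cfourier[OF assms]] by (simp add: fourier_cvec[abs_def])
  show "\<Phi> z = exp_integral ?h z" for z
    by (rule line_holomorphic_eqI[OF _ line_holomorphic_exp_integral[OF h]])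
       (use assms gs_entire_fourier_inversion[OF assms] in \<open>auto simp: gs_entire_def inv_fourier_exp_integral\<close>)
qed

subsection \<open>Cauchy estimates\<close>

lemma exp_integral_Cauchy:
  assumes h: "gauss_bounded h" and "\<delta> > 0"
    and M: "\<And>l. cmod l \<le> \<delta> \<Longrightarrow> cmod (exp_integral h (z + l *s axis j 1)) \<le> M"
  shows "cmod (exp_integral (\<lambda>s. 2 * pi * \<i> * complex_of_real (s $ j) * h s) z) \<le> M / \<delta>"
proof -
  have "deriv (\<lambda>l. exp_integral h (z + l *s axis j 1)) 0 =
      exp_integral (\<lambda>s. 2 * pi * \<i> * complex_of_real (s $ j) * h s) z"
    using DERIV_imp_deriv[OF exp_integral_has_field_derivative[OF h, of z "axis j 1" 0]] by simp
  moreover have "(\<lambda>l. exp_integral h (z + l *s axis j 1)) holomorphic_on UNIV"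
    using line_holomorphic_exp_integral[OF h] by (simp add: line_holomorphic_def)
  ultimately show ?thesis
    using Cauchy_deriv_bound[of "\<lambda>l. exp_integral h (z + l *s axis j 1)" 0 \<delta> M] assms(2) M by simp
qed

text \<open>Iteration of the one-variable Cauchy estimate. The radii \<open>r\<close> are those of
  the polydisc containing w; each occurrence of i in the list enlarges the i-th radius by
  \<open>\<delta> i\<close> in the hypothesis and is rewarded with a factor 1 /
  \<open>\<delta> i\<close>. Both r and w vary in the induction.\<close>

lemma exp_integral_polydisc_bound:
  assumes h: "gauss_bounded h" and \<delta>: "\<And>i. \<delta> i > 0"
    and M: "\<And>w. (\<And>i. cmod (w $ i) \<le> r i + real (count_list js i) * \<delta> i) \<Longrightarrow> cmod (exp_integral h (z + w)) \<le> M"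
    and w: "\<And>i. cmod (w $ i) \<le> r i"
  shows "cmod (exp_integral (\<lambda>s. deriv_factor js s * h s) (z + w)) \<le> M / (prod_list (map \<delta> js))"
  using M w
proof (induction js arbitrary: r w)
  case (Cons j js)
  have "cmod (exp_integral (\<lambda>s. 2 * pi * \<i> * complex_of_real (s $ j) * (deriv_factor js s * h s)) (z + w))
      \<le> M / (prod_list (map \<delta> js)) / \<delta> j"
  proof (rule exp_integral_Cauchy[OF gauss_bounded_deriv_factor[OF h] \<delta>])
    fix l assume l: "cmod l \<le> \<delta> j"
    let ?r = "\<lambda>i. r i + (if i = j then \<delta> j else 0)"
    have "cmod (exp_integral (\<lambda>s. deriv_factor js s * h s) (z + (w + l *s axis j 1))) \<le> M / (prod_list (map \<delta> js))"
    proof (rule Cons.IH[where r = ?r])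
      fix w' :: "complex^'a" assume w': "\<And>i. cmod (w' $ i) \<le> ?r i + real (count_list js i) * \<delta> i"
      show "cmod (exp_integral h (z + w')) \<le> M"
      proof (rule Cons.prems(1))
        show "cmod (w' $ i) \<le> r i + real (count_list (j # js) i) * \<delta> i" for i
          using w'[of i] by (auto simp: algebra_simps)
      qed
    next
      show "cmod ((w + l *s axis j 1) $ i) \<le> ?r i" for i
        using Cons.prems(2)[of i] norm_triangle_ineq[of "w $ i" l] l by (auto simp: axis_def)
    qed
    then show "cmod (exp_integral (\<lambda>s. deriv_factor js s * h s) (z + w + l *s axis j 1)) \<le> M / (prod_list (map \<delta> js))"
      by (simp add: add.assoc)
  qed
  then show ?case by (simp add: mult.assoc mult.commute)
qed simp

lemma prod_list_count:
  "(prod_list (map f js)) = (\<Prod>j\<in>UNIV. (f j :: 'b::comm_monoid_mult) ^ count_list js (j::'a::finite))"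
proof (induction js)
  case (Cons j js)
  have "(\<Prod>i\<in>UNIV. f i ^ count_list (j # js) i) = (\<Prod>i\<in>UNIV. f i ^ count_list js i * (if i = j then f i else 1))"
    by (intro prod.cong) (auto simp: mult.commute)
  then show ?case using Cons by (simp add: prod.distrib mult.commute)
qed simp

lemma sqrt_prod: "sqrt (\<Prod>j\<in>A. f j) = (\<Prod>j\<in>A. sqrt (f j))"
  by (induction A rule: infinite_finite_induct) (auto simp: real_sqrt_mult)

lemma power_le_fact_exp: assumes "x \<ge> 0" shows "x ^ n \<le> fact n * exp (x :: real)"
proof -
  have "(\<lambda>n. x ^ n /\<^sub>R fact n) sums exp x" by (rule exp_converges)
  then have "x ^ n /\<^sub>R fact n \<le> exp x"
    using sum_le_suminf[of "\<lambda>n. x ^ n /\<^sub>R fact n" "{n}"] assms by (auto simp: sums_iff)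
  then show ?thesis by (simp add: field_simps)
qed

text \<open>The square root of x^n <= n! exp x at x = 2 a t^2; taking the root is what produces sqrt
  (n!), the weight of the Gelfand--Shilov norm.\<close>

lemma power_gauss_le:
  assumes a: "a > 0"
  shows "\<bar>t\<bar> ^ n * exp (- a * t\<^sup>2) \<le> sqrt (fact n) * (1 / sqrt (2 * a)) ^ n"
proof -
  have "(2 * a * t\<^sup>2) ^ n \<le> fact n * exp (2 * a * t\<^sup>2)" using a by (intro power_le_fact_exp) simp
  then have "sqrt ((2 * a * t\<^sup>2) ^ n) \<le> sqrt (fact n * exp (2 * a * t\<^sup>2))" by simp
  also have "sqrt (exp (2 * a * t\<^sup>2)) = exp (a * t\<^sup>2)"
    by (rule real_sqrt_unique) (simp_all add: exp_double[symmetric])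
  then have "sqrt (fact n * exp (2 * a * t\<^sup>2)) = sqrt (fact n) * exp (a * t\<^sup>2)" by (simp add: real_sqrt_mult)
  also have "sqrt ((2 * a * t\<^sup>2) ^ n) = (sqrt (2 * a) * \<bar>t\<bar>) ^ n"
    unfolding real_sqrt_power[of "2 * a * t\<^sup>2" n] real_sqrt_mult[of "2 * a"] by simp
  finally have "sqrt (2 * a) ^ n * (\<bar>t\<bar> ^ n * exp (- a * t\<^sup>2)) \<le> sqrt (fact n) * (exp (a * t\<^sup>2) * exp (- a * t\<^sup>2))"
    by (simp add: power_mult_distrib mult_ac)
  also have "exp (a * t\<^sup>2) * exp (- a * t\<^sup>2) = 1" by (simp add: mult_exp_exp)
  finally show ?thesis using a by (simp add: field_simps power_divide)
qed

lemma ex_list_count: "\<exists>js. \<forall>j. count_list js j = \<gamma> $ (j::'d::finite)"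
proof -
  obtain js where "mset js = (\<Sum>j\<in>UNIV. replicate_mset (\<gamma> $ j) j)" using ex_mset by blast
  then have "count_list js i = \<gamma> $ i" for i
    by (simp add: count_mset[symmetric] count_sum count_replicate_mset if_distrib eq_commute cong: if_cong)
  then show ?thesis by blast
qed

lemma multi_deriv_iter:
  obtains js where "multi_deriv \<gamma> \<phi> = iter_deriv js \<phi>" "\<And>j. count_list js j = \<gamma> $ j"
  using someI_ex[OF ex_list_count[of \<gamma>]] by (auto simp: multi_deriv_def)

text \<open>Cauchy estimates on the polydisc with radii \<open>sqrt (\<gamma>\<^sub>j)\<close>, where each of the \<open>\<gamma>\<^sub>j\<close>
  derivatives in the direction \<open>j\<close> uses up \<open>1 / sqrt (\<gamma>\<^sub>j)\<close> of the radius.\<close>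

lemma gs_entire_iter_deriv_bound:
  fixes \<Phi> :: "complex^'d \<Rightarrow> complex"
  assumes "gs_entire \<Phi>"
  obtains a K H where "a > 0" "K \<ge> 0" "H > 0"
    "\<And>js t. cmod (iter_deriv js (\<lambda>t. \<Phi> (cvec t)) t) \<le>
       K * exp (- a * (norm t)\<^sup>2) * (\<Prod>j\<in>UNIV. sqrt (fact (count_list js j)) * H ^ count_list js j)"
proof -
  obtain h where h: "gauss_bounded h" and \<Phi>: "\<Phi> = exp_integral h"
    by (rule gs_entire_eq_exp_integral[OF assms], rule that, assumption, rule ext)
  obtain a K B where K: "a > 0" "K \<ge> 0" "B \<ge> 0"
    and bd: "\<And>t s. cmod (\<Phi> (cvec t + s)) \<le> K * exp (B * (norm s)\<^sup>2) * exp (- a * (norm t)\<^sup>2)"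
    by (rule gs_entire_shift_bound[OF assms]) (rule that)
  have "cmod (iter_deriv js (\<lambda>t. \<Phi> (cvec t)) t) \<le>
       K * exp (- a * (norm t)\<^sup>2) * (\<Prod>j\<in>UNIV. sqrt (fact (count_list js j)) * exp (B + 1) ^ count_list js j)" for js t
  proof -
    define n where "n j = count_list js j" for j
    \<comment> \<open>The maximum with 1 keeps the radius positive for \<open>n j = 0\<close>; in
      every case \<open>n j\<close> steps add up to sqrt (n j).\<close>
    define \<delta> where "\<delta> j = 1 / sqrt (max 1 (real (n j)))" for j
    have n\<delta>: "real (n j) * \<delta> j = sqrt (n j)" for j
      by (cases "n j = 0") (simp_all add: \<delta>_def real_div_sqrt max_def)
    let ?M = "K * exp (- a * (norm t)\<^sup>2) * (\<Prod>j\<in>UNIV. exp B ^ n j)"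
    have "cmod (exp_integral (\<lambda>s. deriv_factor js s * h s) (cvec t + 0)) \<le> ?M / (prod_list (map \<delta> js))"
    proof (rule exp_integral_polydisc_bound[OF h, where r = "\<lambda>_. 0"])
      show "\<delta> i > 0" for i by (simp add: \<delta>_def)
      fix w :: "complex^'d" assume w: "\<And>i. cmod (w $ i) \<le> 0 + real (count_list js i) * \<delta> i"
      \<comment> \<open>On this polydisc |w|^2 is at most the sum of the \<open>n i\<close>, so the
        growth factor exp (B |w|^2) is only geometric in the orders of differentiation.\<close>
      have "(cmod (w $ i))\<^sup>2 \<le> n i" for i
      proof -
        have "(cmod (w $ i))\<^sup>2 \<le> (sqrt (n i))\<^sup>2"
          using w[of i] n\<delta>[of i] by (intro power_mono) (auto simp: n_def)
        then show ?thesis by simp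
      qed
      then have "(norm w)\<^sup>2 \<le> (\<Sum>i\<in>UNIV. real (n i))"
        unfolding norm_vec_power2 by (intro sum_mono)
      then have "exp (B * (norm w)\<^sup>2) \<le> exp (\<Sum>i\<in>UNIV. real (n i) * B)"
        unfolding sum_distrib_right[symmetric] using K(3) by (simp add: mult.commute mult_left_mono)
      also have "\<dots> = (\<Prod>j\<in>UNIV. exp B ^ n j)" by (simp add: exp_sum exp_of_nat_mult)
      finally have "K * exp (- a * (norm t)\<^sup>2) * exp (B * (norm w)\<^sup>2) \<le> ?M"
        using K(2) by (intro mult_left_mono) auto
      then show "cmod (exp_integral h (cvec t + w)) \<le> ?M"
        using bd[of t w] by (simp add: \<Phi> mult_ac)
    qed simp
    also have "\<dots> = K * exp (- a * (norm t)\<^sup>2) * ((\<Prod>j\<in>UNIV. exp B ^ n j) / (\<Prod>j\<in>UNIV. \<delta> j ^ n j))"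
      by (simp add: prod_list_count n_def)
    also have "(\<Prod>j\<in>UNIV. exp B ^ n j) / (\<Prod>j\<in>UNIV. \<delta> j ^ n j) = (\<Prod>j\<in>UNIV. exp B ^ n j / \<delta> j ^ n j)"
      by (simp add: prod_dividef)
    also have "K * exp (- a * (norm t)\<^sup>2) * (\<Prod>j\<in>UNIV. exp B ^ n j / \<delta> j ^ n j) \<le>
        K * exp (- a * (norm t)\<^sup>2) * (\<Prod>j\<in>UNIV. sqrt (fact (n j)) * exp (B + 1) ^ n j)"
    proof (intro mult_left_mono prod_mono conjI)
      fix j
      \<comment> \<open>The Cauchy factor is n^(n/2), and n^n <= n! exp n turns it into sqrt (n!)
        times a geometric factor.\<close>
      have "1 / \<delta> j ^ n j \<le> sqrt (fact (n j)) * exp 1 ^ n j"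
      proof (cases "n j = 0")
        case False
        then have "1 / \<delta> j ^ n j = sqrt (real (n j) ^ n j)"
          by (simp add: \<delta>_def power_divide real_sqrt_power max_def)
        also have "\<dots> \<le> sqrt (fact (n j) * exp (real (n j)))"
          by (intro real_sqrt_le_mono power_le_fact_exp) simp
        also have "\<dots> \<le> sqrt (fact (n j)) * exp (real (n j))"
          unfolding real_sqrt_mult by (intro mult_left_mono) (auto simp: real_le_lsqrt power2_eq_square)
        finally show ?thesis by (simp add: exp_of_nat_mult[symmetric])
      qed simp
      then have "exp B ^ n j * (1 / \<delta> j ^ n j) \<le> exp B ^ n j * (sqrt (fact (n j)) * exp 1 ^ n j)"
        by (intro mult_left_mono) auto
      then show "exp B ^ n j / \<delta> j ^ n j \<le> sqrt (fact (n j)) * exp (B + 1) ^ n j"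
        by (simp add: exp_add power_mult_distrib mult_ac)
      show "0 \<le> exp B ^ n j / \<delta> j ^ n j" by (simp add: \<delta>_def)
    qed (use K in auto)
    finally show ?thesis
      by (simp add: \<Phi> iter_deriv_exp_integral[OF h] n_def)
  qed
  then show ?thesis using K by (intro that[of a K "exp (B + 1)"]) auto
qed

text \<open>The Gaussian factor of the derivative bound splits over the coordinates and is spent on
  the monomial.\<close>

lemma gs_entire_imp_gs_space:
  fixes \<Phi> :: "complex^'d \<Rightarrow> complex"
  assumes "gs_entire \<Phi>"
  shows "(\<lambda>t. \<Phi> (cvec t)) \<in> gs_space"
proof -
  obtain a K H where K: "a > 0" "K \<ge> 0" "H > 0"
    and bd: "\<And>js t. cmod (iter_deriv js (\<lambda>t. \<Phi> (cvec t)) t) \<le>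
       K * exp (- a * (norm t)\<^sup>2) * (\<Prod>j\<in>UNIV. sqrt (fact (count_list js j)) * H ^ count_list js j)"
    by (rule gs_entire_iter_deriv_bound[OF assms]) (rule that)
  \<comment> \<open>The monomial contributes the rate 1 / sqrt (2 a) through
    \<open>power_gauss_le\<close>, the derivatives the rate H; a single h in the norm must serve
    both.\<close>
  define L where "L = max H (1 / sqrt (2 * a))"
  have L: "L > 0" "H \<le> L" "1 / sqrt (2 * a) \<le> L" using K by (auto simp: L_def)
  have "gs_norm L (\<lambda>t. \<Phi> (cvec t)) \<le> ennreal K"
    unfolding gs_norm_def
  proof (rule SUP_least, clarify)
    fix t :: "real^'d" and \<beta> \<gamma> :: "nat^'d"
    obtain js where js: "multi_deriv \<gamma> (\<lambda>t. \<Phi> (cvec t)) = iter_deriv js (\<lambda>t. \<Phi> (cvec t))" "\<And>j. count_list js j = \<gamma> $ j"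
      by (rule multi_deriv_iter) (rule that)
    have e: "exp (- a * (norm t)\<^sup>2) = (\<Prod>j\<in>UNIV. exp (- a * (t $ j)\<^sup>2))"
      by (simp add: norm_vec_power2 exp_sum[symmetric] sum_distrib_left sum_negf)
    have "cmod (complex_of_real (monomial \<beta> t) * multi_deriv \<gamma> (\<lambda>t. \<Phi> (cvec t)) t) \<le>
        \<bar>monomial \<beta> t\<bar> * (K * exp (- a * (norm t)\<^sup>2) * (\<Prod>j\<in>UNIV. sqrt (fact (\<gamma> $ j)) * H ^ \<gamma> $ j))"
      unfolding norm_mult js(1) using bd[of js t] by (intro mult_mono) (auto simp: js(2))
    also have "\<dots> = K * (\<Prod>j\<in>UNIV. \<bar>t $ j\<bar> ^ \<beta> $ j * exp (- a * (t $ j)\<^sup>2)) * (\<Prod>j\<in>UNIV. sqrt (fact (\<gamma> $ j)) * H ^ \<gamma> $ j)"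
      unfolding e monomial_def abs_prod power_abs prod.distrib by (simp only: mult_ac)
    also have "\<dots> \<le> K * (\<Prod>j\<in>UNIV. sqrt (fact (\<beta> $ j)) * L ^ \<beta> $ j) * (\<Prod>j\<in>UNIV. sqrt (fact (\<gamma> $ j)) * L ^ \<gamma> $ j)"
    proof (rule mult_mono[OF mult_left_mono])
      show "(\<Prod>j\<in>UNIV. \<bar>t $ j\<bar> ^ \<beta> $ j * exp (- a * (t $ j)\<^sup>2)) \<le> (\<Prod>j\<in>UNIV. sqrt (fact (\<beta> $ j)) * L ^ \<beta> $ j)"
      proof (rule prod_mono, rule conjI)
        fix j
        have "\<bar>t $ j\<bar> ^ \<beta> $ j * exp (- a * (t $ j)\<^sup>2) \<le> sqrt (fact (\<beta> $ j)) * (1 / sqrt (2 * a)) ^ \<beta> $ j"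
          by (rule power_gauss_le[OF K(1)])
        also have "\<dots> \<le> sqrt (fact (\<beta> $ j)) * L ^ \<beta> $ j"
          using L K by (intro mult_left_mono power_mono) auto
        finally show "\<bar>t $ j\<bar> ^ \<beta> $ j * exp (- a * (t $ j)\<^sup>2) \<le> sqrt (fact (\<beta> $ j)) * L ^ \<beta> $ j" .
      qed simp
      show "(\<Prod>j\<in>UNIV. sqrt (fact (\<gamma> $ j)) * H ^ \<gamma> $ j) \<le> (\<Prod>j\<in>UNIV. sqrt (fact (\<gamma> $ j)) * L ^ \<gamma> $ j)"
        using L K by (intro prod_mono conjI mult_left_mono power_mono) auto
    qed (use L K in \<open>auto intro!: mult_nonneg_nonneg prod_nonneg\<close>)
    also have "\<dots> = K * (L ^ mi_size (\<beta> + \<gamma>) * sqrt (mi_fact \<beta> * mi_fact \<gamma>))"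
      by (simp add: mi_size_def mi_fact_def sum.distrib power_add power_sum real_sqrt_mult sqrt_prod prod.distrib)
    finally have le: "cmod (complex_of_real (monomial \<beta> t) * multi_deriv \<gamma> (\<lambda>t. \<Phi> (cvec t)) t) \<le>
        K * (L ^ mi_size (\<beta> + \<gamma>) * sqrt (mi_fact \<beta> * mi_fact \<gamma>))" .
    have "mi_fact \<beta> * mi_fact \<gamma> > 0" by (auto simp: mi_fact_def intro!: mult_pos_pos prod_pos)
    with le show "ennreal (cmod (complex_of_real (monomial \<beta> t) * multi_deriv \<gamma> (\<lambda>t. \<Phi> (cvec t)) t) /
        (L ^ mi_size (\<beta> + \<gamma>) * sqrt (mi_fact \<beta> * mi_fact \<gamma>))) \<le> ennreal K"
      using L by (intro ennreal_leI) (simp add: pos_divide_le_eq)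
  qed
  then have "gs_norm L (\<lambda>t. \<Phi> (cvec t)) < \<infinity>" by (simp add: le_less_trans)
  moreover have "smooth (\<lambda>t. \<Phi> (cvec t))"
  proof -
    obtain h where "gauss_bounded h" "\<Phi> = exp_integral h"
      by (rule gs_entire_eq_exp_integral[OF assms], rule that, assumption, rule ext)
    then show ?thesis using smooth_exp_integral by simp
  qed
  ultimately show ?thesis using L(1) by (auto simp: gs_space_def gs_banach_def)
qed

subsection \<open>Gaussian decay and entire extension of Gelfand--Shilov functions\<close>

text \<open>If every term were smaller, squaring would give u^(2n) / n! <= exp (u^2 / 2) / 4;
  summing with weights 2^(-n) then yields exp (u^2 / 2) <= exp (u^2 / 2) / 2.\<close>

lemma ex_power_ge_gauss:
  fixes u :: real assumes u: "u \<ge> 0"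
  shows "\<exists>n. exp (u\<^sup>2 / 4) / 2 \<le> u ^ n / sqrt (fact n)"
proof (rule ccontr)
  assume "\<not> ?thesis"
  then have lt: "u ^ n / sqrt (fact n) < exp (u\<^sup>2 / 4) / 2" for n by (simp add: not_le)
  have le: "(u\<^sup>2 / 2) ^ n /\<^sub>R fact n \<le> (exp (u\<^sup>2 / 2) / 4) * (1 / 2) ^ n" for n
  proof -
    have "(u ^ n / sqrt (fact n))\<^sup>2 \<le> (exp (u\<^sup>2 / 4) / 2)\<^sup>2"
      using lt[of n] u by (intro power_mono) auto
    then have "(u\<^sup>2) ^ n / fact n \<le> exp (u\<^sup>2 / 2) / 4"
      by (simp add: power_divide exp_double[symmetric] flip: power_mult) (simp add: mult.commute)
    then have "(u\<^sup>2) ^ n / fact n * (1 / 2) ^ n \<le> exp (u\<^sup>2 / 2) / 4 * (1 / 2) ^ n"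
      by (intro mult_right_mono) auto
    moreover have "(u\<^sup>2 / 2) ^ n /\<^sub>R fact n = (u\<^sup>2) ^ n / fact n * (1 / 2) ^ n"
      by (simp add: power_divide field_simps)
    ultimately show ?thesis by simp
  qed
  have "exp (u\<^sup>2 / 2) = (\<Sum>n. (u\<^sup>2 / 2) ^ n /\<^sub>R fact n)" by (simp add: exp_def)
  also have "\<dots> \<le> (\<Sum>n. (exp (u\<^sup>2 / 2) / 4) * (1 / 2) ^ n)"
    by (intro suminf_le le summable_exp_generic summable_mult summable_geometric) simp
  also have "\<dots> = exp (u\<^sup>2 / 2) / 2"
    by (subst suminf_mult) (auto simp: suminf_geometric intro!: summable_geometric)
  finally show False by simp
qed

text \<open>The multi-index \<open>\<beta>\<close> in the norm is chosen in each coordinate, depending on \<open>t\<close>, by the previous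
  lemma.\<close>

lemma gs_norm_gauss_bound:
  fixes \<phi> :: "real^'d \<Rightarrow> complex"
  assumes h: "h > 0" and N: "gs_norm h \<phi> \<le> ennreal N" "N \<ge> 0"
  shows "cmod (multi_deriv \<gamma> \<phi> t) \<le>
    N * 2 ^ CARD('d) * h ^ mi_size \<gamma> * sqrt (mi_fact \<gamma>) * exp (- (1 / (4 * h\<^sup>2)) * (norm t)\<^sup>2)"
proof -
  let ?X = "cmod (multi_deriv \<gamma> \<phi> t)"
  have pos: "mi_fact \<beta> > 0" for \<beta> :: "nat^'d" by (auto simp: mi_fact_def intro!: prod_pos)
  \<comment> \<open>The argument |t j| / h absorbs the power of h in the norm. Each coordinate loses
    a factor 2, whence \<open>2 ^ CARD('d)\<close> in the bound.\<close>
  have "\<forall>j. \<exists>n. exp ((\<bar>t $ j\<bar> / h)\<^sup>2 / 4) / 2 \<le> (\<bar>t $ j\<bar> / h) ^ n / sqrt (fact n)"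
    using h by (intro allI ex_power_ge_gauss) auto
  then obtain b where b: "\<And>j. exp ((\<bar>t $ j\<bar> / h)\<^sup>2 / 4) / 2 \<le> (\<bar>t $ j\<bar> / h) ^ b j / sqrt (fact (b j))"
    by metis
  define \<beta> :: "nat^'d" where "\<beta> = (\<chi> j. b j)"
  have "ennreal (cmod (complex_of_real (monomial \<beta> t) * multi_deriv \<gamma> \<phi> t) /
      (h ^ mi_size (\<beta> + \<gamma>) * sqrt (mi_fact \<beta> * mi_fact \<gamma>))) \<le> gs_norm h \<phi>"
    unfolding gs_norm_def by (rule SUP_upper2[of "(t, \<beta>, \<gamma>)"]) auto
  also note N(1)
  finally have "cmod (complex_of_real (monomial \<beta> t) * multi_deriv \<gamma> \<phi> t) /
      (h ^ mi_size (\<beta> + \<gamma>) * sqrt (mi_fact \<beta> * mi_fact \<gamma>)) \<le> N"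
    using N(2) by (simp add: ennreal_le_iff)
  then have "\<bar>monomial \<beta> t\<bar> * ?X \<le> N * (h ^ mi_size (\<beta> + \<gamma>) * sqrt (mi_fact \<beta> * mi_fact \<gamma>))"
    using h pos by (simp add: pos_divide_le_eq norm_mult)
  also have "\<dots> = (h ^ mi_size \<beta> * sqrt (mi_fact \<beta>)) * (N * h ^ mi_size \<gamma> * sqrt (mi_fact \<gamma>))"
    by (simp add: mi_size_def sum.distrib power_add real_sqrt_mult)
  finally have 1: "\<bar>monomial \<beta> t\<bar> / (h ^ mi_size \<beta> * sqrt (mi_fact \<beta>)) * ?X \<le> N * h ^ mi_size \<gamma> * sqrt (mi_fact \<gamma>)"
    using h pos[of \<beta>] by (simp add: pos_divide_le_eq mult_ac)
  have "exp ((1 / (4 * h\<^sup>2)) * (norm t)\<^sup>2) / 2 ^ CARD('d) = (\<Prod>j\<in>UNIV. exp ((\<bar>t $ j\<bar> / h)\<^sup>2 / 4) / 2)"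
    by (simp add: norm_vec_power2 prod_dividef exp_sum[symmetric] sum_divide_distrib power_divide mult.commute)
  also have "\<dots> \<le> (\<Prod>j\<in>UNIV. (\<bar>t $ j\<bar> / h) ^ b j / sqrt (fact (b j)))"
    by (intro prod_mono conjI b) auto
  also have "\<dots> = \<bar>monomial \<beta> t\<bar> / (h ^ mi_size \<beta> * sqrt (mi_fact \<beta>))"
    by (simp add: \<beta>_def monomial_def mi_size_def mi_fact_def prod_dividef power_sum sqrt_prod abs_prod power_abs power_divide prod.distrib)
  finally have "exp ((1 / (4 * h\<^sup>2)) * (norm t)\<^sup>2) / 2 ^ CARD('d) * ?X \<le>
      \<bar>monomial \<beta> t\<bar> / (h ^ mi_size \<beta> * sqrt (mi_fact \<beta>)) * ?X"
    by (rule mult_right_mono) simp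
  also note 1
  finally have "exp ((1 / (4 * h\<^sup>2)) * (norm t)\<^sup>2) / 2 ^ CARD('d) * ?X \<le> N * h ^ mi_size \<gamma> * sqrt (mi_fact \<gamma>)" .
  then have "exp ((1 / (4 * h\<^sup>2)) * (norm t)\<^sup>2) * ?X \<le> N * 2 ^ CARD('d) * h ^ mi_size \<gamma> * sqrt (mi_fact \<gamma>)"
    by (simp add: field_simps)
  then have "exp (- (1 / (4 * h\<^sup>2)) * (norm t)\<^sup>2) * (exp ((1 / (4 * h\<^sup>2)) * (norm t)\<^sup>2) * ?X) \<le>
      exp (- (1 / (4 * h\<^sup>2)) * (norm t)\<^sup>2) * (N * 2 ^ CARD('d) * h ^ mi_size \<gamma> * sqrt (mi_fact \<gamma>))"
    by (intro mult_left_mono) auto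
  then show ?thesis
    unfolding mult.assoc[symmetric] exp_add[symmetric] by (simp add: mult_ac)
qed

section \<open>Derivatives seen on the Fourier side\<close>

lemma has_vector_derivative_partial:
  assumes "\<psi> differentiable at (t + s *\<^sub>R axis j 1)"
  shows "((\<lambda>r. \<psi> (t + r *\<^sub>R axis j 1)) has_vector_derivative partial_deriv j \<psi> (t + s *\<^sub>R axis j 1)) (at s)"
proof -
  obtain D where D: "(\<psi> has_derivative D) (at (t + s *\<^sub>R axis j 1))"
    using assms by (auto simp: differentiable_def)
  have *: "((\<lambda>r. \<psi> (u + r *\<^sub>R axis j 1)) has_vector_derivative D (axis j 1)) (at s')"
    if u: "u + s' *\<^sub>R axis j 1 = t + s *\<^sub>R axis j 1" for u s'
  proof -
    have "((\<lambda>r. \<psi> (u + r *\<^sub>R axis j 1)) has_derivative (\<lambda>r. D (r *\<^sub>R axis j 1))) (at s')"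
      by (rule has_derivative_compose[of "\<lambda>r. u + r *\<^sub>R axis j 1" _ s' UNIV \<psi> D])
         (use D u in \<open>auto intro!: derivative_eq_intros\<close>)
    then show ?thesis
      using linear_cmul[OF has_derivative_linear[OF D]] by (simp add: has_vector_derivative_def)
  qed
  have "partial_deriv j \<psi> (t + s *\<^sub>R axis j 1) = D (axis j 1)"
    unfolding partial_deriv_def by (rule vector_derivative_at[OF *]) simp
  then show ?thesis using *[of t s] by simp
qed

text \<open>Integration by parts through translation invariance: the difference quotients of \<psi>
  times the character have integral 0, and dominated convergence transfers this to their limit, the
  product-rule derivative \<open>D\<close>.\<close>

lemma fourier_partial_deriv:
  fixes \<psi> :: "real^'d \<Rightarrow> complex"
  assumes diff: "\<psi> differentiable_on UNIV" and cont: "continuous_on UNIV (partial_deriv j \<psi>)"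
    and a: "a > 0" and b1: "\<And>t. cmod (\<psi> t) \<le> C * exp (- a * (norm t)\<^sup>2)"
    and b2: "\<And>t. cmod (partial_deriv j \<psi> t) \<le> C' * exp (- a * (norm t)\<^sup>2)"
  shows "fourier (partial_deriv j \<psi>) \<omega> = 2 * pi * \<i> * complex_of_real (\<omega> $ j) * fourier \<psi> \<omega>"
proof -
  let ?e = "axis j 1 :: real^'d"
  define \<eta> where "\<eta> t = exp (- (2 * pi * \<i> * complex_of_real (\<omega> \<bullet> t)))" for t
  define F where "F t = \<psi> t * \<eta> t" for t
  define D where "D t = (partial_deriv j \<psi> t - 2 * pi * \<i> * complex_of_real (\<omega> $ j) * \<psi> t) * \<eta> t" for t
  have [measurable]: "\<psi> \<in> borel_measurable borel" "partial_deriv j \<psi> \<in> borel_measurable borel"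
    using cont differentiable_imp_continuous_on[OF diff] by (auto intro: borel_measurable_continuous_onI)
  have [measurable]: "\<eta> \<in> borel_measurable borel" unfolding \<eta>_def by measurable
  have [measurable]: "F \<in> borel_measurable borel" "D \<in> borel_measurable borel"
    unfolding F_def[abs_def] D_def[abs_def] by measurable
  have n\<eta>: "cmod (\<eta> t) = 1" for t by (simp add: \<eta>_def)
  have i\<psi>: "integrable lborel (\<lambda>t. \<psi> t * \<eta> t)"
    by (rule integrable_gauss_bound[OF _ a, where C = C]) (measurable, use b1 in \<open>simp add: norm_mult n\<eta>\<close>)
  have iD\<psi>: "integrable lborel (\<lambda>t. partial_deriv j \<psi> t * \<eta> t)"
    by (rule integrable_gauss_bound[OF _ a, where C = C']) (measurable, use b2 in \<open>simp add: norm_mult n\<eta>\<close>)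
  have dF: "((\<lambda>r. F (t + r *\<^sub>R ?e)) has_vector_derivative D (t + s *\<^sub>R ?e)) (at s)" for t s
  proof -
    have "((\<lambda>r. \<eta> (t + r *\<^sub>R ?e)) has_vector_derivative - (2 * pi * \<i> * complex_of_real (\<omega> $ j)) * \<eta> (t + s *\<^sub>R ?e)) (at s)"
      unfolding \<eta>_def inner_add_right inner_scaleR_right inner_axis
      by (auto intro!: derivative_eq_intros has_vector_derivative_real_field simp: algebra_simps)
    moreover have "\<psi> differentiable at (t + s *\<^sub>R ?e)" using diff by (simp add: differentiable_on_def)
    ultimately have "((\<lambda>r. \<psi> (t + r *\<^sub>R ?e) * \<eta> (t + r *\<^sub>R ?e)) has_vector_derivative
        \<psi> (t + s *\<^sub>R ?e) * (- (2 * pi * \<i> * complex_of_real (\<omega> $ j)) * \<eta> (t + s *\<^sub>R ?e)) +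
        partial_deriv j \<psi> (t + s *\<^sub>R ?e) * \<eta> (t + s *\<^sub>R ?e)) (at s)"
      by (intro has_vector_derivative_mult has_vector_derivative_partial)
    then show ?thesis by (simp add: F_def D_def algebra_simps)
  qed
  define A where "A = \<bar>C'\<bar> + 2 * pi * \<bar>\<omega> $ j\<bar> * \<bar>C\<bar>"
  have bD: "cmod (D t) \<le> A * exp (- a * (norm t)\<^sup>2)" for t
  proof -
    have "cmod (D t) \<le> cmod (partial_deriv j \<psi> t) + 2 * pi * \<bar>\<omega> $ j\<bar> * cmod (\<psi> t)"
      unfolding D_def norm_mult n\<eta> mult_1_right
      by (rule order_trans[OF norm_triangle_ineq4]) (simp add: norm_mult)
    also have "\<dots> \<le> \<bar>C'\<bar> * exp (- a * (norm t)\<^sup>2) + 2 * pi * \<bar>\<omega> $ j\<bar> * (\<bar>C\<bar> * exp (- a * (norm t)\<^sup>2))"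
      by (intro add_mono mult_left_mono order_trans[OF b1] order_trans[OF b2] mult_right_mono) auto
    finally show ?thesis by (simp add: A_def algebra_simps)
  qed
  have A0: "A \<ge> 0" by (simp add: A_def)
  define q where "q n t = (F (t + (1 / Suc n) *\<^sub>R ?e) - F t) /\<^sub>R (1 / Suc n)" for n t
  \<comment> \<open>The mean value inequality on a segment of length at most 1; there |t + s e|^2 >=
    |t|^2 / 2 - 1, which gives the constant exp a and the halved rate.\<close>
  have bq: "cmod (q n t) \<le> (A * exp a) * exp (- (a / 2) * (norm t)\<^sup>2)" for n t
  proof -
    let ?B = "(A * exp a) * exp (- (a / 2) * (norm t)\<^sup>2)"
    have "norm (F (t + (1 / Suc n) *\<^sub>R ?e) - F (t + 0 *\<^sub>R ?e)) \<le> norm (1 / real (Suc n) - 0) * ?B"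
    proof (rule differentiable_bound[of "{0..1}" "\<lambda>r. F (t + r *\<^sub>R ?e)" "\<lambda>s r. r *\<^sub>R D (t + s *\<^sub>R ?e)", simplified mult.commute[of "norm (_ - _)"], THEN ord_le_eq_trans])
      show "convex {0..1::real}" by simp
      fix s :: real assume s: "s \<in> {0..1}"
      show "((\<lambda>r. F (t + r *\<^sub>R ?e)) has_derivative (\<lambda>r. r *\<^sub>R D (t + s *\<^sub>R ?e))) (at s within {0..1})"
        using dF[of t s] by (auto simp: has_vector_derivative_def intro: has_derivative_at_withinI)
      have "(norm t)\<^sup>2 / 2 - (norm (s *\<^sub>R ?e))\<^sup>2 \<le> (norm (t + s *\<^sub>R ?e))\<^sup>2" by (rule norm_add_power2_ge)
      moreover have "(norm (s *\<^sub>R ?e))\<^sup>2 \<le> 1" using s by (simp add: power_le_one)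
      ultimately have "a * ((norm t)\<^sup>2 / 2 - 1) \<le> a * (norm (t + s *\<^sub>R ?e))\<^sup>2"
        using a by (intro mult_left_mono) auto
      then have "exp (- a * (norm (t + s *\<^sub>R ?e))\<^sup>2) \<le> exp (a + - (a / 2) * (norm t)\<^sup>2)"
        by (simp add: algebra_simps)
      then have "A * exp (- a * (norm (t + s *\<^sub>R ?e))\<^sup>2) \<le> A * exp (a + - (a / 2) * (norm t)\<^sup>2)"
        using A0 by (intro mult_left_mono) auto
      then have "norm (D (t + s *\<^sub>R ?e)) \<le> ?B"
        using bD[of "t + s *\<^sub>R ?e"] by (simp only: exp_add mult.assoc)
      then show "onorm (\<lambda>r. r *\<^sub>R D (t + s *\<^sub>R ?e)) \<le> ?B"
        by (simp add: onorm_scaleR_left onorm_id)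
    qed auto
    then have "norm (F (t + (1 / Suc n) *\<^sub>R ?e) - F t) \<le> (1 / real (Suc n)) * ?B"
      by (simp del: of_nat_Suc)
    then have "real (Suc n) * norm (F (t + (1 / Suc n) *\<^sub>R ?e) - F t) \<le> real (Suc n) * ((1 / real (Suc n)) * ?B)"
      by (rule mult_left_mono) simp
    then show ?thesis by (simp add: q_def del: of_nat_Suc)
  qed
  have lim: "(\<lambda>n. q n t) \<longlonglongrightarrow> D t" for t
  proof -
    have "((\<lambda>r. F (t + r *\<^sub>R ?e)) has_vector_derivative D t) (at 0)" using dF[of t 0] by simp
    then have l: "((\<lambda>r. norm (F (t + r *\<^sub>R ?e) - F t - r *\<^sub>R D t) / norm r) \<longlongrightarrow> 0) (at 0)"
      unfolding has_vector_derivative_def has_derivative_at by simp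
    have "((\<lambda>r. (F (t + r *\<^sub>R ?e) - F t) /\<^sub>R r - D t) \<longlongrightarrow> 0) (at 0)"
    proof (rule tendsto_norm_zero_cancel, rule Lim_transform_eventually[OF l])
      have "norm (x - r *\<^sub>R D t) / norm r = norm (x /\<^sub>R r - D t)" if "r \<noteq> 0" for x and r :: real
      proof -
        have "x /\<^sub>R r - D t = (x - r *\<^sub>R D t) /\<^sub>R r" using that by (simp add: scaleR_diff_right)
        then show ?thesis by (simp add: divide_inverse mult.commute)
      qed
      then show "\<forall>\<^sub>F r in at 0. norm (F (t + r *\<^sub>R ?e) - F t - r *\<^sub>R D t) / norm r
          = norm ((F (t + r *\<^sub>R ?e) - F t) /\<^sub>R r - D t)"
        by (simp add: eventually_at_filter)
    qed
    then have "((\<lambda>r. (F (t + r *\<^sub>R ?e) - F t) /\<^sub>R r) \<longlongrightarrow> D t) (at 0)"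
      by (rule LIM_zero_cancel)
    moreover have "filterlim (\<lambda>n. 1 / real (Suc n)) (at 0) sequentially"
      unfolding filterlim_at using LIMSEQ_Suc[OF lim_1_over_n] by auto
    ultimately show ?thesis unfolding q_def by (rule filterlim_compose)
  qed
  have "(\<lambda>n. LINT t|lborel. q n t) \<longlonglongrightarrow> (LINT t|lborel. D t)"
  proof (rule integral_dominated_convergence[where w = "\<lambda>t. (A * exp a) * exp (- (a / 2) * (norm t)\<^sup>2)"])
    show "integrable lborel (\<lambda>t::real^'d. (A * exp a) * exp (- (a / 2) * (norm t)\<^sup>2))"
      using a by (intro integrable_mult_right integrable_gauss) auto
    show "q n \<in> borel_measurable lborel" for n unfolding q_def[abs_def] by measurable
    show "AE t in lborel. norm (q n t) \<le> (A * exp a) * exp (- (a / 2) * (norm t)\<^sup>2)" for n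
      by (rule AE_I2[OF bq])
  qed (auto simp: lim)
  moreover have "(LINT t|lborel. q n t) = 0" for n
  proof -
    have "integrable lborel F" using i\<psi> by (simp add: F_def[abs_def])
    then have "(LINT t|lborel. F (t + (1 / Suc n) *\<^sub>R ?e) - F t) = 0"
      by (subst Bochner_Integration.integral_diff)
         (auto simp: integral_lborel_shift intro: integrable_lborel_shift)
    then show ?thesis by (simp add: q_def)
  qed
  ultimately have "(LINT t|lborel. D t) = 0" by (simp add: LIMSEQ_const_iff)
  also have "(LINT t|lborel. D t) = (LINT t|lborel. partial_deriv j \<psi> t * \<eta> t - (2 * pi * \<i> * complex_of_real (\<omega> $ j)) * (\<psi> t * \<eta> t))"
    by (simp add: D_def left_diff_distrib mult.assoc)
  also have "\<dots> = fourier (partial_deriv j \<psi>) \<omega> - 2 * pi * \<i> * complex_of_real (\<omega> $ j) * fourier \<psi> \<omega>"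
    unfolding fourier_def \<eta>_def[symmetric]
    by (subst Bochner_Integration.integral_diff) (use i\<psi> iD\<psi> in auto)
  finally show ?thesis by simp
qed

text \<open>A multi-index supported on one coordinate is counted by exactly one list, so the choice
  inside \<open>multi_deriv\<close> is forced. For mixed multi-indices symmetry is available only
  once \<phi> has been written as an \<open>exp_integral\<close>.\<close>

lemma iter_deriv_replicate:
  obtains \<gamma> where "iter_deriv (replicate n j) \<phi> = multi_deriv \<gamma> \<phi>"
    "mi_size \<gamma> = n" "mi_fact \<gamma> = fact n"
proof -
  define \<gamma> :: "nat^'a" where "\<gamma> = (\<chi> i. if i = j then n else 0)"
  obtain js where js: "multi_deriv \<gamma> \<phi> = iter_deriv js \<phi>" "\<And>i. count_list js i = \<gamma> $ i"
    by (rule multi_deriv_iter) (rule that)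
  have "mset js = mset (replicate n j)"
    by (rule multiset_eqI) (simp add: count_mset js(2) \<gamma>_def)
  then have "js = replicate n j"
    using mset_eq_length[of js "replicate n j"] mset_eq_setD[of js "replicate n j"]
    by (intro replicate_eqI) auto
  then show ?thesis
    using js(1) that[of \<gamma>] by (simp add: \<gamma>_def mi_size_def mi_fact_def if_distrib cong: if_cong)
qed

lemma power_le_sqrt_fact_exp: assumes "u \<ge> 0" shows "u ^ n \<le> sqrt (fact n) * exp ((u::real)\<^sup>2 / 2)"
proof -
  have "(u\<^sup>2) ^ n \<le> fact n * exp (u\<^sup>2)" by (rule power_le_fact_exp) simp
  then have "sqrt ((u\<^sup>2) ^ n) \<le> sqrt (fact n * exp (u\<^sup>2))" by simp
  moreover have "sqrt (exp (u\<^sup>2)) = exp (u\<^sup>2 / 2)"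
    by (rule real_sqrt_unique) (simp_all add: exp_double[symmetric])
  moreover have "sqrt ((u\<^sup>2) ^ n) = u ^ n" unfolding real_sqrt_power[of "u\<^sup>2" n] using assms by simp
  ultimately show ?thesis by (simp add: real_sqrt_mult)
qed

text \<open>The quotient of the two sides is a multinomial coefficient.\<close>

lemma count_fact_le: "(\<Prod>j\<in>(UNIV::'d::finite set). fact (count_list js j) :: real) \<le> fact (length js)"
proof (induction js)
  case (Cons j js)
  have "(\<Prod>i\<in>(UNIV::'d set). fact (count_list (j # js) i) :: real) =
      (\<Prod>i\<in>UNIV. fact (count_list js i) * (if i = j then real (count_list js j + 1) else 1))"
    by (intro prod.cong) auto
  also have "\<dots> = (\<Prod>i\<in>UNIV. fact (count_list js i)) * real (count_list js j + 1)"
    by (simp add: prod.distrib)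
  also have "\<dots> \<le> fact (length js) * real (length js + 1)"
    using count_le_length[of js j] by (intro mult_mono Cons) auto
  also have "\<dots> = fact (length (j # js))" by (simp add: algebra_simps)
  finally show ?case .
qed simp

lemma exp_integral_sum:
  assumes "finite A" "\<And>j. j \<in> A \<Longrightarrow> gauss_bounded (f j)"
  shows "exp_integral (\<lambda>s. \<Sum>j\<in>A. c j * f j s) z = (\<Sum>j\<in>A. c j * exp_integral (f j) z)"
proof -
  have "exp_integral (\<lambda>s. \<Sum>j\<in>A. c j * f j s) z =
      (LINT t|lborel. (\<Sum>j\<in>A. c j * (exp (2 * pi * \<i> * (z \<bullet>\<^sub>c cvec t)) * f j t)))"
    by (simp add: exp_integral_def sum_distrib_left mult.left_commute)
  also have "\<dots> = (\<Sum>j\<in>A. (LINT t|lborel. c j * (exp (2 * pi * \<i> * (z \<bullet>\<^sub>c cvec t)) * f j t)))"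
    by (rule Bochner_Integration.integral_sum) (intro integrable_mult_right exp_integral_integrable assms)
  finally show ?thesis by (simp add: exp_integral_def)
qed

lemma gauss_bounded_bdot_power:
  assumes "gauss_bounded h"
  shows "gauss_bounded (\<lambda>s. (2 * pi * \<i> * (v \<bullet>\<^sub>c cvec s)) ^ n * h s)"
proof (induction n)
  case (Suc n)
  show ?case using gauss_bounded_bdot[OF Suc, of v] by (simp add: mult_ac)
qed (use assms in simp)

text \<open>The \<open>n\<close>-th directional derivative is a sum of \<open>n\<close>-fold mixed partial derivatives.\<close>

lemma directional_deriv_bound:
  fixes g :: "real^'d \<Rightarrow> complex"
  assumes g: "gauss_bounded g" and C: "C \<ge> 0"
    and bd: "\<And>js. cmod (exp_integral (\<lambda>s. deriv_factor js s * g s) z) \<le> C * (h ^ length js * sqrt (fact (length js)))"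
  shows "cmod (exp_integral (\<lambda>s. (2 * pi * \<i> * (cvec y \<bullet>\<^sub>c cvec s)) ^ n * (deriv_factor js s * g s)) z) \<le>
     (\<Sum>j\<in>UNIV. \<bar>y $ j\<bar>) ^ n * (C * (h ^ (n + length js) * sqrt (fact (n + length js))))"
proof (induction n arbitrary: js)
  case 0
  then show ?case using bd by simp
next
  case (Suc n)
  let ?Y = "\<Sum>j\<in>UNIV. \<bar>y $ j\<bar>"
  let ?p = "\<lambda>s. (2 * pi * \<i> * (cvec y \<bullet>\<^sub>c cvec s)) ^ n"
  \<comment> \<open>One factor of the directional symbol is expanded in coordinates and pushed into
    the list, in which the induction hypothesis is general.\<close>
  have "(2 * pi * \<i> * (cvec y \<bullet>\<^sub>c cvec s)) ^ Suc n * (deriv_factor js s * g s) =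
      (\<Sum>j\<in>UNIV. complex_of_real (y $ j) * (?p s * (deriv_factor (j # js) s * g s)))" for s
    unfolding bdot_def by (simp add: sum_distrib_left sum_distrib_right mult_ac)
  then have "exp_integral (\<lambda>s. (2 * pi * \<i> * (cvec y \<bullet>\<^sub>c cvec s)) ^ Suc n * (deriv_factor js s * g s)) z =
      (\<Sum>j\<in>UNIV. complex_of_real (y $ j) * exp_integral (\<lambda>s. ?p s * (deriv_factor (j # js) s * g s)) z)"
    by (simp only: exp_integral_sum[OF finite gauss_bounded_bdot_power[OF gauss_bounded_deriv_factor[OF g]]])
  then have "cmod (exp_integral (\<lambda>s. (2 * pi * \<i> * (cvec y \<bullet>\<^sub>c cvec s)) ^ Suc n * (deriv_factor js s * g s)) z) \<le>
      (\<Sum>j\<in>UNIV. \<bar>y $ j\<bar> * cmod (exp_integral (\<lambda>s. ?p s * (deriv_factor (j # js) s * g s)) z))"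
    by (simp only:) (rule order_trans[OF norm_sum], simp add: norm_mult)
  also have "\<dots> \<le> (\<Sum>j\<in>UNIV. \<bar>y $ j\<bar> * (?Y ^ n * (C * (h ^ (n + length (j # js)) * sqrt (fact (n + length (j # js)))))))"
    for j by (intro sum_mono mult_left_mono Suc.IH) auto
  also have "\<dots> = ?Y * (?Y ^ n * (C * (h ^ (Suc n + length js) * sqrt (fact (Suc n + length js)))))"
    unfolding sum_distrib_right by simp
  finally show ?case by (simp only: power_Suc mult.assoc)
qed

lemma higher_deriv_exp_integral:
  assumes "gauss_bounded g"
  shows "(deriv ^^ n) (\<lambda>l. exp_integral g (z + l *s v)) =
    (\<lambda>l. exp_integral (\<lambda>s. (2 * pi * \<i> * (v \<bullet>\<^sub>c cvec s)) ^ n * g s) (z + l *s v))"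
proof (induction n)
  case (Suc n)
  have "deriv (\<lambda>l. exp_integral (\<lambda>s. (2 * pi * \<i> * (v \<bullet>\<^sub>c cvec s)) ^ n * g s) (z + l *s v)) l =
      exp_integral (\<lambda>s. 2 * pi * \<i> * (v \<bullet>\<^sub>c cvec s) * ((2 * pi * \<i> * (v \<bullet>\<^sub>c cvec s)) ^ n * g s)) (z + l *s v)" for l
    by (rule DERIV_imp_deriv[OF exp_integral_has_field_derivative[OF gauss_bounded_bdot_power[OF assms]]])
  then show ?case by (simp add: Suc mult.assoc)
qed simp

text \<open>Taylor expansion from the real point x in the direction i y. The n-th term is at most (h
  Y)^n / sqrt (n!) times the Gaussian in x, with Y the l1 norm of y, and the series is bounded by a
  Gaussian in Y.\<close>

lemma gs_entire_exp_integral: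
  fixes g :: "real^'d \<Rightarrow> complex"
  assumes g: "gauss_bounded g" and C: "C \<ge> 0" and a: "a > 0" and h: "h > 0"
    and bd: "\<And>js t. cmod (exp_integral (\<lambda>s. deriv_factor js s * g s) (cvec t)) \<le>
      (C * exp (- a * (norm t)\<^sup>2)) * (h ^ length js * sqrt (fact (length js)))"
  shows "gs_entire (exp_integral g)"
proof (rule gs_entireI[where a = a and b = "2 * h\<^sup>2 * (real CARD('d))\<^sup>2" and C = "2 * C"])
  show "line_holomorphic (exp_integral g)" by (rule line_holomorphic_exp_integral[OF g])
  fix z :: "complex^'d"
  define x y where "x = Re_vec z" and "y = Im_vec z"
  define Y where "Y = (\<Sum>j\<in>UNIV. \<bar>y $ j\<bar>)"
  define E where "E = C * exp (- a * (norm x)\<^sup>2)"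
  have Y: "Y \<ge> 0" "Y \<le> real CARD('d) * norm y"
    using sum_bounded_above[of UNIV "\<lambda>j. \<bar>y $ j\<bar>" "norm y"] component_le_norm_cart[of y]
    by (auto simp: Y_def sum_nonneg)
  have E: "E \<ge> 0" using C by (simp add: E_def)
  let ?G = "\<lambda>l. exp_integral g (cvec x + l *s cvec y)"
  have "?G holomorphic_on UNIV"
    using line_holomorphic_exp_integral[OF g] by (simp add: line_holomorphic_def)
  then have "(\<lambda>n. (deriv ^^ n) ?G 0 / fact n * (\<i> - 0) ^ n) sums ?G \<i>"
    by (intro holomorphic_power_series[where r = 2]) (auto intro: holomorphic_on_subset)
  then have "cmod (?G \<i>) = cmod (\<Sum>n. (deriv ^^ n) ?G 0 / fact n * (\<i> - 0) ^ n)"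
    by (simp add: sums_iff)
  also have "\<dots> \<le> (\<Sum>n. (E * exp (2 * (h * Y)\<^sup>2)) * (1 / 2) ^ n)"
  proof (rule norm_suminf_le)
    show "summable (\<lambda>n. (E * exp (2 * (h * Y)\<^sup>2)) * (1 / 2) ^ n)"
      by (intro summable_mult summable_geometric) simp
    fix n
    have "cmod ((deriv ^^ n) ?G 0) \<le> Y ^ n * (E * (h ^ n * sqrt (fact n)))"
      using directional_deriv_bound[OF g E bd[of _ x, folded E_def], of y n "[]"]
      by (simp add: higher_deriv_exp_integral[OF g] Y_def)
    then have "cmod ((deriv ^^ n) ?G 0 / fact n * (\<i> - 0) ^ n) \<le> Y ^ n * (E * (h ^ n * sqrt (fact n))) / fact n"
      by (simp add: norm_mult norm_divide norm_power divide_right_mono)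
    also have "\<dots> = (h * Y) ^ n * (E / sqrt (fact n))"
      by (simp add: power_mult_distrib field_simps)
    \<comment> \<open>Doubling the base and compensating with (1/2)^n leaves a geometric series,
      because (2 h Y)^n / sqrt (n!) is bounded by exp (2 (h Y)^2) uniformly in n.\<close>
    also have "\<dots> = (2 * (h * Y)) ^ n * (1 / 2) ^ n * (E / sqrt (fact n))"
      unfolding power_mult_distrib[symmetric] by simp
    also have "\<dots> \<le> (sqrt (fact n) * exp ((2 * (h * Y))\<^sup>2 / 2)) * (1 / 2) ^ n * (E / sqrt (fact n))"
      using h Y E by (intro mult_right_mono power_le_sqrt_fact_exp) auto
    also have "(2 * (h * Y))\<^sup>2 / 2 = 2 * (h * Y)\<^sup>2" by (simp add: power2_eq_square)
    also have "(sqrt (fact n) * exp (2 * (h * Y)\<^sup>2)) * (1 / 2) ^ n * (E / sqrt (fact n)) = (E * exp (2 * (h * Y)\<^sup>2)) * (1 / 2) ^ n"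
      by simp
    finally show "cmod ((deriv ^^ n) ?G 0 / fact n * (\<i> - 0) ^ n) \<le> (E * exp (2 * (h * Y)\<^sup>2)) * (1 / 2) ^ n" .
  qed
  also have "\<dots> = (E * exp (2 * (h * Y)\<^sup>2)) * 2"
    by (subst suminf_mult) (auto simp: suminf_geometric intro!: summable_geometric)
  also have "\<dots> \<le> (E * exp (2 * h\<^sup>2 * (real CARD('d))\<^sup>2 * (norm y)\<^sup>2)) * 2"
  proof -
    have "(h * Y)\<^sup>2 \<le> (h * (real CARD('d) * norm y))\<^sup>2"
      using Y h by (intro power_mono mult_left_mono) auto
    then show ?thesis using E by (intro mult_right_mono mult_left_mono) (auto simp: power_mult_distrib mult_ac)
  qed
  also have "\<dots> = 2 * C * exp (2 * h\<^sup>2 * (real CARD('d))\<^sup>2 * (norm y)\<^sup>2 - a * (norm x)\<^sup>2)"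
    by (simp add: E_def exp_diff exp_minus field_simps)
  finally show "cmod (exp_integral g z) \<le> 2 * C * exp (2 * h\<^sup>2 * (real CARD('d))\<^sup>2 * (norm (Im_vec z))\<^sup>2 - a * (norm (Re_vec z))\<^sup>2)"
    unfolding x_def y_def cvec_Re_Im[symmetric] .
qed (use a in auto)

text \<open>Pure derivatives alone give Gaussian decay of the Fourier transform. Inversion then
  writes \<phi> as an \<open>exp_integral\<close>, which makes its mixed derivatives symmetric and
  lets the bounds on \<open>multi_deriv\<close> reach every list of directions.\<close>

lemma gs_space_imp_gs_entire:
  fixes \<phi> :: "real^'d \<Rightarrow> complex"
  assumes "\<phi> \<in> gs_space"
  obtains \<Phi> where "gs_entire \<Phi>" "\<phi> = (\<lambda>t. \<Phi> (cvec t))"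
proof -
  obtain h where h: "h > 0" and sm: "smooth \<phi>" and fin: "gs_norm h \<phi> < \<infinity>"
    using assms by (auto simp: gs_space_def gs_banach_def)
  define N where "N = enn2real (gs_norm h \<phi>)"
  have N: "gs_norm h \<phi> \<le> ennreal N" "N \<ge> 0" using fin by (auto simp: N_def)
  define a where "a = 1 / (4 * h\<^sup>2)"
  have a: "a > 0" using h by (simp add: a_def)
  define C where "C = N * 2 ^ CARD('d)"
  have C: "C \<ge> 0" using N by (simp add: C_def)
  have bd: "cmod (multi_deriv \<gamma> \<phi> t) \<le> C * h ^ mi_size \<gamma> * sqrt (mi_fact \<gamma>) * exp (- a * (norm t)\<^sup>2)" for \<gamma> t
    unfolding C_def a_def by (rule gs_norm_gauss_bound[OF h N])
  have pure: "cmod (iter_deriv (replicate n j) \<phi> t) \<le> (C * h ^ n * sqrt (fact n)) * exp (- a * (norm t)\<^sup>2)" for n j t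
    using iter_deriv_replicate[of n j \<phi>] bd by metis
  have diff: "iter_deriv js \<phi> differentiable_on UNIV" for js using sm by (simp add: smooth_def)
  have cont: "continuous_on UNIV (iter_deriv js \<phi>)" for js
    by (rule differentiable_imp_continuous_on[OF diff])
  have F: "fourier (iter_deriv (replicate n j) \<phi>) \<omega> = (2 * pi * \<i> * complex_of_real (\<omega> $ j)) ^ n * fourier \<phi> \<omega>" for n j \<omega>
  proof (induction n)
    case (Suc n)
    have "fourier (partial_deriv j (iter_deriv (replicate n j) \<phi>)) \<omega> =
        2 * pi * \<i> * complex_of_real (\<omega> $ j) * fourier (iter_deriv (replicate n j) \<phi>) \<omega>"
      using cont[of "replicate (Suc n) j"] pure[of "Suc n" j]
      by (intro fourier_partial_deriv[OF diff _ a pure[of n j]]) (auto simp: iter_deriv_Cons)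
    then show ?case by (simp add: iter_deriv_Cons Suc mult.assoc)
  qed simp
  define G where "G = (LINT t::real^'d|lborel. exp (- a * (norm t)\<^sup>2))"
  have Fb: "(2 * pi * \<bar>\<omega> $ j\<bar>) ^ n * cmod (fourier \<phi> \<omega>) \<le> C * h ^ n * sqrt (fact n) * G" for n j \<omega>
  proof -
    have "(2 * pi * \<bar>\<omega> $ j\<bar>) ^ n * cmod (fourier \<phi> \<omega>) = cmod (fourier (iter_deriv (replicate n j) \<phi>) \<omega>)"
      unfolding F by (simp add: norm_mult norm_power)
    also have "\<dots> \<le> (LINT t|lborel. (C * h ^ n * sqrt (fact n)) * exp (- a * (norm (t::real^'d))\<^sup>2))"
      unfolding fourier_def
    proof (rule Bochner_Integration.integral_norm_bound_integral)
      have [measurable]: "iter_deriv (replicate n j) \<phi> \<in> borel_measurable borel"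
        using cont by (rule borel_measurable_continuous_onI)
      show "integrable lborel (\<lambda>t. iter_deriv (replicate n j) \<phi> t * exp (- (2 * pi * \<i> * complex_of_real (\<omega> \<bullet> t))))"
        by (rule integrable_gauss_bound[OF _ a]) (measurable, use pure in \<open>simp add: norm_mult\<close>)
      show "integrable lborel (\<lambda>t::real^'d. (C * h ^ n * sqrt (fact n)) * exp (- a * (norm t)\<^sup>2))"
        by (intro integrable_mult_right integrable_gauss a)
    qed (use pure in \<open>simp add: norm_mult\<close>)
    finally show ?thesis by (simp add: G_def)
  qed
  let ?g = "fourier \<phi>"
  have \<phi>m [measurable]: "\<phi> \<in> borel_measurable borel"
    using cont[of "[]"] by (intro borel_measurable_continuous_onI) simp
  have g: "gauss_bounded ?g"
    unfolding gauss_bounded_def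
  proof (intro conjI exI allI)
    show "?g \<in> borel_measurable borel" unfolding fourier_def by measurable
    let ?d = "real CARD('d)"
    show "pi\<^sup>2 / (?d * h\<^sup>2) > 0" using h by simp
    fix \<omega> :: "real^'d"
    \<comment> \<open>A coordinate of maximal modulus: decay in it controls |\<omega>|, at the price
      of the dimension in the rate.\<close>
    obtain j where j: "\<And>i. \<bar>\<omega> $ i\<bar> \<le> \<bar>\<omega> $ j\<bar>"
    proof -
      have "Max (range (\<lambda>i. \<bar>\<omega> $ i\<bar>)) \<in> range (\<lambda>i. \<bar>\<omega> $ i\<bar>)" by (intro Max_in) auto
      then obtain j where j: "Max (range (\<lambda>i. \<bar>\<omega> $ i\<bar>)) = \<bar>\<omega> $ j\<bar>" by (rule rangeE)
      have "\<bar>\<omega> $ i\<bar> \<le> \<bar>\<omega> $ j\<bar>" for i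
        unfolding j[symmetric] by (rule Max_ge) auto
      then show ?thesis by (rule that)
    qed
    have "(norm \<omega>)\<^sup>2 \<le> (\<Sum>i\<in>(UNIV::'d set). \<bar>\<omega> $ j\<bar>\<^sup>2)"
      unfolding norm_vec_power2 using j by (intro sum_mono power_mono) auto
    then have nj: "(norm \<omega>)\<^sup>2 \<le> ?d * (\<omega> $ j)\<^sup>2" by simp
    \<comment> \<open>The ratio whose powers \<open>Fb\<close> controls against sqrt (n!); the order
      n of differentiation is then chosen depending on \<omega>.\<close>
    define u where "u = 2 * pi * \<bar>\<omega> $ j\<bar> / h"
    have "u \<ge> 0" using h by (simp add: u_def)
    then obtain n where n: "exp (u\<^sup>2 / 4) / 2 \<le> u ^ n / sqrt (fact n)" using ex_power_ge_gauss by blast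
    have "exp (u\<^sup>2 / 4) / 2 * cmod (?g \<omega>) \<le> u ^ n / sqrt (fact n) * cmod (?g \<omega>)"
      by (rule mult_right_mono[OF n]) simp
    also have "\<dots> = ((2 * pi * \<bar>\<omega> $ j\<bar>) ^ n * cmod (?g \<omega>)) / (h ^ n * sqrt (fact n))"
      by (simp add: u_def power_divide)
    also have "\<dots> \<le> (C * h ^ n * sqrt (fact n) * G) / (h ^ n * sqrt (fact n))"
      using h by (intro divide_right_mono Fb) auto
    also have "\<dots> = C * G" using h by simp
    finally have "exp (u\<^sup>2 / 4) * cmod (?g \<omega>) \<le> 2 * C * G" by simp
    then have "exp (- (u\<^sup>2 / 4)) * (exp (u\<^sup>2 / 4) * cmod (?g \<omega>)) \<le> exp (- (u\<^sup>2 / 4)) * (2 * C * G)"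
      by (rule mult_left_mono) simp
    then have "cmod (?g \<omega>) \<le> 2 * C * G * exp (- (u\<^sup>2 / 4))"
      unfolding mult.assoc[symmetric] exp_add[symmetric] by (simp add: mult_ac)
    also have "\<dots> \<le> 2 * C * G * exp (- (pi\<^sup>2 / (?d * h\<^sup>2)) * (norm \<omega>)\<^sup>2)"
    proof (intro mult_left_mono iffD2[OF exp_le_cancel_iff])
      have "pi\<^sup>2 / (?d * h\<^sup>2) * (norm \<omega>)\<^sup>2 \<le> pi\<^sup>2 / (?d * h\<^sup>2) * (?d * (\<omega> $ j)\<^sup>2)"
        by (intro mult_left_mono nj) simp
      also have "\<dots> = u\<^sup>2 / 4" using h by (simp add: u_def power_divide power_mult_distrib field_simps)
      finally show "- (u\<^sup>2 / 4) \<le> - (pi\<^sup>2 / (?d * h\<^sup>2)) * (norm \<omega>)\<^sup>2" by simp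
      show "0 \<le> 2 * C * G" using C by (simp add: G_def)
    qed
    finally show "cmod (?g \<omega>) \<le> 2 * C * G * exp (- (pi\<^sup>2 / (?d * h\<^sup>2)) * (norm \<omega>)\<^sup>2)" .
  qed
  have pb: "cmod (\<phi> t) \<le> C * exp (- a * (norm t)\<^sup>2)" for t using pure[of 0 _ t] by simp
  have \<phi>: "\<phi> = (\<lambda>t. exp_integral ?g (cvec t))"
  proof (rule ext)
    fix t
    have "cmod (\<phi> t) \<le> C" for t
    proof -
      have "C * exp (- a * (norm t)\<^sup>2) \<le> C * 1" using a C by (intro mult_left_mono) auto
      then show ?thesis using pb[of t] by simp
    qed
    then have "inv_fourier ?g t = \<phi> t"
      by (intro fourier_inversion integrable_gauss_bound[OF \<phi>m a pb] gauss_bounded_integrable[OF g])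
         (use cont[of "[]"] in auto)
    then show "\<phi> t = exp_integral ?g (cvec t)" by (simp add: inv_fourier_exp_integral)
  qed
  have it: "iter_deriv js \<phi> = (\<lambda>t. exp_integral (\<lambda>s. deriv_factor js s * ?g s) (cvec t))" for js
    using arg_cong[OF \<phi>, of "iter_deriv js"] unfolding iter_deriv_exp_integral[OF g] .
  have "gs_entire (exp_integral ?g)"
  proof (rule gs_entire_exp_integral[OF g C a h])
    fix js t
    \<comment> \<open>The list chosen by \<open>multi_deriv\<close> may be another ordering of js;
      the derivatives agree because their symbols do.\<close>
    define \<gamma> :: "nat^'d" where "\<gamma> = (\<chi> j. count_list js j)"
    obtain ks where ks: "multi_deriv \<gamma> \<phi> = iter_deriv ks \<phi>" "\<And>i. count_list ks i = \<gamma> $ i"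
      by (rule multi_deriv_iter) (rule that)
    have "mset js = mset ks" by (rule multiset_eqI) (simp add: count_mset ks(2) \<gamma>_def)
    then have "iter_deriv js \<phi> = multi_deriv \<gamma> \<phi>"
      unfolding ks(1) it using deriv_factor_mset by metis
    moreover have "iter_deriv js \<phi> t = exp_integral (\<lambda>s. deriv_factor js s * ?g s) (cvec t)"
      unfolding it ..
    ultimately have "cmod (exp_integral (\<lambda>s. deriv_factor js s * ?g s) (cvec t)) \<le>
        C * h ^ mi_size \<gamma> * sqrt (mi_fact \<gamma>) * exp (- a * (norm t)\<^sup>2)"
      using bd[of \<gamma> t] by simp
    also have "mi_size \<gamma> = length js"
      using sum_count_set[of js UNIV] by (simp add: mi_size_def \<gamma>_def)
    also have "C * h ^ length js * sqrt (mi_fact \<gamma>) * exp (- a * (norm t)\<^sup>2) \<le>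
        C * h ^ length js * sqrt (fact (length js)) * exp (- a * (norm t)\<^sup>2)"
      using C h count_fact_le[of js] by (intro mult_right_mono mult_left_mono real_sqrt_le_mono) (auto simp: mi_fact_def \<gamma>_def)
    finally show "cmod (exp_integral (\<lambda>s. deriv_factor js s * ?g s) (cvec t)) \<le>
        C * exp (- a * (norm t)\<^sup>2) * (h ^ length js * sqrt (fact (length js)))" by (simp only: mult_ac)
  qed
  then show ?thesis using \<phi> by (rule that)
qed

subsection \<open>Embedding of \<open>L\<^sup>2\<close> into the dual\<close>

text \<open>Closed sets form an intersection-stable generator of the Borel sets, and the sets over
  which h integrates to 0 are stable under complements and disjoint countable unions. The complement
  step uses that the whole space is closed.\<close>

lemma set_integral_zero_of_closed:
  fixes h :: "'a::euclidean_space \<Rightarrow> complex"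
  assumes h: "integrable lborel h"
    and closed: "\<And>S. closed S \<Longrightarrow> (LINT t:S|lborel. h t) = 0"
  shows "AE t in lborel. h t = 0"
proof (rule sigma_finite_measure.density_zero[OF sigma_finite_lborel h])
  have si: "set_integrable lborel A h" if "A \<in> sets borel" for A
    using h that unfolding set_integrable_def by (intro integrable_mult_indicator) auto
  fix A :: "'a set" assume "A \<in> sets lborel"
  then have "A \<in> sigma_sets UNIV (Collect closed)"
    by (simp add: borel_eq_closed)
  then show "(LINT t:A|lborel. h t) = 0"
  proof (rule sigma_sets_induct_disjoint[rotated 2])
    show "Int_stable (Collect (closed :: 'a set \<Rightarrow> bool))"
      by (auto simp: Int_stable_def intro: closed_Int)
    fix A :: "'a set" assume "A \<in> Collect closed"
    then show "(LINT t:A|lborel. h t) = 0" using closed by simp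
  next
    fix A :: "'a set" assume A: "A \<in> sigma_sets UNIV (Collect closed)" "(LINT t:A|lborel. h t) = 0"
    then have "A \<in> sets borel" by (simp add: borel_eq_closed)
    then have "(LINT t:A \<union> (UNIV - A)|lborel. h t) = (LINT t:A|lborel. h t) + (LINT t:UNIV - A|lborel. h t)"
      by (intro set_integral_Un si) auto
    then show "(LINT t:UNIV - A|lborel. h t) = 0" using A(2) closed[of UNIV] by simp
  next
    fix B :: "nat \<Rightarrow> 'a set"
    assume B: "disjoint_family B" "range B \<subseteq> sigma_sets UNIV (Collect closed)"
      "\<And>i. (LINT t:B i|lborel. h t) = 0"
    then have m: "B i \<in> sets borel" for i by (auto simp: borel_eq_closed)
    then have "(LINT t:(\<Union>i. B i)|lborel. h t) = (\<Sum>i. (LINT t:B i|lborel. h t))"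
      using B(1) by (intro lebesgue_integral_countable_add si) (auto simp: disjoint_family_on_def)
    then show "(LINT t:(\<Union>i. B i)|lborel. h t) = 0" by (simp add: B(3))
  qed (auto simp: set_lebesgue_integral_def)
qed

lemma closed_integral_zero_of_continuous:
  fixes h :: "'a::euclidean_space \<Rightarrow> complex"
  assumes h: "integrable lborel h"
    and \<psi>: "\<And>\<psi>::'a \<Rightarrow> real. continuous_on UNIV \<psi> \<Longrightarrow> (\<And>t. \<bar>\<psi> t\<bar> \<le> 1) \<Longrightarrow> (LINT t|lborel. \<psi> t *\<^sub>R h t) = 0"
    and S: "closed S"
  shows "(LINT t:S|lborel. h t) = 0"
\<comment> \<open>\<open>infdist\<close> to the empty set is 0 by convention, so the cutoff
  functions would not tend to its indicator.\<close>
proof (cases "S = {}")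
  case False
  define \<psi> where "\<psi> n t = max 0 (1 - real n * infdist t S)" for n t
  have [measurable]: "h \<in> borel_measurable borel" using h by auto
  have c: "continuous_on UNIV (\<psi> n)" for n
    unfolding \<psi>_def by (intro continuous_intros)
  have le: "\<bar>\<psi> n t\<bar> \<le> 1" for n t
    using infdist_nonneg[of t S] by (auto simp: \<psi>_def max_def)
  have lim: "(\<lambda>n. \<psi> n t) \<longlonglongrightarrow> indicator S t" for t
  proof (cases "t \<in> S")
    case True then show ?thesis by (simp add: \<psi>_def)
  next
    case False
    then have "infdist t S > 0" using S \<open>S \<noteq> {}\<close> infdist_nonneg[of t S] in_closed_iff_infdist_zero[of S t] by auto
    then obtain N where N: "real N * infdist t S > 1" using reals_Archimedean3 by blast
    have "\<psi> n t = 0" if "n \<ge> N" for n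
    proof -
      have "real N * infdist t S \<le> real n * infdist t S"
        using that infdist_nonneg[of t S] by (intro mult_right_mono) auto
      then show ?thesis using N by (simp add: \<psi>_def)
    qed
    then have "eventually (\<lambda>n. \<psi> n t = indicator S t) sequentially"
      using False by (auto simp: eventually_sequentially)
    then show ?thesis by (rule tendsto_eventually)
  qed
  have "(\<lambda>n. LINT t|lborel. \<psi> n t *\<^sub>R h t) \<longlonglongrightarrow> (LINT t|lborel. indicator S t *\<^sub>R h t)"
  proof (rule integral_dominated_convergence[where w = "\<lambda>t. norm (h t)"])
    show "(\<lambda>t. \<psi> n t *\<^sub>R h t) \<in> borel_measurable lborel" for n
      using borel_measurable_continuous_onI[OF c[of n]] by measurable
    show "AE t in lborel. (\<lambda>n. \<psi> n t *\<^sub>R h t) \<longlonglongrightarrow> indicator S t *\<^sub>R h t"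
      by (intro AE_I2 tendsto_scaleR lim tendsto_const)
    show "AE t in lborel. norm (\<psi> n t *\<^sub>R h t) \<le> norm (h t)" for n
      by (intro AE_I2) (simp add: mult_left_le_one_le le)
  qed (use h S in \<open>auto intro!: borel_measurable_scaleR borel_measurable_indicator borel_closed\<close>)
  then show ?thesis
    using \<psi>[OF c le] by (simp add: set_lebesgue_integral_def LIMSEQ_const_iff)
qed (simp add: set_lebesgue_integral_def)

text \<open>Integrating the hypothesis against \<open>\<psi>\<close> turns the Gaussians into an approximate identity
  acting on \<open>\<psi>\<close>.\<close>

lemma AE_zero_of_gauss_convolution:
  fixes h :: "'a::euclidean_space \<Rightarrow> complex"
  assumes h: "integrable lborel h"
    and gz: "\<And>n x. (LINT t|lborel. exp (- pi * (norm (real (Suc n) *\<^sub>R (t - x)))\<^sup>2) *\<^sub>R h t) = 0"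
  shows "AE t in lborel. h t = 0"
proof (rule set_integral_zero_of_closed[OF h], rule closed_integral_zero_of_continuous[OF h])
  fix \<psi> :: "'a \<Rightarrow> real"
  assume c: "continuous_on UNIV \<psi>" and le: "\<And>t. \<bar>\<psi> t\<bar> \<le> 1"
  have [measurable]: "h \<in> borel_measurable borel" using h by auto
  have [measurable]: "\<psi> \<in> borel_measurable borel" using c by (rule borel_measurable_continuous_onI)
  define g where "g u = exp (- pi * (norm (u :: 'a))\<^sup>2)" for u
  have [measurable]: "g \<in> borel_measurable borel" unfolding g_def by measurable
  have g: "integrable lborel g" "(LINT u|lborel. g u) = 1" "g u > 0" for u
    unfolding g_def using integrable_gauss[of pi] integral_gauss_pi by auto
  have g\<psi>: "integrable lborel (\<lambda>u. \<psi> (t + c *\<^sub>R u) * g u)" for t and c :: real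
  proof (rule Bochner_Integration.integrable_bound[OF g(1)])
    show "AE u in lborel. norm (\<psi> (t + c *\<^sub>R u) * g u) \<le> norm (g u)"
      using le g(3) by (intro AE_I2) (simp add: abs_mult mult_left_le_one_le)
  qed measurable
  \<comment> \<open>The average of \<psi> around t at scale 1 / (n + 1). By Fubini its integral
    against h is a superposition of the vanishing Gaussian integrals.\<close>
  define \<Psi> where "\<Psi> n t = (LINT u|lborel. \<psi> (t + (1 / real (Suc n)) *\<^sub>R u) * g u)" for n t
  have [measurable]: "\<Psi> n \<in> borel_measurable borel" for n unfolding \<Psi>_def by measurable
  have \<Psi>le: "\<bar>\<Psi> n t\<bar> \<le> 1" for n t
  proof -
    have "norm (\<Psi> n t) \<le> (LINT u|lborel. g u)"
      unfolding \<Psi>_def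
    proof (rule Bochner_Integration.integral_norm_bound_integral[OF g\<psi> g(1)])
      show "norm (\<psi> (t + (1 / real (Suc n)) *\<^sub>R u) * g u) \<le> g u" for u
        using le g(3)[of u] by (simp add: abs_mult mult_left_le_one_le)
    qed
    then show ?thesis using g(2) by simp
  qed
  have z: "(LINT t|lborel. \<Psi> n t *\<^sub>R h t) = 0" for n
  proof -
    let ?r = "real (Suc n)"
    define k where "k t x = (\<psi> x * g (?r *\<^sub>R (t - x))) *\<^sub>R h t" for t x
    have [measurable]: "(\<lambda>(t, x). k t x) \<in> borel_measurable (lborel \<Otimes>\<^sub>M lborel)"
      unfolding k_def by measurable
    have in_k: "(LINT x|lborel. \<psi> x * g (?r *\<^sub>R (t - x))) = (1 / ?r) ^ DIM('a) * \<Psi> n t"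
      and ig_k: "integrable lborel (\<lambda>x. \<psi> x * g (?r *\<^sub>R (t - x)))" for t
    proof -
      have gm: "g (- u) = g u" for u by (simp add: g_def)
      have "(LINT x|lborel. \<psi> x * g (?r *\<^sub>R (t - x))) =
        \<bar>1 / ?r\<bar> ^ DIM('a) *\<^sub>R (LINT u|lborel. \<psi> (t + (1 / ?r) *\<^sub>R u) * g (?r *\<^sub>R (t - (t + (1 / ?r) *\<^sub>R u))))"
        by (rule integral_lborel_scaleR) auto
      then show "(LINT x|lborel. \<psi> x * g (?r *\<^sub>R (t - x))) = (1 / ?r) ^ DIM('a) * \<Psi> n t"
        by (simp add: \<Psi>_def gm del: of_nat_Suc)
      have "integrable lborel (\<lambda>x::'a. exp (- (pi * ?r\<^sup>2) * (norm x)\<^sup>2))"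
        by (rule integrable_gauss) simp
      from integrable_lborel_shift[OF this, of "- t"]
      have "integrable lborel (\<lambda>x. g (?r *\<^sub>R (t - x)))"
        by (simp add: g_def power_mult_distrib norm_minus_commute mult.assoc del: of_nat_Suc)
      then show "integrable lborel (\<lambda>x. \<psi> x * g (?r *\<^sub>R (t - x)))"
        by (rule Bochner_Integration.integrable_bound)
           (measurable, use le g(3) in \<open>auto simp: abs_mult mult_left_le_one_le\<close>)
    qed
    have "integrable (lborel \<Otimes>\<^sub>M lborel) (\<lambda>(t, x). k t x)"
    proof (rule lborel_pair.Fubini_integrable)
      define G where "G = (LINT x|lborel. g (?r *\<^sub>R x))"
      have gi: "integrable lborel (\<lambda>x. g (?r *\<^sub>R x))"
        using integrable_gauss[of "pi * ?r\<^sup>2", where 'a='a]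
        by (simp add: g_def power_mult_distrib mult.assoc del: of_nat_Suc)
      have "(LINT x|lborel. norm (k t x)) \<le> G * norm (h t)" for t
      proof -
        have gm: "g (?r *\<^sub>R (t - x)) = g (?r *\<^sub>R (x + - t))" for x
          by (simp add: g_def norm_minus_commute)
        have "(LINT x|lborel. norm (k t x)) \<le> (LINT x|lborel. g (?r *\<^sub>R (x + - t)) * norm (h t))"
        proof (rule integral_mono_AE')
          show "integrable lborel (\<lambda>x. g (?r *\<^sub>R (x + - t)) * norm (h t))"
            using integrable_lborel_shift[OF gi, of "- t"] by (rule integrable_mult_left)
          show "AE x in lborel. norm (k t x) \<le> g (?r *\<^sub>R (x + - t)) * norm (h t)"
            unfolding k_def gm using le g(3)[THEN less_imp_le]
            by (intro AE_I2) (simp add: abs_mult mult_left_le_one_le mult_right_mono del: of_nat_Suc)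
        qed (use g(3)[THEN less_imp_le] in auto)
        also have "\<dots> = G * norm (h t)"
          using integral_lborel_shift[of "\<lambda>x. g (?r *\<^sub>R x)" "- t"] by (simp add: G_def del: of_nat_Suc)
        finally show ?thesis .
      qed
      then have bd: "norm (LINT x|lborel. norm (k t x)) \<le> norm (G * norm (h t))" for t
        by (simp add: order_trans[OF _ abs_ge_self])
      have "integrable lborel (\<lambda>t. LINT x|lborel. norm (k t x))"
      proof (rule Bochner_Integration.integrable_bound)
        show "integrable lborel (\<lambda>t. G * norm (h t))" using h by simp
        show "(\<lambda>t. LINT x|lborel. norm (k t x)) \<in> borel_measurable lborel" by measurable
      qed (rule AE_I2[OF bd])
      then show "integrable lborel (\<lambda>t. LINT x|lborel. norm (case (t, x) of (t, x) \<Rightarrow> k t x))" by simp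
      show "AE t in lborel. integrable lborel (\<lambda>x. case (t, x) of (t, x) \<Rightarrow> k t x)"
        using ig_k by (intro AE_I2) (simp add: k_def)
    qed measurable
    from lborel_pair.Fubini_integral[OF this]
    have "(LINT t|lborel. LINT x|lborel. k t x) = (LINT x|lborel. LINT t|lborel. k t x)" by simp
    moreover have "(LINT t|lborel. k t x) = 0" for x
    proof -
      have "(LINT t|lborel. k t x) = \<psi> x *\<^sub>R (LINT t|lborel. g (?r *\<^sub>R (t - x)) *\<^sub>R h t)"
        unfolding k_def scaleR_scaleR[symmetric] by (rule integral_scaleR_right)
      then show ?thesis using gz[of n x] by (simp add: g_def)
    qed
    moreover have "(LINT x|lborel. k t x) = (1 / ?r) ^ DIM('a) *\<^sub>R (\<Psi> n t *\<^sub>R h t)" for t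
      unfolding k_def integral_scaleR_left[OF ig_k] in_k by simp
    ultimately have "(1 / ?r) ^ DIM('a) *\<^sub>R (LINT t|lborel. \<Psi> n t *\<^sub>R h t) = 0"
      by (simp only: integral_scaleR_right) simp
    then show ?thesis by simp
  qed
  have "(\<lambda>n. LINT t|lborel. \<Psi> n t *\<^sub>R h t) \<longlonglongrightarrow> (LINT t|lborel. \<psi> t *\<^sub>R h t)"
  proof (rule integral_dominated_convergence[where w = "\<lambda>t. norm (h t)"])
    have "(\<lambda>n. \<Psi> n t) \<longlonglongrightarrow> \<psi> t" for t
    proof -
      have "(\<lambda>n. LINT u|lborel. \<psi> (t + (1 / real (Suc n)) *\<^sub>R u) * g u) \<longlonglongrightarrow> (LINT u|lborel. \<psi> t * g u)"
      proof (rule integral_dominated_convergence[OF _ _ g(1)])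
        show "AE u in lborel. (\<lambda>n. \<psi> (t + (1 / real (Suc n)) *\<^sub>R u) * g u) \<longlonglongrightarrow> \<psi> t * g u"
        proof (intro AE_I2 tendsto_mult_right)
          fix u
          have "(\<lambda>n. t + (1 / real (Suc n)) *\<^sub>R u) \<longlonglongrightarrow> t + 0 *\<^sub>R u"
            by (intro tendsto_intros LIMSEQ_Suc[OF lim_1_over_n])
          then show "(\<lambda>n. \<psi> (t + (1 / real (Suc n)) *\<^sub>R u)) \<longlonglongrightarrow> \<psi> t"
            using c by (intro continuous_on_tendsto_compose[of UNIV \<psi>]) auto
        qed
        show "AE u in lborel. norm (\<psi> (t + (1 / real (Suc n)) *\<^sub>R u) * g u) \<le> g u" for n
          using le g(3)[THEN less_imp_le] by (intro AE_I2) (simp add: abs_mult mult_left_le_one_le)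
      qed measurable
      then show ?thesis using g(2) by (simp add: \<Psi>_def)
    qed
    then show "AE t in lborel. (\<lambda>n. \<Psi> n t *\<^sub>R h t) \<longlonglongrightarrow> \<psi> t *\<^sub>R h t"
      by (intro AE_I2 tendsto_scaleR tendsto_const)
    show "AE t in lborel. norm (\<Psi> n t *\<^sub>R h t) \<le> norm (h t)" for n
      using \<Psi>le by (intro AE_I2) (simp add: mult_left_le_one_le)
  qed (use h in auto)
  then show "(LINT t|lborel. \<psi> t *\<^sub>R h t) = 0"
    unfolding z by (simp add: LIMSEQ_const_iff)
qed

section \<open>Square-integrable classes and the bilinear pairing\<close>

lemma L2_class_eqI:
  assumes "sq_integrable f" "sq_integrable g" "AE t in lborel. f t = g t"
  shows "L2_class f = L2_class g"
  using Quotient_rel_abs[OF Quotient_L2, of f g] assms by (simp add: L2_rel_def)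

lemma L2_eqI: "(AE t in lborel. rep_L2 f t = rep_L2 g t) \<Longrightarrow> f = g"
  using L2_class_eqI[OF sq_integrable_rep_L2 sq_integrable_rep_L2] by (metis L2_class_rep_L2)

lemma rep_L2_measurable [measurable]: "rep_L2 f \<in> borel_measurable borel"
  using sq_integrable_rep_L2[of f] by (simp add: sq_integrable_def)

lemma rep_L2_add: "AE t in lborel. rep_L2 (f + g) t = rep_L2 f t + rep_L2 g t"
  using rep_L2_L2_class[OF sq_integrable_add[OF sq_integrable_rep_L2 sq_integrable_rep_L2], of f g]
  by (simp add: plus_L2_def)

lemma rep_L2_scaleC: "AE t in lborel. rep_L2 (scaleC_L2 c f) t = c * rep_L2 f t"
  using rep_L2_L2_class[OF sq_integrable_scale[OF sq_integrable_rep_L2], of c f]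
  by (simp add: scaleC_L2_def)

lemma rep_L2_scaleR: "AE t in lborel. rep_L2 (r *\<^sub>R f) t = complex_of_real r * rep_L2 f t"
  using rep_L2_L2_class[OF sq_integrable_scale[OF sq_integrable_rep_L2], of "complex_of_real r" f]
  by (simp add: scaleR_L2_def)

lemma norm_L2_rep: "norm f = sqrt (LINT t|lborel. (cmod (rep_L2 f t))\<^sup>2)"
  by (simp add: norm_L2.rep_eq)

lemma norm_L2_class:
  assumes "sq_integrable f" shows "norm (L2_class f) = sqrt (LINT t|lborel. (cmod (f t))\<^sup>2)"
proof -
  have [measurable]: "f \<in> borel_measurable borel" using assms by (simp add: sq_integrable_def)
  have "(LINT t|lborel. (cmod (rep_L2 (L2_class f) t))\<^sup>2) = (LINT t|lborel. (cmod (f t))\<^sup>2)"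
    using rep_L2_L2_class[OF assms] by (intro integral_cong_AE) auto
  then show ?thesis by (simp add: norm_L2_rep)
qed

lemma gauss_bounded_sq_integrable:
  assumes "gauss_bounded g" shows "sq_integrable g"
proof -
  obtain a C where a: "a > 0" and bd: "\<And>t. cmod (g t) \<le> C * exp (- a * (norm t)\<^sup>2)"
    and [measurable]: "g \<in> borel_measurable borel"
    using assms by (auto simp: gauss_bounded_def)
  have "integrable lborel (\<lambda>t. (cmod (g t))\<^sup>2)"
  proof (rule integrable_gauss_bound[of _ "2 * a" "C\<^sup>2"])
    fix t
    have "(cmod (g t))\<^sup>2 \<le> (C * exp (- a * (norm t)\<^sup>2))\<^sup>2" by (intro power_mono bd) simp
    also have "\<dots> = C\<^sup>2 * exp (- (2 * a) * (norm t)\<^sup>2)"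
      by (simp add: power_mult_distrib exp_double[symmetric])
    finally show "norm ((cmod (g t))\<^sup>2) \<le> C\<^sup>2 * exp (- (2 * a) * (norm t)\<^sup>2)" by simp
  qed (use a in auto)
  then show ?thesis by (simp add: sq_integrable_def)
qed

lemma sq_integrable_mult_integrable:
  assumes f: "sq_integrable f" and g: "sq_integrable g"
  shows "integrable lborel (\<lambda>t. f t * g t)"
proof (rule Bochner_Integration.integrable_bound)
  have [measurable]: "f \<in> borel_measurable borel" "g \<in> borel_measurable borel"
    using f g by (auto simp: sq_integrable_def)
  show "integrable lborel (\<lambda>t. (cmod (f t))\<^sup>2 + (cmod (g t))\<^sup>2)"
    using f g by (auto simp: sq_integrable_def)
  show "(\<lambda>t. f t * g t) \<in> borel_measurable lborel" by measurable
  have "cmod (f t) * cmod (g t) \<le> (cmod (f t))\<^sup>2 + (cmod (g t))\<^sup>2" for t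
    using sum_squares_bound[of "cmod (f t)" "cmod (g t)"]
      mult_nonneg_nonneg[OF norm_ge_zero[of "f t"] norm_ge_zero[of "g t"]] by linarith
  then show "AE t in lborel. norm (f t * g t) \<le> norm ((cmod (f t))\<^sup>2 + (cmod (g t))\<^sup>2)"
    by (simp add: norm_mult)
qed

text \<open>Complex bilinear, without conjugation, like the duality it models. Being total in
  \<phi>, it avoids the membership conditions that the restriction in \<open>of_L2\<close> carries
  along.\<close>

definition pairing :: "'d::finite L2 \<Rightarrow> (real^'d \<Rightarrow> complex) \<Rightarrow> complex" where
  "pairing f \<phi> = (LINT t|lborel. rep_L2 f t * \<phi> t)"

lemma of_L2_pairing: "\<phi> \<in> gs_space \<Longrightarrow> of_L2 f \<phi> = pairing f \<phi>"
  by (simp add: of_L2_def pairing_def)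

lemma pairing_integrable: "sq_integrable \<phi> \<Longrightarrow> integrable lborel (\<lambda>t. rep_L2 f t * \<phi> t)"
  by (rule sq_integrable_mult_integrable[OF sq_integrable_rep_L2])

lemma pairing_L2_class:
  assumes "sq_integrable f" "sq_integrable \<phi>"
  shows "pairing (L2_class f) \<phi> = (LINT t|lborel. f t * \<phi> t)"
  unfolding pairing_def
proof (rule integral_cong_AE)
  have [measurable]: "f \<in> borel_measurable borel" "\<phi> \<in> borel_measurable borel"
    using assms by (auto simp: sq_integrable_def)
  show "(\<lambda>t. rep_L2 (L2_class f) t * \<phi> t) \<in> borel_measurable lborel"
    "(\<lambda>t. f t * \<phi> t) \<in> borel_measurable lborel" by measurable
  show "AE t in lborel. rep_L2 (L2_class f) t * \<phi> t = f t * \<phi> t"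
    using rep_L2_L2_class[OF assms(1)] by auto
qed

lemma pairing_diff:
  assumes "sq_integrable \<phi>" shows "pairing (f - g) \<phi> = pairing f \<phi> - pairing g \<phi>"
proof -
  have [measurable]: "\<phi> \<in> borel_measurable borel" using assms by (auto simp: sq_integrable_def)
  have "pairing f \<phi> = pairing ((f - g) + g) \<phi>" by simp
  also have "\<dots> = (LINT t|lborel. rep_L2 (f - g) t * \<phi> t + rep_L2 g t * \<phi> t)"
    unfolding pairing_def
  proof (rule integral_cong_AE)
    show "AE t in lborel. rep_L2 (f - g + g) t * \<phi> t = rep_L2 (f - g) t * \<phi> t + rep_L2 g t * \<phi> t"
      using rep_L2_add[of "f - g" g] by (auto simp: distrib_right)
  qed measurable
  also have "\<dots> = pairing (f - g) \<phi> + pairing g \<phi>"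
    unfolding pairing_def by (intro Bochner_Integration.integral_add pairing_integrable assms)
  finally show ?thesis by simp
qed

text \<open>A substitute for Cauchy--Schwarz, by the arithmetic-geometric mean with weight A = norm
  f. It serves continuity in f, so what counts is that the bound is linear in norm f.\<close>

lemma pairing_bound:
  assumes \<phi>: "sq_integrable \<phi>"
  shows "cmod (pairing f \<phi>) \<le> norm f * ((1 + (LINT t|lborel. (cmod (\<phi> t))\<^sup>2)) / 2)"
proof (cases "f = 0")
  case True
  have [measurable]: "\<phi> \<in> borel_measurable borel" using \<phi> by (simp add: sq_integrable_def)
  have "AE t in lborel. rep_L2 f t = 0"
    using rep_L2_L2_class[OF sq_integrable_0] True by (simp add: zero_L2_def)
  then have "pairing f \<phi> = 0"
    unfolding pairing_def by (intro integral_eq_zero_AE) auto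
  then show ?thesis using True by simp
next
  case False
  define A where "A = norm f"
  have A: "A > 0" using False by (simp add: A_def)
  have A2: "(LINT t|lborel. (cmod (rep_L2 f t))\<^sup>2) = A\<^sup>2" by (simp add: A_def norm_L2_rep)
  have i: "integrable lborel (\<lambda>t. (cmod (rep_L2 f t))\<^sup>2)" "integrable lborel (\<lambda>t. (cmod (\<phi> t))\<^sup>2)"
    using sq_integrable_rep_L2[of f] \<phi> by (auto simp: sq_integrable_def)
  have "cmod (pairing f \<phi>) \<le> (LINT t|lborel. ((cmod (rep_L2 f t))\<^sup>2 / A + A * (cmod (\<phi> t))\<^sup>2) / 2)"
    unfolding pairing_def
  proof (rule Bochner_Integration.integral_norm_bound_integral[OF pairing_integrable[OF \<phi>]])
    fix t
    have "0 \<le> (cmod (rep_L2 f t) - A * cmod (\<phi> t))\<^sup>2 / A" using A by simp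
    also have "\<dots> = (cmod (rep_L2 f t))\<^sup>2 / A + A * (cmod (\<phi> t))\<^sup>2 - 2 * (cmod (rep_L2 f t) * cmod (\<phi> t))"
      using A by (simp add: field_simps power2_eq_square)
    finally show "norm (rep_L2 f t * \<phi> t) \<le> ((cmod (rep_L2 f t))\<^sup>2 / A + A * (cmod (\<phi> t))\<^sup>2) / 2"
      by (simp add: norm_mult)
  qed (use i in auto)
  also have "\<dots> = (A\<^sup>2 / A + A * (LINT t|lborel. (cmod (\<phi> t))\<^sup>2)) / 2"
    using i by (simp add: A2)
  also have "\<dots> = A * ((1 + (LINT t|lborel. (cmod (\<phi> t))\<^sup>2)) / 2)"
    using A by (simp add: power2_eq_square field_simps)
  finally show ?thesis by (simp add: A_def)
qed

lemma gs_space_gauss_bounded: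
  assumes "\<phi> \<in> gs_space" shows "gauss_bounded \<phi>"
proof -
  obtain \<Phi> where "gs_entire \<Phi>" "\<phi> = (\<lambda>t. \<Phi> (cvec t))" by (rule gs_space_imp_gs_entire[OF assms])
  then show ?thesis using gs_entire_gauss_bounded by simp
qed

lemma gs_space_sq_integrable: "\<phi> \<in> gs_space \<Longrightarrow> sq_integrable \<phi>"
  by (intro gauss_bounded_sq_integrable gs_space_gauss_bounded)

lemma gs_space_lincomb:
  assumes "\<phi> \<in> gs_space" "\<psi> \<in> gs_space"
  shows "(\<lambda>t. a * \<phi> t + b * \<psi> t) \<in> gs_space"
proof -
  obtain \<Phi> where \<Phi>: "gs_entire \<Phi>" "\<phi> = (\<lambda>t. \<Phi> (cvec t))" by (rule gs_space_imp_gs_entire[OF assms(1)])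
  obtain \<Psi> where \<Psi>: "gs_entire \<Psi>" "\<psi> = (\<lambda>t. \<Psi> (cvec t))" by (rule gs_space_imp_gs_entire[OF assms(2)])
  show ?thesis unfolding \<Phi>(2) \<Psi>(2)
    by (rule gs_entire_imp_gs_space[OF gs_entire_add[OF gs_entire_scale[OF \<Phi>(1)] gs_entire_scale[OF \<Psi>(1)]]])
qed

lemma gs_space_add: "\<phi> \<in> gs_space \<Longrightarrow> \<psi> \<in> gs_space \<Longrightarrow> (\<lambda>t. \<phi> t + \<psi> t) \<in> gs_space"
  using gs_space_lincomb[of \<phi> \<psi> 1 1] by simp

lemma gs_space_scale: "\<phi> \<in> gs_space \<Longrightarrow> (\<lambda>t. c * \<phi> t) \<in> gs_space"
  using gs_space_lincomb[of \<phi> \<phi> c 0] by simp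

section \<open>Continuity for the inductive-limit topology\<close>

lemma gs_nhd0_gs_space: "gs_nhd0 gs_space"
  unfolding gs_nhd0_def
proof (intro conjI ballI allI impI)
  show "\<exists>\<epsilon>>0. \<forall>\<phi>\<in>gs_banach h. gs_norm h \<phi> < ennreal \<epsilon> \<longrightarrow> \<phi> \<in> gs_space" if "h > 0" for h
    using that by (intro exI[of _ 1]) (auto simp: gs_space_def)
qed (auto intro: gs_space_lincomb)

lemma topspace_gs_topology: "topspace gs_topology = gs_space"
proof
  show "topspace gs_topology \<subseteq> gs_space"
    unfolding topspace_def openin_gs_topology gs_open_def by auto
  have "gs_open gs_space"
    unfolding gs_open_def using gs_nhd0_gs_space gs_space_add by blast
  then show "gs_space \<subseteq> topspace gs_topology"
    using openin_subset[of gs_topology gs_space] by (simp add: openin_gs_topology)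
qed

lemma multi_deriv_0: "multi_deriv 0 \<phi> = \<phi>"
proof -
  obtain js where js: "multi_deriv 0 \<phi> = iter_deriv js \<phi>" "\<And>j. count_list js j = 0 $ j"
    by (rule multi_deriv_iter) (rule that)
  have "j \<notin> set js" for j using js(2)[of j] by (simp add: count_list_0_iff)
  then have "js = []" by (cases js) auto
  then show ?thesis using js(1) by simp
qed

lemma pairing_lincomb:
  assumes "sq_integrable \<phi>" "sq_integrable \<psi>"
  shows "pairing f (\<lambda>t. a * \<phi> t + b * \<psi> t) = a * pairing f \<phi> + b * pairing f \<psi>"
proof -
  have "pairing f (\<lambda>t. a * \<phi> t + b * \<psi> t) = (LINT t|lborel. a * (rep_L2 f t * \<phi> t) + b * (rep_L2 f t * \<psi> t))"
    by (simp add: pairing_def algebra_simps)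
  also have "\<dots> = a * pairing f \<phi> + b * pairing f \<psi>"
    using pairing_integrable[OF assms(1)] pairing_integrable[OF assms(2)] by (simp add: pairing_def)
  finally show ?thesis .
qed

text \<open>The norm dominates \<phi> pointwise by N times a Gaussian \<open>w\<close> depending
  only on h, and |f| w is integrable since both factors are square integrable.\<close>

lemma pairing_gs_norm_bound:
  fixes f :: "'d::finite L2"
  assumes h: "h > 0"
  obtains K where "K \<ge> 0"
    "\<And>\<phi> N. \<phi> \<in> gs_banach h \<Longrightarrow> N \<ge> 0 \<Longrightarrow> gs_norm h \<phi> \<le> ennreal N \<Longrightarrow> cmod (pairing f \<phi>) \<le> K * N"
proof -
  define w where "w t = 2 ^ CARD('d) * exp (- (1 / (4 * h\<^sup>2)) * (norm (t::real^'d))\<^sup>2)" for t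
  have w: "w t > 0" for t by (simp add: w_def)
  have "gauss_bounded (\<lambda>t. complex_of_real (w t))"
    unfolding gauss_bounded_def
  proof (intro conjI exI allI)
    show "(\<lambda>t. complex_of_real (w t)) \<in> borel_measurable borel" unfolding w_def by measurable
    show "1 / (4 * h\<^sup>2) > 0" using h by simp
    show "cmod (complex_of_real (w t)) \<le> 2 ^ CARD('d) * exp (- (1 / (4 * h\<^sup>2)) * (norm t)\<^sup>2)" for t
      using w[of t] by (simp only: norm_of_real abs_of_pos) (simp add: w_def)
  qed
  from integrable_norm[OF pairing_integrable[OF gauss_bounded_sq_integrable[OF this], of f]]
  have i: "integrable lborel (\<lambda>t. cmod (rep_L2 f t) * w t)" using w[THEN less_imp_le] by (simp add: norm_mult)
  show ?thesis
  proof (rule that[of "LINT t|lborel. cmod (rep_L2 f t) * w t"])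
    show "0 \<le> (LINT t|lborel. cmod (rep_L2 f t) * w t)" using w[THEN less_imp_le] by simp
    fix \<phi> :: "real^'d \<Rightarrow> complex" and N :: real
    assume \<phi>: "\<phi> \<in> gs_banach h" and N: "N \<ge> 0" "gs_norm h \<phi> \<le> ennreal N"
    have "\<phi> \<in> gs_space" using \<phi> h by (auto simp: gs_space_def)
    then have s: "sq_integrable \<phi>" by (rule gs_space_sq_integrable)
    have "cmod (pairing f \<phi>) \<le> (LINT t|lborel. (cmod (rep_L2 f t) * w t) * N)"
      unfolding pairing_def
    proof (rule Bochner_Integration.integral_norm_bound_integral[OF pairing_integrable[OF s]])
      fix t
      have "cmod (\<phi> t) \<le> w t * N"
        using gs_norm_gauss_bound[OF h N(2) N(1), of 0 t]
        by (simp add: multi_deriv_0 mi_size_def mi_fact_def w_def mult_ac)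
      then show "norm (rep_L2 f t * \<phi> t) \<le> (cmod (rep_L2 f t) * w t) * N"
        unfolding norm_mult mult.assoc by (rule mult_left_mono) simp
    qed (use i in auto)
    then show "cmod (pairing f \<phi>) \<le> (LINT t|lborel. cmod (rep_L2 f t) * w t) * N" by simp
  qed
qed

lemma gs_nhd0_pairing:
  assumes d: "\<delta> > 0" shows "gs_nhd0 {\<phi> \<in> gs_space. cmod (pairing f \<phi>) < \<delta>}"
  unfolding gs_nhd0_def
proof (intro conjI ballI allI impI)
  fix \<phi> \<psi> a b
  assume \<phi>: "\<phi> \<in> {\<phi> \<in> gs_space. cmod (pairing f \<phi>) < \<delta>}" and \<psi>: "\<psi> \<in> {\<phi> \<in> gs_space. cmod (pairing f \<phi>) < \<delta>}"
    and ab: "cmod a + cmod b \<le> 1"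
  have "cmod (pairing f (\<lambda>t. a * \<phi> t + b * \<psi> t)) \<le> cmod a * cmod (pairing f \<phi>) + cmod b * cmod (pairing f \<psi>)"
    using \<phi> \<psi> norm_triangle_ineq[of "a * pairing f \<phi>" "b * pairing f \<psi>"]
    by (simp add: pairing_lincomb gs_space_sq_integrable norm_mult)
  also have "\<dots> \<le> (cmod a + cmod b) * max (cmod (pairing f \<phi>)) (cmod (pairing f \<psi>))"
    unfolding distrib_right by (intro add_mono mult_left_mono) auto
  also have "\<dots> \<le> 1 * max (cmod (pairing f \<phi>)) (cmod (pairing f \<psi>))"
    by (intro mult_right_mono ab) (simp add: le_max_iff_disj)
  also have "\<dots> < \<delta>" using \<phi> \<psi> by simp
  finally show "(\<lambda>t. a * \<phi> t + b * \<psi> t) \<in> {\<phi> \<in> gs_space. cmod (pairing f \<phi>) < \<delta>}"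
    using \<phi> \<psi> by (simp add: gs_space_lincomb)
next
  fix h :: real assume h: "h > 0"
  obtain K where K: "K \<ge> 0"
    "\<And>\<phi> N. \<phi> \<in> gs_banach h \<Longrightarrow> N \<ge> 0 \<Longrightarrow> gs_norm h \<phi> \<le> ennreal N \<Longrightarrow> cmod (pairing f \<phi>) \<le> K * N"
    by (rule pairing_gs_norm_bound[OF h, of f]) (rule that)
  \<comment> \<open>The 1 in K + 1 covers K = 0 and makes the final inequality strict.\<close>
  have "cmod (pairing f \<phi>) < \<delta>" if "\<phi> \<in> gs_banach h" "gs_norm h \<phi> < ennreal (\<delta> / (K + 1))" for \<phi>
  proof -
    have "cmod (pairing f \<phi>) \<le> K * (\<delta> / (K + 1))"
      using that d K(1) by (intro K(2)) auto
    also have "\<dots> < \<delta>" using d K(1) by (simp add: field_simps)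
    finally show ?thesis .
  qed
  then show "\<exists>\<epsilon>>0. \<forall>\<phi>\<in>gs_banach h. gs_norm h \<phi> < ennreal \<epsilon> \<longrightarrow> \<phi> \<in> {\<phi> \<in> gs_space. cmod (pairing f \<phi>) < \<delta>}"
    using d K(1) h by (intro exI[of _ "\<delta> / (K + 1)"]) (auto simp: gs_space_def)
qed auto

lemma of_L2_gs_dual: "of_L2 f \<in> gs_dual"
  unfolding gs_dual_def
proof (intro CollectI conjI ballI allI)
  show "of_L2 f \<in> extensional gs_space" by (simp add: of_L2_def)
  fix \<phi> \<psi> :: "real^'a \<Rightarrow> complex" assume \<phi>: "\<phi> \<in> gs_space" and \<psi>: "\<psi> \<in> gs_space"
  show "of_L2 f (\<lambda>t. \<phi> t + \<psi> t) = of_L2 f \<phi> + of_L2 f \<psi>"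
    using pairing_lincomb[OF gs_space_sq_integrable[OF \<phi>] gs_space_sq_integrable[OF \<psi>], of f 1 1] \<phi> \<psi>
    by (simp add: of_L2_pairing gs_space_add)
next
  fix c and \<phi> :: "real^'a \<Rightarrow> complex" assume \<phi>: "\<phi> \<in> gs_space"
  show "of_L2 f (\<lambda>t. c * \<phi> t) = c * of_L2 f \<phi>"
    using pairing_lincomb[OF gs_space_sq_integrable[OF \<phi>] gs_space_sq_integrable[OF \<phi>], of f c 0] \<phi>
    by (simp add: of_L2_pairing gs_space_scale)
next
  show "continuous_map gs_topology euclidean (of_L2 f)"
    unfolding continuous_map_def
  proof (intro conjI allI impI)
    fix U :: "complex set" assume "openin euclidean U"
    then have U: "open U" by simp
    show "openin gs_topology {\<phi> \<in> topspace gs_topology. of_L2 f \<phi> \<in> U}"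
      unfolding openin_gs_topology topspace_gs_topology gs_open_def
    proof (intro conjI ballI)
      fix \<phi> assume "\<phi> \<in> {\<phi> \<in> gs_space. of_L2 f \<phi> \<in> U}"
      then have \<phi>: "\<phi> \<in> gs_space" "pairing f \<phi> \<in> U" by (auto simp: of_L2_pairing)
      then obtain \<delta> where d: "\<delta> > 0" "ball (pairing f \<phi>) \<delta> \<subseteq> U" by (auto elim: openE[OF U])
      have "(\<lambda>t. \<phi> t + \<psi> t) \<in> {\<phi> \<in> gs_space. of_L2 f \<phi> \<in> U}"
        if \<psi>: "\<psi> \<in> {\<phi> \<in> gs_space. cmod (pairing f \<phi>) < \<delta>}" for \<psi>
      proof -
        have "pairing f (\<lambda>t. \<phi> t + \<psi> t) = pairing f \<phi> + pairing f \<psi>"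
          using pairing_lincomb[OF gs_space_sq_integrable[OF \<phi>(1)] gs_space_sq_integrable[of \<psi>], of f 1 1] \<psi> by simp
        then have "pairing f (\<lambda>t. \<phi> t + \<psi> t) \<in> ball (pairing f \<phi>) \<delta>" using \<psi> by (simp add: dist_norm)
        then show ?thesis using d(2) \<phi>(1) \<psi> by (auto simp: gs_space_add of_L2_pairing)
      qed
      then show "\<exists>V. gs_nhd0 V \<and> (\<forall>\<psi>\<in>V. (\<lambda>t. \<phi> t + \<psi> t) \<in> {\<phi> \<in> gs_space. of_L2 f \<phi> \<in> U})"
        using gs_nhd0_pairing[OF d(1), of f] by blast
    qed auto
  qed auto
qed

text \<open>A product of two real Gaussians is the restriction of an entire one, so every Gaussian
  average of (f - g) exp (- pi |t|^2) is a pairing with a test function and vanishes.\<close>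

lemma of_L2_inject:
  assumes "of_L2 f = of_L2 g" shows "f = g"
proof -
  define k where "k = rep_L2 (f - g)"
  have pz: "pairing (f - g) (\<lambda>t. \<Phi> (cvec t)) = 0" if "gs_entire \<Phi>" for \<Phi>
    using fun_cong[OF assms, of "\<lambda>t. \<Phi> (cvec t)"] gs_entire_imp_gs_space[OF that]
    by (simp add: of_L2_pairing pairing_diff gs_space_sq_integrable)
  \<comment> \<open>The Gaussian weight makes the square-integrable difference integrable and,
    having no zeros, loses no information.\<close>
  define h where "h t = k t * complex_of_real (exp (- pi * (norm t)\<^sup>2))" for t
  have "gauss_bounded (\<lambda>t::real^'a. complex_of_real (exp (- pi * (norm t)\<^sup>2)))"
    unfolding gauss_bounded_def by (intro conjI exI[of _ pi] exI[of _ 1]) auto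
  then have h: "integrable lborel h"
    unfolding h_def[abs_def] k_def by (intro pairing_integrable gauss_bounded_sq_integrable)
  have "AE t in lborel. h t = 0"
  proof (rule AE_zero_of_gauss_convolution[OF h])
    fix n :: nat and x :: "real^'a"
    let ?r = "real (Suc n)"
    \<comment> \<open>After expanding |t - x|^2 the linear term exp (2 pi r^2 x.t) is a modulation
      with the imaginary frequency - i r^2 x.\<close>
    let ?\<Phi> = "\<lambda>z::complex^'a. exp (2 * pi * \<i> * (((- \<i> * complex_of_real (?r\<^sup>2)) *s cvec x) \<bullet>\<^sub>c z)) *
        exp (- complex_of_real (pi + pi * ?r\<^sup>2) * (z \<bullet>\<^sub>c z))"
    have E: "gs_entire ?\<Phi>" by (intro gs_entire_modulation gs_entire_gauss) (simp add: add_pos_nonneg)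
    have "exp (- pi * (norm (?r *\<^sub>R (t - x)))\<^sup>2) *\<^sub>R h t = complex_of_real (exp (- pi * ?r\<^sup>2 * (norm x)\<^sup>2)) * (k t * ?\<Phi> (cvec t))" for t
    proof -
      have N: "(norm (?r *\<^sub>R (t - x)))\<^sup>2 = ?r\<^sup>2 * ((norm t)\<^sup>2 - 2 * (x \<bullet> t) + (norm x)\<^sup>2)"
        unfolding norm_scaleR power_mult_distrib
        by (simp add: power2_norm_eq_inner inner_simps inner_commute del: of_nat_Suc)
      have "complex_of_real (exp (- pi * (norm (?r *\<^sub>R (t - x)))\<^sup>2)) * complex_of_real (exp (- pi * (norm t)\<^sup>2)) =
          complex_of_real (exp (- pi * ?r\<^sup>2 * (norm x)\<^sup>2)) * complex_of_real (exp (2 * pi * ?r\<^sup>2 * (x \<bullet> t)) * exp (- (pi + pi * ?r\<^sup>2) * (norm t)\<^sup>2))"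
        unfolding of_real_mult[symmetric] exp_add[symmetric] N by (simp add: algebra_simps del: of_nat_Suc)
      moreover have "?\<Phi> (cvec t) = complex_of_real (exp (2 * pi * ?r\<^sup>2 * (x \<bullet> t)) * exp (- (pi + pi * ?r\<^sup>2) * (norm t)\<^sup>2))"
        unfolding gauss_cvec of_real_mult[of "exp _"]
        by (simp add: bdot_simps exp_of_real[symmetric] mult_ac del: of_nat_Suc)
      ultimately show ?thesis unfolding h_def scaleR_conv_of_real[where 'a=complex]
        by (simp only: mult_ac)
    qed
    then have "(LINT t|lborel. exp (- pi * (norm (?r *\<^sub>R (t - x)))\<^sup>2) *\<^sub>R h t) =
        complex_of_real (exp (- pi * ?r\<^sup>2 * (norm x)\<^sup>2)) * pairing (f - g) (\<lambda>t. ?\<Phi> (cvec t))"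
      unfolding pairing_def k_def by (simp only: integral_mult_right_zero)
    then show "(LINT t|lborel. exp (- pi * (norm (?r *\<^sub>R (t - x)))\<^sup>2) *\<^sub>R h t) = 0"
      using pz[OF E] by simp
  qed
  then have "AE t in lborel. rep_L2 (f - g) t = 0" by (simp add: h_def k_def)
  moreover have "AE t in lborel. rep_L2 (0 :: 'a L2) t = 0"
    using rep_L2_L2_class[OF sq_integrable_0] by (simp add: zero_L2_def)
  ultimately have "f - g = 0" by (intro L2_eqI) auto
  then show ?thesis by simp
qed

subsection \<open>Weighted composition operators\<close>

lemma L2_class_add:
  assumes "sq_integrable u" "sq_integrable v"
  shows "L2_class (\<lambda>t. u t + v t) = L2_class u + L2_class v"
proof (rule L2_eqI)
  show "AE t in lborel. rep_L2 (L2_class (\<lambda>t. u t + v t)) t = rep_L2 (L2_class u + L2_class v) t"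
    using rep_L2_L2_class[OF sq_integrable_add[OF assms]] rep_L2_L2_class[OF assms(1)]
      rep_L2_L2_class[OF assms(2)] rep_L2_add[of "L2_class u" "L2_class v"] by eventually_elim simp
qed

lemma L2_class_scaleC:
  assumes "sq_integrable u" shows "L2_class (\<lambda>t. c * u t) = scaleC_L2 c (L2_class u)"
proof (rule L2_eqI)
  show "AE t in lborel. rep_L2 (L2_class (\<lambda>t. c * u t)) t = rep_L2 (scaleC_L2 c (L2_class u)) t"
    using rep_L2_L2_class[OF sq_integrable_scale[OF assms]] rep_L2_L2_class[OF assms]
      rep_L2_scaleC[of c "L2_class u"] by eventually_elim simp
qed

lemma scaleR_L2_scaleC: "r *\<^sub>R f = scaleC_L2 (complex_of_real r) f"
  by (rule L2_eqI) (use rep_L2_scaleR[of r f] rep_L2_scaleC[of "complex_of_real r" f] in eventually_elim, simp)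

text \<open>Chirps, dilations and real Schroedinger operators are all of the form f |-> m (f o g).
  By \<open>distr_g\<close>, composition with g preserves null sets and multiplies integrals by
  \<open>\<kappa>\<close>, which yields independence of the representative and boundedness at
  once.\<close>

locale weighted_composition =
  fixes m :: "real^'d::finite \<Rightarrow> complex" and g :: "real^'d \<Rightarrow> real^'d" and M \<kappa> :: real
  assumes m [measurable]: "m \<in> borel_measurable borel" and m_le: "\<And>t. cmod (m t) \<le> M"
    and g [measurable]: "g \<in> borel_measurable borel" and \<kappa>: "\<kappa> > 0"
    and distr_g: "distr lborel borel g = density lborel (\<lambda>_. ennreal \<kappa>)"
begin

definition wc_op :: "'d L2 \<Rightarrow> 'd L2" where
  "wc_op f = L2_class (\<lambda>t. m t * rep_L2 f (g t))"

lemma AE_comp: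
  assumes [measurable]: "u \<in> borel_measurable borel" "v \<in> borel_measurable borel"
    and "AE t in lborel. u t = (v t :: complex)"
  shows "AE t in lborel. u (g t) = v (g t)"
proof -
  have "AE t in distr lborel borel g. u t = v t"
    unfolding distr_g using assms(3) by (subst AE_density) auto
  then show ?thesis by (subst (asm) AE_distr_iff) auto
qed

lemma integrable_comp:
  fixes u :: "real^'d \<Rightarrow> 'b::{banach, second_countable_topology}"
  assumes u: "integrable lborel u"
  shows "integrable lborel (\<lambda>t. u (g t))"
proof -
  have [measurable]: "u \<in> borel_measurable borel" using u by auto
  have "integrable (distr lborel borel g) u"
    unfolding distr_g using u \<kappa> by (subst integrable_density) auto
  then show ?thesis by (subst (asm) integrable_distr_eq) auto
qed

lemma integral_comp:
  fixes u :: "real^'d \<Rightarrow> 'b::{banach, second_countable_topology}"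
  assumes [measurable]: "u \<in> borel_measurable borel"
  shows "(LINT t|lborel. u (g t)) = \<kappa> *\<^sub>R (LINT t|lborel. u t)"
proof -
  have "(LINT t|lborel. u (g t)) = (LINT t|distr lborel borel g. u t)"
    by (subst integral_distr) auto
  also have "\<dots> = \<kappa> *\<^sub>R (LINT t|lborel. u t)"
    unfolding distr_g using \<kappa> by (subst integral_density) auto
  finally show ?thesis .
qed

lemma wc_pointwise: "(cmod (m t * u (g t)))\<^sup>2 \<le> M\<^sup>2 * (cmod (u (g t)))\<^sup>2"
  unfolding norm_mult power_mult_distrib by (intro mult_right_mono power_mono m_le) auto

lemma sq_integrable_comp:
  assumes "sq_integrable u" shows "sq_integrable (\<lambda>t. m t * u (g t))"
proof -
  have [measurable]: "u \<in> borel_measurable borel" and i: "integrable lborel (\<lambda>t. (cmod (u t))\<^sup>2)"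
    using assms by (auto simp: sq_integrable_def)
  have "integrable lborel (\<lambda>t. (cmod (m t * u (g t)))\<^sup>2)"
  proof (rule Bochner_Integration.integrable_bound)
    show "integrable lborel (\<lambda>t. M\<^sup>2 * (cmod (u (g t)))\<^sup>2)"
      by (intro integrable_mult_right integrable_comp[OF i])
    show "AE t in lborel. norm ((cmod (m t * u (g t)))\<^sup>2) \<le> norm (M\<^sup>2 * (cmod (u (g t)))\<^sup>2)"
      using wc_pointwise[of _ u] by (intro AE_I2) simp
  qed measurable
  then show ?thesis by (simp add: sq_integrable_def)
qed

lemma wc_op_L2_class:
  assumes u: "sq_integrable u"
  shows "wc_op (L2_class u) = L2_class (\<lambda>t. m t * u (g t))"
  unfolding wc_op_def
proof (rule L2_class_eqI[OF sq_integrable_comp[OF sq_integrable_rep_L2] sq_integrable_comp[OF u]])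
  show "AE t in lborel. m t * rep_L2 (L2_class u) (g t) = m t * u (g t)"
    using AE_comp[OF _ _ rep_L2_L2_class[OF u]] u by (auto simp: sq_integrable_def)
qed

lemma wc_op_bounded: "wc_op \<in> bounded_ops"
proof -
  have sc: "wc_op (scaleC_L2 c f) = scaleC_L2 c (wc_op f)" for c f
  proof -
    have "wc_op (scaleC_L2 c f) = wc_op (L2_class (\<lambda>t. c * rep_L2 f t))"
      by (simp add: L2_class_scaleC sq_integrable_rep_L2 L2_class_rep_L2)
    also have "\<dots> = L2_class (\<lambda>t. c * (m t * rep_L2 f (g t)))"
      by (simp add: wc_op_L2_class sq_integrable_scale sq_integrable_rep_L2 mult.left_commute)
    also have "\<dots> = scaleC_L2 c (wc_op f)"
      unfolding wc_op_def by (rule L2_class_scaleC[OF sq_integrable_comp[OF sq_integrable_rep_L2]])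
    finally show ?thesis .
  qed
  have "bounded_linear wc_op"
  proof (rule bounded_linear_intro)
    fix f h :: "'d L2" and r :: real
    have "wc_op (f + h) = wc_op (L2_class (\<lambda>t. rep_L2 f t + rep_L2 h t))"
      by (simp add: L2_class_add sq_integrable_rep_L2 L2_class_rep_L2)
    also have "\<dots> = L2_class (\<lambda>t. m t * rep_L2 f (g t) + m t * rep_L2 h (g t))"
      by (simp add: wc_op_L2_class sq_integrable_add sq_integrable_rep_L2 distrib_left)
    also have "\<dots> = wc_op f + wc_op h"
      unfolding wc_op_def
      by (rule L2_class_add[OF sq_integrable_comp[OF sq_integrable_rep_L2] sq_integrable_comp[OF sq_integrable_rep_L2]])
    finally show "wc_op (f + h) = wc_op f + wc_op h" .
    show "wc_op (r *\<^sub>R f) = r *\<^sub>R wc_op f" by (simp add: scaleR_L2_scaleC sc)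
    have i: "integrable lborel (\<lambda>t. (cmod (rep_L2 f t))\<^sup>2)"
      using sq_integrable_rep_L2[of f] by (simp add: sq_integrable_def)
    have "(LINT t|lborel. (cmod (m t * rep_L2 f (g t)))\<^sup>2) \<le> (LINT t|lborel. M\<^sup>2 * (cmod (rep_L2 f (g t)))\<^sup>2)"
      using sq_integrable_comp[OF sq_integrable_rep_L2[of f]]
      by (intro integral_mono integrable_mult_right integrable_comp i wc_pointwise)
         (auto simp: sq_integrable_def)
    also have "\<dots> = M\<^sup>2 * \<kappa> * (LINT t|lborel. (cmod (rep_L2 f t))\<^sup>2)"
      using integral_comp[of "\<lambda>t. (cmod (rep_L2 f t))\<^sup>2"] by simp
    finally have "norm (wc_op f) \<le> sqrt (M\<^sup>2 * \<kappa> * (LINT t|lborel. (cmod (rep_L2 f t))\<^sup>2))"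
      unfolding wc_op_def norm_L2_class[OF sq_integrable_comp[OF sq_integrable_rep_L2]]
      by (rule real_sqrt_le_mono)
    then show "norm (wc_op f) \<le> norm f * sqrt (M\<^sup>2 * \<kappa>)"
      by (simp add: norm_L2_rep real_sqrt_mult mult.commute)
  qed
  then show ?thesis using sc by (simp add: bounded_ops_def)
qed

lemma pairing_wc_op:
  assumes "sq_integrable \<phi>"
  shows "pairing (wc_op f) \<phi> = (LINT t|lborel. m t * rep_L2 f (g t) * \<phi> t)"
  unfolding wc_op_def
  by (rule pairing_L2_class[OF sq_integrable_comp[OF sq_integrable_rep_L2] assms])

end

section \<open>Boundedness of the generators and of real phase-space shifts\<close>

lemma bounded_ops_comp: "A \<in> bounded_ops \<Longrightarrow> B \<in> bounded_ops \<Longrightarrow> A \<circ> B \<in> bounded_ops"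
  by (auto simp: bounded_ops_def intro: bounded_linear_compose simp: comp_def)

lemma density_lborel_1: "density lborel (\<lambda>_. ennreal 1) = lborel"
  by (simp add: density_1)

lemma chirp_weighted_composition:
  fixes Q :: "complex^'d^'d"
  assumes "im_nonneg Q"
  shows "weighted_composition (\<lambda>t. exp (\<i> * pi * ((Q *v cvec t) \<bullet>\<^sub>c cvec t))) (\<lambda>t. t) 1 1"
proof
  show "(\<lambda>t. exp (\<i> * pi * ((Q *v cvec t) \<bullet>\<^sub>c cvec t))) \<in> borel_measurable borel"
    unfolding bdot_def matrix_vector_mult_def by (intro borel_measurable_continuous_onI continuous_intros)
  fix t
  have "Re_vec (Q *v cvec t) = map_matrix Re Q *v t" "Im_vec (Q *v cvec t) = map_matrix Im Q *v t"
    by (simp_all add: vec_eq_iff matrix_vector_mult_def map_matrix_def)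
  then have "Im ((Q *v cvec t) \<bullet>\<^sub>c cvec t) \<ge> 0"
    using assms by (simp add: bdot_Im im_nonneg_def)
  then show "cmod (exp (\<i> * pi * ((Q *v cvec t) \<bullet>\<^sub>c cvec t))) \<le> 1"
    by (simp add: norm_exp_eq_Re)
next
  show "distr lborel borel (\<lambda>t. t) = density lborel (\<lambda>_. ennreal 1)"
    unfolding density_lborel_1 by (rule distr_id2) simp
qed auto

lemma invertible_linear_distr:
  fixes E :: "real^'d^'d"
  assumes "invertible E"
  obtains \<kappa> where "\<kappa> > 0" "distr lborel borel ((*v) E) = density lborel (\<lambda>_. ennreal \<kappa>)"
proof -
  have "bij ((*v) E)" using assms by (simp add: invertible_eq_bij)
  then obtain \<kappa> where \<kappa>: "\<kappa> > 0" "\<And>f. f \<in> borel_measurable borel \<Longrightarrow>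
      (\<integral>\<^sup>+t. f (E *v t) \<partial>lborel) = ennreal \<kappa> * (\<integral>\<^sup>+t. f t \<partial>lborel)"
    using nn_integral_lborel_linear[of "(*v) E"] matrix_vector_mul_linear[of E] by metis
  have [measurable]: "(*v) E \<in> borel_measurable borel"
    by (intro borel_measurable_continuous_onI matrix_vector_mult_linear_continuous_on)
  have "distr lborel borel ((*v) E) = density lborel (\<lambda>_. ennreal \<kappa>)"
  proof (rule measure_eqI)
    fix A assume "A \<in> sets (distr lborel borel ((*v) E))"
    then have A [measurable]: "A \<in> sets borel" by simp
    have "emeasure (distr lborel borel ((*v) E)) A = (\<integral>\<^sup>+t. indicator A t \<partial>distr lborel borel ((*v) E))"
      by simp
    also have "\<dots> = (\<integral>\<^sup>+t. indicator A (E *v t) \<partial>lborel)"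
      by (subst nn_integral_distr) auto
    also have "\<dots> = ennreal \<kappa> * emeasure lborel A" by (subst \<kappa>(2)) auto
    finally show "emeasure (distr lborel borel ((*v) E)) A = emeasure (density lborel (\<lambda>_. ennreal \<kappa>)) A"
      by (simp add: emeasure_density_const)
  qed simp
  then show ?thesis using \<kappa>(1) that by blast
qed

lemma dilation_weighted_composition:
  fixes E :: "real^'d^'d"
  assumes "invertible E"
  obtains \<kappa> where "weighted_composition (\<lambda>t. \<i> powi m * complex_of_real (sqrt \<bar>det E\<bar>)) ((*v) E) (sqrt \<bar>det E\<bar>) \<kappa>"
proof -
  obtain \<kappa> where \<kappa>: "\<kappa> > 0" "distr lborel borel ((*v) E) = density lborel (\<lambda>_. ennreal \<kappa>)"
    by (rule invertible_linear_distr[OF assms])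
  have "weighted_composition (\<lambda>t. \<i> powi m * complex_of_real (sqrt \<bar>det E\<bar>)) ((*v) E) (sqrt \<bar>det E\<bar>) \<kappa>"
  proof
    show "(*v) E \<in> borel_measurable borel"
      by (intro borel_measurable_continuous_onI matrix_vector_mult_linear_continuous_on)
  qed (use \<kappa> in \<open>auto simp: norm_mult norm_power_int\<close>)
  then show ?thesis by (rule that)
qed

lemma schrodinger_weighted_composition:
  fixes x \<xi> :: "real^'d" and \<tau> :: real
  shows "weighted_composition (\<lambda>t. exp (2 * pi * \<i> * \<tau>) * exp (- (\<i> * pi * complex_of_real (x \<bullet> \<xi>))) *
       exp (2 * pi * \<i> * complex_of_real (\<xi> \<bullet> t))) (\<lambda>t. t - x) 1 1"
proof
  show "(\<lambda>t. exp (2 * pi * \<i> * \<tau>) * exp (- (\<i> * pi * complex_of_real (x \<bullet> \<xi>))) *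
       exp (2 * pi * \<i> * complex_of_real (\<xi> \<bullet> t))) \<in> borel_measurable borel" by measurable
  show "cmod (exp (2 * pi * \<i> * \<tau>) * exp (- (\<i> * pi * complex_of_real (x \<bullet> \<xi>))) *
       exp (2 * pi * \<i> * complex_of_real (\<xi> \<bullet> t))) \<le> 1" for t
    by (simp add: norm_mult norm_exp_eq_Re)
  show "distr lborel borel (\<lambda>t. t - x) = density lborel (\<lambda>_. ennreal 1)"
  proof -
    have "(\<lambda>t. t - x) = (+) (- x)" by auto
    then show ?thesis unfolding density_lborel_1 using lborel_distr_plus[of "- x"] by simp
  qed
qed auto

lemma chirp_op_bounded:
  assumes "im_nonneg Q" shows "chirp_op Q \<in> bounded_ops"
proof -
  interpret weighted_composition "\<lambda>t. exp (\<i> * pi * ((Q *v cvec t) \<bullet>\<^sub>c cvec t))" "\<lambda>t. t" 1 1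
    by (rule chirp_weighted_composition[OF assms])
  show ?thesis using wc_op_bounded by (simp add: wc_op_def[abs_def] chirp_op_def[abs_def])
qed

lemma dilation_op_bounded:
  assumes "invertible E" shows "dilation_op E m \<in> bounded_ops"
proof -
  obtain \<kappa> where "weighted_composition (\<lambda>t. \<i> powi m * complex_of_real (sqrt \<bar>det E\<bar>)) ((*v) E) (sqrt \<bar>det E\<bar>) \<kappa>"
    by (rule dilation_weighted_composition[OF assms])
  then interpret weighted_composition "\<lambda>t. \<i> powi m * complex_of_real (sqrt \<bar>det E\<bar>)" "(*v) E" "sqrt \<bar>det E\<bar>" \<kappa> .
  show ?thesis using wc_op_bounded by (simp add: wc_op_def[abs_def] dilation_op_def[abs_def])
qed

lemma schrodinger_L2_bounded: "schrodinger_L2 z \<tau> \<in> bounded_ops"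
proof -
  interpret weighted_composition "\<lambda>t. exp (2 * pi * \<i> * \<tau>) * exp (- (\<i> * pi * complex_of_real (fst_part z \<bullet> snd_part z))) *
       exp (2 * pi * \<i> * complex_of_real (snd_part z \<bullet> t))" "\<lambda>t. t - fst_part z" 1 1
    by (rule schrodinger_weighted_composition)
  have "schrodinger_L2 z \<tau> = wc_op"
    by (rule ext) (simp only: wc_op_def schrodinger_L2_def Let_def)
  then show ?thesis using wc_op_bounded by simp
qed

lemma Mp_plus_bounded: "A \<in> Mp_plus \<Longrightarrow> A \<in> bounded_ops"
proof (induction rule: Mp_plus.induct)
  case (gen A S)
  then show ?case
    by cases (auto simp: is_fourier_L2_def dilation_op_bounded chirp_op_bounded)
qed (rule bounded_ops_comp)

subsection \<open>Intertwining relations for the generators\<close>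

text \<open>The action on entire test functions dual to \<open>\<rho>(w;\<tau>)\<close>.\<close>

definition schrodinger_test ::
    "complex^('d::finite + 'd) \<Rightarrow> real \<Rightarrow> (complex^'d \<Rightarrow> complex) \<Rightarrow> complex^'d \<Rightarrow> complex" where
  "schrodinger_test w \<tau> \<Phi> z = exp (2 * pi * \<i> * \<tau>) * exp (- (\<i> * pi * (fst_part w \<bullet>\<^sub>c snd_part w))) *
     (exp (2 * pi * \<i> * (snd_part w \<bullet>\<^sub>c (z + fst_part w))) * \<Phi> (z + fst_part w))"

lemma gs_entire_schrodinger_test:
  assumes "gs_entire \<Phi>" shows "gs_entire (schrodinger_test w \<tau> \<Phi>)"
  unfolding schrodinger_test_def[abs_def]
  by (rule gs_entire_scale[OF gs_entire_translate[OF gs_entire_modulation[OF assms]]])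

lemma pairing_scale: "pairing f (\<lambda>t. c * \<phi> t) = c * pairing f \<phi>"
  unfolding pairing_def by (simp add: mult.left_commute[of _ c])

text \<open>Transposition reverses the product of modulation and translation: the test function is
  first modulated by \<xi>, then translated by + x. Each intermediate function must lie in
  \<open>gs_space\<close>, to which the extended operators are restricted.\<close>

lemma schrodinger_dual_of_L2:
  assumes "gs_entire \<Phi>"
  shows "schrodinger_dual w \<tau> (of_L2 f) (\<lambda>t. \<Phi> (cvec t)) = pairing f (\<lambda>t. schrodinger_test w \<tau> \<Phi> (cvec t))"
proof -
  let ?x = "fst_part w" and ?\<xi> = "snd_part w"
  let ?\<Psi> = "\<lambda>z. exp (2 * pi * \<i> * (?\<xi> \<bullet>\<^sub>c z)) * \<Phi> z"
  have \<Psi>: "gs_entire ?\<Psi>" by (rule gs_entire_modulation[OF assms])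
  have "mod_fun ?\<xi> (\<lambda>t. \<Phi> (cvec t)) = (\<lambda>t. ?\<Psi> (cvec t))" by (simp add: mod_fun_def[abs_def])
  moreover have "trans_fun (- ?x) (\<lambda>t. ?\<Psi> (cvec t)) = (\<lambda>t. ?\<Psi> (cvec t + ?x))"
    by (rule ext, subst trans_fun_gs_entire[OF \<Psi>]) simp
  moreover note gs_entire_imp_gs_space[OF assms] gs_entire_imp_gs_space[OF \<Psi>]
    gs_entire_imp_gs_space[OF gs_entire_translate[OF \<Psi>, of ?x]]
  ultimately show ?thesis
    by (simp add: schrodinger_dual_def Let_def mod_dual_def trans_dual_def of_L2_pairing
        schrodinger_test_def pairing_scale)
qed

lemma functional_eqI:
  assumes "u \<in> extensional gs_space" "v \<in> extensional gs_space"
    and "\<And>\<Phi>. gs_entire \<Phi> \<Longrightarrow> u (\<lambda>t. \<Phi> (cvec t)) = v (\<lambda>t. \<Phi> (cvec t))"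
  shows "u = v"
proof (rule extensionalityI[OF assms(1,2)])
  fix \<phi> :: "real^'a \<Rightarrow> complex" assume "\<phi> \<in> gs_space"
  then obtain \<Phi> where "gs_entire \<Phi>" "\<phi> = (\<lambda>t. \<Phi> (cvec t))" by (rule gs_space_imp_gs_entire)
  then show "u \<phi> = v \<phi>" using assms(3) by simp
qed

lemma schrodinger_dual_extensional: "schrodinger_dual w \<tau> u \<in> extensional gs_space"
  by (simp add: schrodinger_dual_def Let_def)

lemma of_L2_extensional: "of_L2 f \<in> extensional gs_space"
  by (simp add: of_L2_def)

definition intertwines ::
    "('d::finite L2 \<Rightarrow> 'd L2) \<Rightarrow> complex^('d + 'd)^('d + 'd) \<Rightarrow> bool" where
  "intertwines A S \<longleftrightarrow> (\<forall>f g w \<tau>. schrodinger_dual w \<tau> (of_L2 f) = of_L2 g \<longrightarrow>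
     schrodinger_dual (S *v w) \<tau> (of_L2 (A f)) = of_L2 (A g))"

text \<open>\<open>At\<close> is the transpose of A for the bilinear pairing and
  \<open>schrodinger_test w \<tau>\<close> that of rho(w). Transposing A rho(w) = rho(S w) A
  reverses the products, which explains the order of the operators in \<open>C\<close>.\<close>

lemma intertwinesI:
  fixes A :: "'d::finite L2 \<Rightarrow> 'd L2"
  assumes E: "\<And>\<Phi>. gs_entire \<Phi> \<Longrightarrow> gs_entire (At \<Phi>)"
    and P: "\<And>f \<Phi>. gs_entire \<Phi> \<Longrightarrow> pairing (A f) (\<lambda>t. \<Phi> (cvec t)) = pairing f (\<lambda>t. At \<Phi> (cvec t))"
    and C: "\<And>w \<tau> \<Phi> z. gs_entire \<Phi> \<Longrightarrow> schrodinger_test w \<tau> (At \<Phi>) z = At (schrodinger_test (S *v w) \<tau> \<Phi>) z"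
  shows "intertwines A S"
  unfolding intertwines_def
proof (intro allI impI)
  fix f g :: "'d L2" and w :: "complex^('d + 'd)" and \<tau> :: real
  assume eq: "schrodinger_dual w \<tau> (of_L2 f) = of_L2 g"
  show "schrodinger_dual (S *v w) \<tau> (of_L2 (A f)) = of_L2 (A g)"
  proof (rule functional_eqI[OF schrodinger_dual_extensional of_L2_extensional])
    fix \<Phi> :: "complex^'d \<Rightarrow> complex" assume \<Phi>: "gs_entire \<Phi>"
    have "schrodinger_dual (S *v w) \<tau> (of_L2 (A f)) (\<lambda>t. \<Phi> (cvec t)) =
        pairing f (\<lambda>t. At (schrodinger_test (S *v w) \<tau> \<Phi>) (cvec t))"
      by (simp add: schrodinger_dual_of_L2 \<Phi> P gs_entire_schrodinger_test)
    also have "\<dots> = schrodinger_dual w \<tau> (of_L2 f) (\<lambda>t. At \<Phi> (cvec t))"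
      by (simp add: schrodinger_dual_of_L2 E \<Phi> C[OF \<Phi>])
    also have "\<dots> = pairing g (\<lambda>t. At \<Phi> (cvec t))"
      unfolding eq by (rule of_L2_pairing[OF gs_entire_imp_gs_space[OF E[OF \<Phi>]]])
    also have "\<dots> = of_L2 (A g) (\<lambda>t. \<Phi> (cvec t))"
      by (simp add: P[OF \<Phi>] of_L2_pairing[OF gs_entire_imp_gs_space[OF \<Phi>]])
    finally show "schrodinger_dual (S *v w) \<tau> (of_L2 (A f)) (\<lambda>t. \<Phi> (cvec t)) = of_L2 (A g) (\<lambda>t. \<Phi> (cvec t))" .
  qed
qed

text \<open>The conclusion for B at w is the premise for A at the point
  \<open>R *v w\<close>.\<close>

lemma intertwines_comp:
  assumes "intertwines A S" "intertwines B R" shows "intertwines (A \<circ> B) (S ** R)"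
  using assms unfolding intertwines_def comp_def matrix_vector_mul_assoc[symmetric] by blast

lemma sum_UNIV_Plus:
  "(\<Sum>i\<in>(UNIV::('a::finite + 'b::finite) set). f i) = (\<Sum>i\<in>UNIV. f (Inl i)) + (\<Sum>i\<in>UNIV. f (Inr i))"
  unfolding UNIV_Plus_UNIV[symmetric] by (subst sum.Plus) (auto simp: comp_def)

lemma block_matrix_vector:
  "fst_part (block_matrix A B C D *v w) = A *v fst_part w + B *v snd_part w"
  "snd_part (block_matrix A B C D *v w) = C *v fst_part w + D *v snd_part w"
  by (simp_all add: vec_eq_iff fst_part_def snd_part_def matrix_vector_mult_def block_matrix_def sum_UNIV_Plus)

lemma bdot_matrix_transpose: "(A *v x) \<bullet>\<^sub>c y = x \<bullet>\<^sub>c (transpose A *v y)"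
proof -
  have "(A *v x) \<bullet>\<^sub>c y = (\<Sum>i\<in>UNIV. \<Sum>j\<in>UNIV. A $ i $ j * x $ j * y $ i)"
    by (simp add: bdot_def matrix_vector_mult_def sum_distrib_right)
  also have "\<dots> = (\<Sum>j\<in>UNIV. \<Sum>i\<in>UNIV. A $ i $ j * x $ j * y $ i)"
    by (rule sum.swap)
  also have "\<dots> = x \<bullet>\<^sub>c (transpose A *v y)"
    by (simp add: bdot_def matrix_vector_mult_def transpose_def sum_distrib_left mult_ac)
  finally show ?thesis .
qed

text \<open>A multiplication operator is its own transpose. Expanding the quadratic form at z + x,
  symmetry of Q merges the two mixed terms into modulation by Q x, and the constant (Q x).x accounts
  for the change in the phase x.\<xi>.\<close>

lemma intertwines_chirp:
  fixes Q :: "complex^'d^'d"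
  assumes Q: "transpose Q = Q" "im_nonneg Q"
  shows "intertwines (chirp_op Q) (block_matrix (mat 1) 0 Q (mat 1))"
proof (rule intertwinesI[where At = "\<lambda>\<Phi> z. exp (\<i> * pi * ((Q *v z) \<bullet>\<^sub>c z)) * \<Phi> z"])
  fix \<Phi> :: "complex^'d \<Rightarrow> complex" assume \<Phi>: "gs_entire \<Phi>"
  show "gs_entire (\<lambda>z. exp (\<i> * pi * ((Q *v z) \<bullet>\<^sub>c z)) * \<Phi> z)"
    by (rule gs_entire_multiplier[OF tame_exp_quadratic[OF Q(2)] \<Phi>])
  interpret weighted_composition "\<lambda>t. exp (\<i> * pi * ((Q *v cvec t) \<bullet>\<^sub>c cvec t))" "\<lambda>t. t" 1 1
    by (rule chirp_weighted_composition[OF Q(2)])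
  have c: "chirp_op Q = wc_op" by (rule ext) (simp only: chirp_op_def wc_op_def)
  show "pairing (chirp_op Q f) (\<lambda>t. \<Phi> (cvec t)) =
      pairing f (\<lambda>t. exp (\<i> * pi * ((Q *v cvec t) \<bullet>\<^sub>c cvec t)) * \<Phi> (cvec t))" for f
    unfolding c by (subst pairing_wc_op[OF gs_space_sq_integrable[OF gs_entire_imp_gs_space[OF \<Phi>]]])
      (simp only: pairing_def mult_ac)
  fix w :: "complex^('d + 'd)" and \<tau> z
  define x \<xi> where "x = fst_part w" and "\<xi> = snd_part w"
  have S: "fst_part (block_matrix (mat 1) 0 Q (mat 1) *v w) = x"
    "snd_part (block_matrix (mat 1) 0 Q (mat 1) *v w) = Q *v x + \<xi>"
    by (simp_all add: block_matrix_vector x_def \<xi>_def)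
  have sym: "(Q *v z) \<bullet>\<^sub>c x = (Q *v x) \<bullet>\<^sub>c z"
    unfolding bdot_matrix_transpose[of Q z] Q(1) by (rule bdot_commute)
  have "- (\<i> * pi * (x \<bullet>\<^sub>c \<xi>)) + (2 * pi * \<i> * (\<xi> \<bullet>\<^sub>c (z + x)) + \<i> * pi * ((Q *v (z + x)) \<bullet>\<^sub>c (z + x))) =
      \<i> * pi * ((Q *v z) \<bullet>\<^sub>c z) + (- (\<i> * pi * (x \<bullet>\<^sub>c (Q *v x + \<xi>))) + 2 * pi * \<i> * ((Q *v x + \<xi>) \<bullet>\<^sub>c (z + x)))"
    by (simp add: matrix_vector_right_distrib bdot_simps sym bdot_commute[of x "Q *v x"] algebra_simps)
  then have e: "exp (- (\<i> * pi * (x \<bullet>\<^sub>c \<xi>))) * (exp (2 * pi * \<i> * (\<xi> \<bullet>\<^sub>c (z + x))) * exp (\<i> * pi * ((Q *v (z + x)) \<bullet>\<^sub>c (z + x)))) =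
      exp (\<i> * pi * ((Q *v z) \<bullet>\<^sub>c z)) * (exp (- (\<i> * pi * (x \<bullet>\<^sub>c (Q *v x + \<xi>)))) * exp (2 * pi * \<i> * ((Q *v x + \<xi>) \<bullet>\<^sub>c (z + x))))"
    unfolding exp_add[symmetric] by simp
  show "schrodinger_test w \<tau> (\<lambda>z. exp (\<i> * pi * ((Q *v z) \<bullet>\<^sub>c z)) * \<Phi> z) z =
      exp (\<i> * pi * ((Q *v z) \<bullet>\<^sub>c z)) * schrodinger_test (block_matrix (mat 1) 0 Q (mat 1) *v w) \<tau> \<Phi> z"
    unfolding schrodinger_test_def S x_def[symmetric] \<xi>_def[symmetric]
    using arg_cong[OF e, of "\<lambda>u. exp (2 * pi * \<i> * \<tau>) * u * \<Phi> (z + x)"] by (simp only: mult_ac)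
qed

text \<open>The transpose of composition with E is composition with its inverse, times the scaling
  factor \<kappa> of the measure. The phases match because (E^T \<xi>).(E^-1 y) = \<xi>.y.\<close>

lemma intertwines_dilation:
  fixes E :: "real^'d^'d"
  assumes E: "invertible E"
  shows "intertwines (dilation_op E m)
      (block_matrix (map_matrix complex_of_real (matrix_inv E)) 0
                    0 (map_matrix complex_of_real (transpose E)))" (is "intertwines _ ?S")
proof -
  define G where "G = matrix_inv E"
  have EG: "E ** G = mat 1" "G ** E = mat 1" unfolding G_def matrix_inv_def
    using someI_ex[OF E[unfolded invertible_def]] by auto
  then have iG: "invertible G" by (auto simp: invertible_def)
  define c where "c = \<i> powi m * complex_of_real (sqrt \<bar>det E\<bar>)"
  obtain \<kappa> where "weighted_composition (\<lambda>t. \<i> powi m * complex_of_real (sqrt \<bar>det E\<bar>)) ((*v) E) (sqrt \<bar>det E\<bar>) \<kappa>"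
    by (rule dilation_weighted_composition[OF E])
  then interpret weighted_composition "\<lambda>t. c" "(*v) E" "sqrt \<bar>det E\<bar>" \<kappa> unfolding c_def .
  have d: "dilation_op E m = wc_op" by (rule ext, simp only: wc_op_def, simp only: dilation_op_def c_def)
  let ?G = "map_matrix complex_of_real G"
  show ?thesis
  proof (rule intertwinesI[where At = "\<lambda>\<Phi> z. (complex_of_real \<kappa> * c) * \<Phi> (?G *v z)"])
    fix \<Phi> :: "complex^'d \<Rightarrow> complex" assume \<Phi>: "gs_entire \<Phi>"
    have L: "gs_entire (\<lambda>z. \<Phi> (?G *v z))" by (rule gs_entire_linear[OF \<Phi> iG])
    then show "gs_entire (\<lambda>z. (complex_of_real \<kappa> * c) * \<Phi> (?G *v z))" by (rule gs_entire_scale)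
    show "pairing (dilation_op E m f) (\<lambda>t. \<Phi> (cvec t)) =
        pairing f (\<lambda>t. (complex_of_real \<kappa> * c) * \<Phi> (?G *v cvec t))" for f
    proof -
      have [measurable]: "(\<lambda>t. \<Phi> (?G *v cvec t)) \<in> borel_measurable borel"
        using gs_entire_measurable[OF L, of 0] by simp
      have "G *v (E *v t) = t" for t by (simp add: matrix_vector_mul_assoc EG)
      then have "pairing (wc_op f) (\<lambda>t. \<Phi> (cvec t)) =
          (LINT t|lborel. c * rep_L2 f (E *v t) * \<Phi> (?G *v cvec (E *v t)))"
        unfolding pairing_wc_op[OF gs_space_sq_integrable[OF gs_entire_imp_gs_space[OF \<Phi>]]]
        by (simp add: cvec_matrix[symmetric])
      also have "\<dots> = \<kappa> *\<^sub>R (LINT t|lborel. c * rep_L2 f t * \<Phi> (?G *v cvec t))"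
        by (rule integral_comp) measurable
      also have "\<dots> = pairing f (\<lambda>t. (complex_of_real \<kappa> * c) * \<Phi> (?G *v cvec t))"
        unfolding pairing_scale by (simp add: pairing_def scaleR_conv_of_real mult.assoc)
      finally show ?thesis unfolding d .
    qed
    fix w :: "complex^('d + 'd)" and \<tau> z
    define x \<xi> where "x = fst_part w" and "\<xi> = snd_part w"
    let ?T = "map_matrix complex_of_real (transpose E)"
    have S: "fst_part (?S *v w) = ?G *v x" "snd_part (?S *v w) = ?T *v \<xi>"
      by (simp_all add: block_matrix_vector x_def \<xi>_def G_def)
    have "map_matrix complex_of_real E *v (?G *v y) = y" for y
    proof -
      have "map_matrix complex_of_real E ** ?G = map_matrix complex_of_real (E ** G)"
        by (simp add: vec_eq_iff matrix_matrix_mult_def map_matrix_def)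
      also have "\<dots> = mat 1" unfolding EG by (simp add: vec_eq_iff map_matrix_def mat_def)
      finally show ?thesis by (simp add: matrix_vector_mul_assoc)
    qed
    moreover have "transpose ?T = map_matrix complex_of_real E"
      by (simp add: vec_eq_iff map_matrix_def transpose_def)
    ultimately have T: "(?T *v \<xi>) \<bullet>\<^sub>c (?G *v y) = \<xi> \<bullet>\<^sub>c y" for y
      by (simp add: bdot_matrix_transpose)
    have T': "(?G *v x) \<bullet>\<^sub>c (?T *v \<xi>) = x \<bullet>\<^sub>c \<xi>"
      using T[of x] by (simp add: bdot_commute)
    show "schrodinger_test w \<tau> (\<lambda>z. (complex_of_real \<kappa> * c) * \<Phi> (?G *v z)) z =
        (complex_of_real \<kappa> * c) * schrodinger_test (?S *v w) \<tau> \<Phi> (?G *v z)"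
      unfolding schrodinger_test_def S x_def[symmetric] \<xi>_def[symmetric] T'
        matrix_vector_right_distrib[symmetric] T by (simp only: mult_ac)
  qed
qed

text \<open>\<open>is_fourier_L2\<close> prescribes the operator only on functions that are both
  integrable and square integrable; cutting off to balls approximates any class by such
  functions.\<close>

lemma L2_truncation_tendsto:
  fixes f :: "'d::finite L2"
  defines "u n t \<equiv> indicator (cball 0 (real n)) t * rep_L2 f t"
  shows "sq_integrable (u n)" "integrable lborel (u n)" "(\<lambda>n. norm (f - L2_class (u n))) \<longlonglongrightarrow> 0"
proof -
  have i: "integrable lborel (\<lambda>t. (cmod (rep_L2 f t))\<^sup>2)"
    using sq_integrable_rep_L2[of f] by (simp add: sq_integrable_def)
  have ind: "sq_integrable (\<lambda>t::real^'d. indicator (cball 0 (real n)) t)" for n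
  proof -
    have "integrable lborel (\<lambda>t::real^'d. indicator (cball 0 (real n)) t :: real)"
      using emeasure_bounded_finite[OF bounded_cball, of "0::real^'d" "real n"] by simp
    moreover have "(cmod (indicator (cball 0 (real n)) t))\<^sup>2 = indicator (cball 0 (real n)) t" for t :: "real^'d"
      by (simp add: indicator_def)
    moreover have "indicator (cball 0 (real n)) \<in> borel_measurable (borel :: (real^'d) measure)"
      by (intro borel_measurable_indicator) simp
    ultimately show ?thesis by (simp add: sq_integrable_def)
  qed
  show "integrable lborel (u n)" for n
    unfolding u_def by (rule sq_integrable_mult_integrable[OF ind sq_integrable_rep_L2])
  have le: "(cmod (rep_L2 f t - u n t))\<^sup>2 \<le> (cmod (rep_L2 f t))\<^sup>2" "(cmod (u n t))\<^sup>2 \<le> (cmod (rep_L2 f t))\<^sup>2" for n t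
    by (simp_all add: u_def indicator_def)
  have [measurable]: "u n \<in> borel_measurable borel" for n
    unfolding u_def by (intro borel_measurable_times borel_measurable_indicator rep_L2_measurable) simp
  show sq: "sq_integrable (u n)" for n
    unfolding sq_integrable_def
  proof
    show "integrable lborel (\<lambda>t. (cmod (u n t))\<^sup>2)"
      by (rule Bochner_Integration.integrable_bound[OF i]) (measurable, use le in auto)
  qed simp
  have sd: "sq_integrable (\<lambda>t. rep_L2 f t - u n t)" for n
    using sq_integrable_add[OF sq_integrable_rep_L2[of f] sq_integrable_scale[OF sq, of "- 1"]] by simp
  have "L2_class (\<lambda>t. (rep_L2 f t - u n t) + u n t) = L2_class (\<lambda>t. rep_L2 f t - u n t) + L2_class (u n)" for n
    by (rule L2_class_add[OF sd sq])
  then have "f - L2_class (u n) = L2_class (\<lambda>t. rep_L2 f t - u n t)" for n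
    by (simp add: L2_class_rep_L2 algebra_simps)
  then have eq: "norm (f - L2_class (u n)) = sqrt (LINT t|lborel. (cmod (rep_L2 f t - u n t))\<^sup>2)" for n
    by (simp add: norm_L2_class[OF sd])
  have "(\<lambda>n. LINT t|lborel. (cmod (rep_L2 f t - u n t))\<^sup>2) \<longlonglongrightarrow> (LINT t::real^'d|lborel. 0)"
  proof (rule integral_dominated_convergence[OF _ _ i])
    show "AE t in lborel. (\<lambda>n. (cmod (rep_L2 f t - u n t))\<^sup>2) \<longlonglongrightarrow> 0"
    proof (intro AE_I2 tendsto_eventually)
      fix t :: "real^'d"
      obtain N where "norm t \<le> real N" using real_arch_simple by blast
      then have "(cmod (rep_L2 f t - u n t))\<^sup>2 = 0" if "n \<ge> N" for n
        using that by (simp add: u_def indicator_def)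
      then show "eventually (\<lambda>n. (cmod (rep_L2 f t - u n t))\<^sup>2 = 0) sequentially"
        unfolding eventually_sequentially by blast
    qed
    show "AE t in lborel. norm ((cmod (rep_L2 f t - u n t))\<^sup>2) \<le> (cmod (rep_L2 f t))\<^sup>2" for n
      using le(1) by (intro AE_I2) simp
  qed measurable
  then have "(\<lambda>n. sqrt (LINT t|lborel. (cmod (rep_L2 f t - u n t))\<^sup>2)) \<longlonglongrightarrow> sqrt 0"
    by (intro tendsto_real_sqrt) simp
  then show "(\<lambda>n. norm (f - L2_class (u n))) \<longlonglongrightarrow> 0" by (simp add: eq)
qed

lemma pairing_tendsto:
  assumes \<phi>: "sq_integrable \<phi>" and X: "(\<lambda>n. norm (f - X n)) \<longlonglongrightarrow> 0"
  shows "(\<lambda>n. pairing (X n) \<phi>) \<longlonglongrightarrow> pairing f \<phi>"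
proof -
  let ?K = "(1 + (LINT t|lborel. (cmod (\<phi> t))\<^sup>2)) / 2"
  have "(\<lambda>n. pairing f \<phi> - pairing (X n) \<phi>) \<longlonglongrightarrow> 0"
  proof (rule Lim_null_comparison)
    show "eventually (\<lambda>n. norm (pairing f \<phi> - pairing (X n) \<phi>) \<le> norm (f - X n) * ?K) sequentially"
      unfolding pairing_diff[OF \<phi>, symmetric] by (intro always_eventually allI pairing_bound[OF \<phi>])
    show "(\<lambda>n. norm (f - X n) * ?K) \<longlonglongrightarrow> 0" using tendsto_mult_right[OF X, of ?K] by simp
  qed
  from tendsto_diff[OF tendsto_const[of "pairing f \<phi>"] this] show ?thesis by simp
qed

text \<open>The multiplication formula for Fourier integrals says that the transform is symmetric
  for the pairing. It holds on truncations and passes to the limit, as F is bounded and the pairing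
  is continuous in its L2 argument.\<close>

lemma pairing_fourier_L2:
  fixes F :: "'d::finite L2 \<Rightarrow> 'd L2"
  assumes F: "is_fourier_L2 F" and \<Phi>: "gs_entire \<Phi>"
  shows "pairing (F f) (\<lambda>t. \<Phi> (cvec t)) =
    pairing f (\<lambda>t. \<i> powr (- (of_nat CARD('d) / 2)) * cfourier \<Phi> (cvec t))"
proof -
  let ?c = "\<i> powr (- (of_nat CARD('d) / 2))"
  let ?\<phi> = "\<lambda>t. \<Phi> (cvec t)" and ?\<psi> = "\<lambda>t. ?c * cfourier \<Phi> (cvec t)"
  have \<phi>: "sq_integrable ?\<phi>" "integrable lborel ?\<phi>"
    using gauss_bounded_sq_integrable gauss_bounded_integrable gs_entire_gauss_bounded[OF \<Phi>] by auto
  have \<psi>: "sq_integrable ?\<psi>"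
    by (rule gauss_bounded_sq_integrable[OF gs_entire_gauss_bounded[OF gs_entire_scale[OF gs_entire_cfourier[OF \<Phi>]]]])
  define u where "u n t = indicator (cball 0 (real n)) t * rep_L2 f t" for n :: nat and t
  have u: "sq_integrable (u n)" "integrable lborel (u n)" and lim: "(\<lambda>n. norm (f - L2_class (u n))) \<longlonglongrightarrow> 0" for n
    using L2_truncation_tendsto[where f = f] by (simp_all add: u_def[abs_def])
  have FL: "F (L2_class (u n)) = L2_class (\<lambda>\<xi>. ?c * fourier (u n) \<xi>)" "sq_integrable (fourier (u n))" for n
    using F u by (auto simp: is_fourier_L2_def)
  have bl: "bounded_linear F" using F by (simp add: is_fourier_L2_def bounded_ops_def)
  have eq: "pairing (F (L2_class (u n))) ?\<phi> = pairing (L2_class (u n)) ?\<psi>" for n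
  proof -
    have "pairing (F (L2_class (u n))) ?\<phi> = (LINT t|lborel. ?c * fourier (u n) t * ?\<phi> t)"
      unfolding FL by (rule pairing_L2_class[OF sq_integrable_scale[OF FL(2)] \<phi>(1)])
    also have "\<dots> = ?c * (LINT t|lborel. fourier (u n) t * ?\<phi> t)"
      by (simp add: mult.assoc)
    also have "(LINT t|lborel. fourier (u n) t * ?\<phi> t) = (LINT t|lborel. u n t * fourier ?\<phi> t)"
      by (rule fourier_pairing[OF u(2) \<phi>(2)])
    also have "?c * \<dots> = (LINT t|lborel. u n t * ?\<psi> t)"
      by (simp add: fourier_cvec mult.left_commute[of _ ?c])
    also have "\<dots> = pairing (L2_class (u n)) ?\<psi>"
      by (rule pairing_L2_class[OF u(1) \<psi>, symmetric])
    finally show ?thesis .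
  qed
  have "(\<lambda>n. norm (F f - F (L2_class (u n)))) \<longlonglongrightarrow> 0"
  proof -
    have "(\<lambda>n. f - L2_class (u n)) \<longlonglongrightarrow> 0" using lim by (rule tendsto_norm_zero_cancel)
    from bounded_linear.tendsto_zero[OF bl this]
    show ?thesis unfolding linear_diff[OF bounded_linear.linear[OF bl]] by (rule tendsto_norm_zero)
  qed
  from pairing_tendsto[OF \<phi>(1) this] have "(\<lambda>n. pairing (L2_class (u n)) ?\<psi>) \<longlonglongrightarrow> pairing (F f) ?\<phi>"
    unfolding eq .
  from LIMSEQ_unique[OF this pairing_tendsto[OF \<psi> lim]] show ?thesis .
qed

text \<open>Modulation turns into translation in frequency directly under the integral; complex
  translation turns into modulation by \<open>cfourier_translate\<close>. J exchanges x and \<xi>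
  with one sign accordingly.\<close>

lemma intertwines_fourier:
  fixes F :: "'d::finite L2 \<Rightarrow> 'd L2"
  assumes F: "is_fourier_L2 F"
  shows "intertwines F J_mat"
proof (rule intertwinesI[where At = "\<lambda>\<Phi> z. \<i> powr (- (of_nat CARD('d) / 2)) * cfourier \<Phi> z"])
  let ?c = "\<i> powr (- (of_nat CARD('d) / 2))"
  fix \<Phi> :: "complex^'d \<Rightarrow> complex" assume \<Phi>: "gs_entire \<Phi>"
  show "gs_entire (\<lambda>z. ?c * cfourier \<Phi> z)" by (rule gs_entire_scale[OF gs_entire_cfourier[OF \<Phi>]])
  show "pairing (F f) (\<lambda>t. \<Phi> (cvec t)) = pairing f (\<lambda>t. ?c * cfourier \<Phi> (cvec t))" for f
    by (rule pairing_fourier_L2[OF F \<Phi>])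
  fix w :: "complex^('d + 'd)" and \<tau> :: real and z
  define x \<xi> where "x = fst_part w" and "\<xi> = snd_part w"
  have minus: "(- mat 1) *v v = - v" for v :: "complex^'d"
    using matrix_vector_mult_diff_rdistrib[of 0 "mat 1" v] by simp
  have S: "fst_part (J_mat *v w) = \<xi>" "snd_part (J_mat *v w) = - x"
    by (simp_all add: J_mat_def block_matrix_vector x_def \<xi>_def minus)
  let ?a = "exp (2 * pi * \<i> * \<tau>)"
  let ?\<Psi> = "\<lambda>z. exp (2 * pi * \<i> * (- x \<bullet>\<^sub>c z)) * \<Phi> z"
  have cs: "cfourier (\<lambda>z. k * \<Theta> z) z = k * cfourier \<Theta> z" for k \<Theta> and z :: "complex^'d"
    unfolding cfourier_def by (simp add: mult.left_commute[of _ k])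
  have mod: "cfourier ?\<Psi> z = cfourier \<Phi> (z + x)"
    unfolding cfourier_def mult.assoc[symmetric] exp_add[symmetric]
    by (simp add: bdot_simps algebra_simps)
  have "cfourier (schrodinger_test (J_mat *v w) \<tau> \<Phi>) z =
      ?a * exp (- (\<i> * pi * (\<xi> \<bullet>\<^sub>c - x))) * (exp (2 * pi * \<i> * (z \<bullet>\<^sub>c \<xi>)) * cfourier \<Phi> (z + x))"
    unfolding schrodinger_test_def[abs_def] S cs
      cfourier_translate[OF gs_entire_modulation[OF \<Phi>, of "- x"]] mod ..
  \<comment> \<open>The half phases make up for the changed order of translation and modulation: + i
    pi x.\<xi> on the left is - i pi x.\<xi> + 2 pi i x.\<xi> on the right.\<close>
  moreover have "exp (- (\<i> * pi * (\<xi> \<bullet>\<^sub>c - x))) * exp (2 * pi * \<i> * (z \<bullet>\<^sub>c \<xi>)) =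
      exp (- (\<i> * pi * (x \<bullet>\<^sub>c \<xi>))) * exp (2 * pi * \<i> * (\<xi> \<bullet>\<^sub>c (z + x)))"
    unfolding exp_add[symmetric] by (simp add: bdot_simps bdot_commute[of \<xi>] algebra_simps)
  ultimately show "schrodinger_test w \<tau> (\<lambda>z. ?c * cfourier \<Phi> z) z =
      ?c * cfourier (schrodinger_test (J_mat *v w) \<tau> \<Phi>) z"
    unfolding schrodinger_test_def x_def[symmetric] \<xi>_def[symmetric] by (simp add: mult_ac)
qed

section \<open>From the generators to the semigroup, and restriction to real points\<close>

lemma Mp_projection_intertwines: "Mp_projection A S \<Longrightarrow> intertwines A S"
proof (induction rule: Mp_projection.induct)
  case (gen A S)
  then show ?case
    by cases (auto intro: intertwines_fourier intertwines_dilation intertwines_chirp)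
qed (rule intertwines_comp)

lemma fst_snd_part_cvec: "fst_part (cvec z) = cvec (fst_part z)" "snd_part (cvec z) = cvec (snd_part z)"
  by (simp_all add: vec_eq_iff fst_part_def snd_part_def)

lemma schrodinger_dual_real:
  fixes f :: "'d::finite L2"
  shows "schrodinger_dual (cvec z) \<tau> (of_L2 f) = of_L2 (schrodinger_L2 z \<tau> f)"
proof (rule functional_eqI[OF schrodinger_dual_extensional of_L2_extensional])
  fix \<Phi> :: "complex^'d \<Rightarrow> complex" assume \<Phi>: "gs_entire \<Phi>"
  define x \<xi> where "x = fst_part z" and "\<xi> = snd_part z"
  define m where "m t = exp (2 * pi * \<i> * \<tau>) * exp (- (\<i> * pi * complex_of_real (x \<bullet> \<xi>))) *
       exp (2 * pi * \<i> * complex_of_real (\<xi> \<bullet> t))" for t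
  interpret weighted_composition m "\<lambda>t. t - x" 1 1
    unfolding m_def[abs_def] by (rule schrodinger_weighted_composition)
  have s: "schrodinger_L2 z \<tau> f = wc_op f"
    by (simp only: wc_op_def) (simp only: schrodinger_L2_def Let_def m_def x_def \<xi>_def)
  have [measurable]: "(\<lambda>t. \<Phi> (cvec t + v)) \<in> borel_measurable borel" for v
    by (rule gs_entire_measurable[OF \<Phi>])
  have "of_L2 (schrodinger_L2 z \<tau> f) (\<lambda>t. \<Phi> (cvec t)) = (LINT t|lborel. m t * rep_L2 f (t - x) * \<Phi> (cvec t))"
    unfolding of_L2_pairing[OF gs_entire_imp_gs_space[OF \<Phi>]] s
    by (rule pairing_wc_op[OF gs_space_sq_integrable[OF gs_entire_imp_gs_space[OF \<Phi>]]])
  \<comment> \<open>The integrand is written as a function of t - x, so that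
    \<open>integral_comp\<close> with \<kappa> = 1 performs the translation.\<close>
  also have "\<dots> = (LINT t|lborel. m (t - x + x) * rep_L2 f (t - x) * \<Phi> (cvec (t - x) + cvec x))" by simp
  also have "\<dots> = 1 *\<^sub>R (LINT t|lborel. m (t + x) * rep_L2 f t * \<Phi> (cvec t + cvec x))"
    by (rule integral_comp) measurable
  also have "\<dots> = pairing f (\<lambda>t. schrodinger_test (cvec z) \<tau> \<Phi> (cvec t))"
    unfolding pairing_def schrodinger_test_def fst_snd_part_cvec x_def[symmetric] \<xi>_def[symmetric] m_def
    by (simp add: bdot_simps inner_simps mult_ac)
  finally show "schrodinger_dual (cvec z) \<tau> (of_L2 f) (\<lambda>t. \<Phi> (cvec t)) = of_L2 (schrodinger_L2 z \<tau> f) (\<lambda>t. \<Phi> (cvec t))"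
    by (simp add: schrodinger_dual_of_L2[OF \<Phi>])
qed

theorem theorem5p1:
  fixes Shat :: "'d::finite L2 \<Rightarrow> 'd L2"
    and S :: "complex^('d + 'd)^('d + 'd)"
  assumes "Shat \<in> Mp_plus"
    and "S \<in> Sp_plus"
    and "Mp_projection Shat S"
  shows "(\<forall>f z \<tau>.
            of_L2 (Shat (schrodinger_L2 z \<tau> f))
              = schrodinger_dual (S *v cvec z) \<tau> (of_L2 (Shat f)) \<and>
            represented_by (schrodinger_dual (S *v cvec z) \<tau> (of_L2 (Shat f)))
              (Shat (schrodinger_L2 z \<tau> f)))
       \<and> (\<forall>z \<tau>.
            range Shat \<subseteq> {u. \<exists>g. represented_by (schrodinger_dual (S *v cvec z) \<tau> (of_L2 u)) g} \<and>
            schrodinger_partial (S *v cvec z) \<tau> \<circ> Shat = Shat \<circ> schrodinger_L2 z \<tau> \<and>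
            Shat \<circ> schrodinger_L2 z \<tau> \<in> bounded_ops)"
proof -
  \<comment> \<open>The premise of \<open>intertwines\<close> holds at \<open>cvec z\<close> with
    \<open>schrodinger_L2 z \<tau> f\<close> in the role of g.\<close>
  have eq: "schrodinger_dual (S *v cvec z) \<tau> (of_L2 (Shat f)) = of_L2 (Shat (schrodinger_L2 z \<tau> f))" for z \<tau> f
    using Mp_projection_intertwines[OF assms(3)] schrodinger_dual_real unfolding intertwines_def by blast
  \<comment> \<open>Injectivity of \<open>of_L2\<close> makes the representing class unique, so the
    definite description in \<open>schrodinger_partial\<close> denotes it.\<close>
  have rep: "represented_by (schrodinger_dual (S *v cvec z) \<tau> (of_L2 (Shat f))) g \<longleftrightarrow>
      g = Shat (schrodinger_L2 z \<tau> f)" for z \<tau> f g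
    unfolding represented_by_def eq using of_L2_gs_dual of_L2_inject by metis
  have "schrodinger_partial (S *v cvec z) \<tau> \<circ> Shat = Shat \<circ> schrodinger_L2 z \<tau>" for z \<tau>
    by (rule ext) (simp add: schrodinger_partial_def rep)
  moreover have "Shat \<circ> schrodinger_L2 z \<tau> \<in> bounded_ops" for z \<tau>
    by (rule bounded_ops_comp[OF Mp_plus_bounded[OF assms(1)] schrodinger_L2_bounded])
  ultimately show ?thesis by (auto simp: rep eq[symmetric])
qed

end
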